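(* Assume $\chi_{\rm res}\le\chi_0<1$. For every oversampling level $\ell$, the localization defect satisfies $$\frac{\Theta_\ell}{C_aC_{\rm syn}}\ \le\ \delta_\ell\ \le\ \frac{C_{\rm sd}}{c_W}\,\Theta_\ell .$$
   Context: **Problem.** $\Omega\subset\mathbb R^2$ is a bounded polygonal Lipschitz domain whose (fixed) boundary partition consists of relatively open parts $\Gamma_D,\Gamma_N,\Gamma_R$, disjoint up to endpoints, with $|\Gamma_R|>0$; $k\ge k_{\min}>0$. $V=\{v\in H^1(\Omega;\mathbb C): v|_{\Gamma_D}=0\}$. $L^2$ inner products are linear in the first and conjugate linear in the second argument. For $v,w\in V$, $$b_k(v,w)=(\nabla v,\nabla w)_\Omega+k^2(v,w)_\Omega,\quad \|v\|_k^2=b_k(v,v),\quad a(v,w)=(\nabla v,\nabla w)_\Omega-k^2(v,w)_\Omega-\mathrm i k(v,w)_{\Gamma_R}.$$ $C_a$ is a continuity constant: $|a(v,w)|\le C_a\|v\|_k\|w\|_k$ on $V$. $V_h^\star$ is the anti-dual of the space $V_h$ below. **Meshes and patches.** $\mathcal T_H$ and its refinement $\mathcal T_h$ are shape-regular conforming triangular meshes resolving the boundary partition; $V_H\subseteq V_h\subset V$ are the associated continuous piecewise affine spaces; $H|_T=H_T=\operatorname{diam}T$ for $T\in\mathcal T_H$; $\mathcal N_H$ is the set of all coarse vertices (including Dirichlet vertices). For a coarse entity or a union of entities $S$: $N^0(S)=S$, $N(S)=\bigcup\{T\in\mathcal T_H:\overline T\cap\overline S\ne\varnothing\}$, $N^m(S)=N(N^{m-1}(S))$;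 $N^\infty(T)=\Omega$; $C_{\rm patch}(m)=\max_{T}\#\{K\in\mathcal T_H:K\subseteq N^m(T)\}$. **Quasi-interpolation and kernel.** $I_H=E_H\Pi_H^{\rm dg}:V\to V_H$, where $\Pi_H^{\rm dg}$ is the elementwise $L^2$ projection onto discontinuous piecewise affine functions and, for coarse vertices $z$, $(E_Hq)(z)=0$ if $z\in\overline{\Gamma_D}$ and $(E_Hq)(z)=\big(\sum_{T\ni z}q|_T(z)|T|\big)/\big(\sum_{T\ni z}|T|\big)$ otherwise; $I_H$ is a projection onto $V_H$. $C_{\rm app}$ is such that $H_T^{-1}\|v-I_Hv\|_{L^2(T)}\le C_{\rm app}\|\nabla v\|_{L^2(N(T))}$. $W_h=\ker I_H\cap V_h$, $\chi_{\rm res}=C_{\rm app}C_{\rm patch}(1)^{1/2}\|kH\|_{L^\infty(\Omega)}$, $c_W=(1-\chi_{\rm res}^2)/(1+\chi_{\rm res}^2)$; $\chi_{\rm res}\le\chi_0<1$ implies $\operatorname{Re}a(w,w)\ge c_W\|w\|_k^2$ on $\ker I_H$. **Correctors.** Ideal correctors $\mathcal Q_\infty,\mathcal Q_\infty^*:V_h\to W_h$: $a(\mathcal Q_\infty v_h,w)=a(v_h,w)$, $a(w,\mathcal Q_\infty^*v_h)=a(w,v_h)$ for all $w\in W_h$. Localized correctors, $\ell\in\mathbb N_0\cup\{\infty\}$: let $a_T$ be $a$ with integrals restricted to $T\in\mathcal T_H$ (Robin integral over $\Gamma_R\cap\overline T$), $W_h(N^\ell(T))=\{w\in W_h:\operatorname{supp}w\subseteq\overline{N^\ell(T)}\}$;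 for $v_H\in V_H$, $q_{T,\ell}v_H,q_{T,\ell}^*v_H\in W_h(N^\ell(T))$ solve $a(q_{T,\ell}v_H,w)=a_T(v_H,w)$ and $a(w,q_{T,\ell}^*v_H)=a_T(w,v_H)$ for all $w\in W_h(N^\ell(T))$; $\mathcal Q_\ell=\sum_Tq_{T,\ell}$, $\mathcal Q_\ell^*=\sum_Tq_{T,\ell}^*$ on $V_H$ (consistent with the ideal correctors for $\ell=\infty$). $T_\ell^*=I-\mathcal Q_\ell^*$. **Localization defect.** $\mathcal D_\ell=\mathcal Q_\infty-\mathcal Q_\ell$ and $\mathcal D_\ell^*=\mathcal Q_\infty^*-\mathcal Q_\ell^*$ on $V_H$; $\delta_\ell:=\|\mathcal D_\ell\|_{\mathcal L(V_H,V_h)}=\|\mathcal D_\ell^*\|_{\mathcal L(V_H,V_h)}$, operator norms with respect to $\|\cdot\|_k$ (the two coincide, since the primal and adjoint correctors are related by complex conjugation). **Local spaces, constants, indicator.** For $z\in\mathcal N_H$, $W_{h,z}=\{w\in W_h:\operatorname{supp}w\subseteq\overline{N^2(z)}\}$. $C_{\rm sd},C_{\rm syn}$ are constants (depending only on $\chi_0$, coarse- and fine-mesh shape regularity and fixed-order patch overlap) such that every $w\in W_h$ can be written $w=\sum_{z\in\mathcal N_H}w_z$, $w_z\in W_{h,z}$, with $\sum_z\|w_z\|_k^2\le C_{\rm sd}^2\|w\|_k^2$, and such that arbitrary $w_z\in W_{h,z}$ satisfy $\|\sum_zw_z\|_k^2\le C_{\rm syn}^2\sum_z\|w_z\|_k^2$.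 For $G\in V_h^\star$, $\xi_z(G)\in W_{h,z}$ is defined by $b_k(\xi_z(G),w)=G(w)$ for $w\in W_{h,z}$, and $\eta(G)^2=\sum_{z\in\mathcal N_H}\|\xi_z(G)\|_k^2$. Finally, $G_\ell(v_H)(w)=\overline{a(w,T_\ell^*v_H)}$ for $v_H\in V_H$, and $$\Theta_\ell=\sup_{0\ne v_H\in V_H}\frac{\eta(G_\ell(v_H))}{\|v_H\|_k}.$$ *)

theory Defs
  imports "HOL-Analysis.Analysis" "HOL-Library.Extended_Nat"
begin

type_synonym point = "real ^ 2"
type_synonym cfun = "real ^ 2 \<Rightarrow> complex"

record lod_problem =
  Om :: "point set"
  bedges :: "(point \<times> point) set"  \<comment> \<open>edges of the polygon, as pairs of end points\<close>
  GamD :: "point set"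
  GamN :: "point set"
  GamR :: "point set"
  wavenum :: real
  coarse_mesh :: "point set set"  \<comment> \<open>coarse mesh, consisting of closed triangles\<close>
  fine_mesh :: "point set set"


section \<open>Domain and boundary\<close>

definition lipschitz_domain :: "point set \<Rightarrow> bool" where
  "lipschitz_domain \<Omega> \<longleftrightarrow> open \<Omega> \<and> connected \<Omega> \<and> \<Omega> \<noteq> {} \<and>
     (\<forall>x\<in>frontier \<Omega>. \<exists>U e f \<gamma> L. open U \<and> x \<in> U \<and>
        norm e = 1 \<and> norm f = 1 \<and> e \<bullet> f = 0 \<and> L-lipschitz_on (UNIV :: real set) \<gamma> \<and>
        \<Omega> \<inter> U = {y \<in> U. \<gamma> (y \<bullet> e) < y \<bullet> f})"

definition polygonal_boundary :: "point set \<Rightarrow> (point \<times> point) set \<Rightarrow> bool" where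
  "polygonal_boundary \<Omega> E \<longleftrightarrow> finite E \<and> (\<forall>(p, q)\<in>E. p \<noteq> q) \<and>
     pairwise (\<lambda>(p, q) (p', q'). open_segment p q \<inter> open_segment p' q' = {}) E \<and>
     frontier \<Omega> = (\<Union>(p, q)\<in>E. closed_segment p q)"

text \<open>Arc length on the boundary, through the affine parametrisations of the edges of the polygon.\<close>

definition arc_length :: "(point \<times> point) set \<Rightarrow> point set \<Rightarrow> real" where
  "arc_length E S = (\<Sum>(p, q)\<in>E. dist p q * measure lebesgue {t \<in> {0..1}. linepath p q t \<in> S})"

definition arc_integral :: "(point \<times> point) set \<Rightarrow> point set \<Rightarrow> cfun \<Rightarrow> complex" where
  "arc_integral E S f = (\<Sum>(p, q)\<in>E. of_real (dist p q) *
     (LINT t|lebesgue_on {0..1}. (if linepath p q t \<in> S then f (linepath p q t) else 0)))"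

definition arc_AE :: "(point \<times> point) set \<Rightarrow> (point \<Rightarrow> bool) \<Rightarrow> bool" where
  "arc_AE E R \<longleftrightarrow> (\<forall>(p, q)\<in>E. AE t in lebesgue_on {0..1}. R (linepath p q t))"

text \<open>``Disjoint up to end points'': the relatively open parts are disjoint and miss only
  finitely many boundary points.\<close>

definition boundary_partition ::
    "point set \<Rightarrow> point set \<Rightarrow> point set \<Rightarrow> point set \<Rightarrow> bool" where
  "boundary_partition \<Omega> GD GN GR \<longleftrightarrow>
     openin (top_of_set (frontier \<Omega>)) GD \<and>
     openin (top_of_set (frontier \<Omega>)) GN \<and>
     openin (top_of_set (frontier \<Omega>)) GR \<and>
     GD \<inter> GN = {} \<and> GD \<inter> GR = {} \<and> GN \<inter> GR = {} \<and>
     finite (frontier \<Omega> - (GD \<union> GN \<union> GR))"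


section \<open>Sobolev space\<close>

definition partial :: "2 \<Rightarrow> (point \<Rightarrow> real) \<Rightarrow> point \<Rightarrow> real" where
  "partial i f x = frechet_derivative f (at x) (axis i 1)"

text \<open>Partial derivatives of every order exist and are differentiable, that is, \<open>f\<close> is
  infinitely differentiable.\<close>

definition smooth :: "(point \<Rightarrow> real) \<Rightarrow> bool" where
  "smooth f \<longleftrightarrow> (\<forall>js x. foldr partial js f differentiable (at x))"

definition test_functions :: "point set \<Rightarrow> (point \<Rightarrow> real) set" where
  "test_functions \<Omega> = {\<phi>. smooth \<phi> \<and>
     compact (closure {x. \<phi> x \<noteq> 0}) \<and> closure {x. \<phi> x \<noteq> 0} \<subseteq> \<Omega>}"

definition L2 :: "point set \<Rightarrow> cfun set" where
  "L2 S = {v. v \<in> borel_measurable (lebesgue_on S) \<and>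
              integrable (lebesgue_on S) (\<lambda>x. (cmod (v x))\<^sup>2)}"

definition is_weak_gradient :: "point set \<Rightarrow> cfun \<Rightarrow> (point \<Rightarrow> complex ^ 2) \<Rightarrow> bool" where
  "is_weak_gradient \<Omega> v g \<longleftrightarrow> (\<forall>i. (\<lambda>x. g x $ i) \<in> L2 \<Omega>) \<and>
     (\<forall>\<phi>\<in>test_functions \<Omega>. \<forall>i.
        (LINT x|lebesgue_on \<Omega>. v x * of_real (partial i \<phi> x)) =
        - (LINT x|lebesgue_on \<Omega>. g x $ i * of_real (\<phi> x)))"

text \<open>Elements of \<open>H1 \<Omega>\<close> are representatives; values outside \<open>\<Omega>\<close> are irrelevant.  The
  weak gradient is unique almost everywhere in \<open>\<Omega>\<close>, and only its integrals are used.\<close>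

definition H1 :: "point set \<Rightarrow> cfun set" where
  "H1 \<Omega> = {v \<in> L2 \<Omega>. \<exists>g. is_weak_gradient \<Omega> v g}"

definition wgrad :: "point set \<Rightarrow> cfun \<Rightarrow> point \<Rightarrow> complex ^ 2" where
  "wgrad \<Omega> v = (SOME g. is_weak_gradient \<Omega> v g)"

text \<open>Boundary trace.  On a Lipschitz domain the trace of an \<open>H1\<close> function is, at almost every
  boundary point, the limit of the mean values over small balls intersected with the domain; for
  a function that is continuous up to the boundary it is the restriction.\<close>

definition bdtrace :: "point set \<Rightarrow> cfun \<Rightarrow> cfun" where
  "bdtrace \<Omega> v x = Lim (at_right 0)
     (\<lambda>r. (LINT y|lebesgue_on (\<Omega> \<inter> ball x r). v y) / of_real (measure lebesgue (\<Omega> \<inter> ball x r)))"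

definition Vspace :: "lod_problem \<Rightarrow> cfun set" where
  "Vspace P = {v \<in> H1 (Om P). arc_AE (bedges P) (\<lambda>x. x \<in> GamD P \<longrightarrow> bdtrace (Om P) v x = 0)}"


section \<open>Sesquilinear forms and norms\<close>

definition ip :: "point set \<Rightarrow> cfun \<Rightarrow> cfun \<Rightarrow> complex" where
  "ip S v w = (LINT x|lebesgue_on S. v x * cnj (w x))"

definition grad_ip :: "lod_problem \<Rightarrow> point set \<Rightarrow> cfun \<Rightarrow> cfun \<Rightarrow> complex" where
  "grad_ip P S v w =
     (LINT x|lebesgue_on S. (\<Sum>i\<in>UNIV. wgrad (Om P) v x $ i * cnj (wgrad (Om P) w x $ i)))"

definition L2norm :: "point set \<Rightarrow> cfun \<Rightarrow> real" where
  "L2norm S v = sqrt (Re (ip S v v))"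

definition grad_norm :: "lod_problem \<Rightarrow> point set \<Rightarrow> cfun \<Rightarrow> real" where
  "grad_norm P S v = sqrt (Re (grad_ip P S v v))"

definition bform :: "lod_problem \<Rightarrow> cfun \<Rightarrow> cfun \<Rightarrow> complex" where
  "bform P v w = grad_ip P (Om P) v w + of_real ((wavenum P)\<^sup>2) * ip (Om P) v w"

definition knorm :: "lod_problem \<Rightarrow> cfun \<Rightarrow> real" where
  "knorm P v = sqrt (Re (bform P v v))"

text \<open>The Helmholtz form with volume integrals over \<open>S\<close> and Robin integral over \<open>R\<close>.\<close>

definition aform_on :: "lod_problem \<Rightarrow> point set \<Rightarrow> point set \<Rightarrow> cfun \<Rightarrow> cfun \<Rightarrow> complex" where
  "aform_on P S R v w = grad_ip P S v w - of_real ((wavenum P)\<^sup>2) * ip S v w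
     - \<i> * of_real (wavenum P) *
       arc_integral (bedges P) R (\<lambda>x. bdtrace (Om P) v x * cnj (bdtrace (Om P) w x))"

definition aform :: "lod_problem \<Rightarrow> cfun \<Rightarrow> cfun \<Rightarrow> complex" where
  "aform P = aform_on P (Om P) (GamR P)"

definition aform_loc :: "lod_problem \<Rightarrow> point set \<Rightarrow> cfun \<Rightarrow> cfun \<Rightarrow> complex" where
  "aform_loc P T = aform_on P T (GamR P \<inter> closure T)"


section \<open>Meshes and finite element spaces\<close>

definition vertices :: "point set set \<Rightarrow> point set" where
  "vertices \<T> = {z. \<exists>T\<in>\<T>. z extreme_point_of T}"

definition conforming_mesh :: "point set \<Rightarrow> point set set \<Rightarrow> bool" where
  "conforming_mesh \<Omega> \<T> \<longleftrightarrow> triangulation \<T> \<and> (\<forall>T\<in>\<T>. 2 simplex T) \<and> \<Union>\<T> = closure \<Omega>"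

text \<open>Every triangle contains a ball of radius at least its diameter divided by \<open>\<kappa>\<close>.\<close>

definition shape_regular :: "real \<Rightarrow> point set set \<Rightarrow> bool" where
  "shape_regular \<kappa> \<T> \<longleftrightarrow> 0 < \<kappa> \<and> (\<forall>T\<in>\<T>. \<exists>x. ball x (diameter T / \<kappa>) \<subseteq> T)"

definition resolves_boundary :: "lod_problem \<Rightarrow> point set set \<Rightarrow> bool" where
  "resolves_boundary P \<T> \<longleftrightarrow> (\<forall>T\<in>\<T>. \<forall>F. F edge_of T \<and> F \<subseteq> frontier (Om P) \<longrightarrow>
     F \<subseteq> closure (GamD P) \<or> F \<subseteq> closure (GamN P) \<or> F \<subseteq> closure (GamR P))"

definition refines :: "point set set \<Rightarrow> point set set \<Rightarrow> bool" where
  "refines \<T>' \<T> \<longleftrightarrow> (\<forall>T'\<in>\<T>'. \<exists>T\<in>\<T>. T' \<subseteq> T)"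

definition affine_funs :: "cfun set" where
  "affine_funs = {p. \<exists>\<alpha> \<beta> \<gamma>. p = (\<lambda>x. \<alpha> + \<beta> * of_real (x $ 1) + \<gamma> * of_real (x $ 2))}"

text \<open>Finite element functions are represented by their continuous version on the closure of the
  domain, extended by zero, so that equality of functions is equality in the space.\<close>

definition fe_space :: "lod_problem \<Rightarrow> point set set \<Rightarrow> cfun set" where
  "fe_space P \<T> = {v \<in> Vspace P. continuous_on (closure (Om P)) v \<and>
     (\<forall>T\<in>\<T>. \<exists>p\<in>affine_funs. \<forall>x\<in>T. v x = p x) \<and> (\<forall>x. x \<notin> closure (Om P) \<longrightarrow> v x = 0)}"

abbreviation V_H :: "lod_problem \<Rightarrow> cfun set" where
  "V_H P \<equiv> fe_space P (coarse_mesh P)"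

abbreviation V_h :: "lod_problem \<Rightarrow> cfun set" where
  "V_h P \<equiv> fe_space P (fine_mesh P)"

definition nbhd :: "point set set \<Rightarrow> point set \<Rightarrow> point set" where
  "nbhd \<T> S = \<Union>{T \<in> \<T>. closure T \<inter> closure S \<noteq> {}}"

definition patch :: "lod_problem \<Rightarrow> enat \<Rightarrow> point set \<Rightarrow> point set" where
  "patch P l S = (case l of enat m \<Rightarrow> (nbhd (coarse_mesh P) ^^ m) S | \<infinity> \<Rightarrow> Om P)"

definition C_patch :: "lod_problem \<Rightarrow> nat \<Rightarrow> nat" where
  "C_patch P m = Max ((\<lambda>T. card {K \<in> coarse_mesh P. K \<subseteq> patch P (enat m) T}) ` coarse_mesh P)"

text \<open>On the interior of each triangle the choice below is unique.\<close>

definition mesh_size :: "point set set \<Rightarrow> point \<Rightarrow> real" where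
  "mesh_size \<T> x = diameter (SOME T. T \<in> \<T> \<and> x \<in> T)"

definition Linf_norm :: "point set \<Rightarrow> (point \<Rightarrow> real) \<Rightarrow> real" where
  "Linf_norm S f = Inf {c. 0 \<le> c \<and> (AE x in lebesgue_on S. \<bar>f x\<bar> \<le> c)}"


section \<open>Quasi-interpolation and its kernel\<close>

definition dg_proj :: "cfun \<Rightarrow> point set \<Rightarrow> cfun" where
  "dg_proj v T = (THE p. p \<in> affine_funs \<and> (\<forall>q\<in>affine_funs. ip T (\<lambda>x. v x - p x) q = 0))"

text \<open>\<open>q T\<close> is the affine function whose restriction to \<open>T\<close> is the discontinuous function at hand.\<close>

definition avg_nodal :: "lod_problem \<Rightarrow> (point set \<Rightarrow> cfun) \<Rightarrow> cfun" where
  "avg_nodal P q z = (if z \<in> closure (GamD P) then 0 else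
     (\<Sum>T\<in>{T \<in> coarse_mesh P. z \<in> T}. q T z * of_real (measure lebesgue T)) /
     of_real (\<Sum>T\<in>{T \<in> coarse_mesh P. z \<in> T}. measure lebesgue T))"

text \<open>Continuous piecewise affine function with nodal values \<open>c\<close>; by conformity the choice of
  the triangle containing \<open>x\<close> is immaterial.\<close>

definition pw_affine_interp :: "point set set \<Rightarrow> cfun \<Rightarrow> cfun" where
  "pw_affine_interp \<T> c x = (if x \<in> \<Union>\<T> then
     (let T = (SOME T. T \<in> \<T> \<and> x \<in> T)
      in (THE p. p \<in> affine_funs \<and> (\<forall>z. z extreme_point_of T \<longrightarrow> p z = c z)) x)
     else 0)"

definition I_H :: "lod_problem \<Rightarrow> cfun \<Rightarrow> cfun" where
  "I_H P v = pw_affine_interp (coarse_mesh P) (avg_nodal P (dg_proj v))"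

definition W_h :: "lod_problem \<Rightarrow> cfun set" where
  "W_h P = {w \<in> V_h P. I_H P w = (\<lambda>x. 0)}"

definition chi_res :: "lod_problem \<Rightarrow> real \<Rightarrow> real" where
  "chi_res P Capp = Capp * sqrt (real (C_patch P 1)) *
     Linf_norm (Om P) (\<lambda>x. wavenum P * mesh_size (coarse_mesh P) x)"

definition c_W :: "lod_problem \<Rightarrow> real \<Rightarrow> real" where
  "c_W P Capp = (1 - (chi_res P Capp)\<^sup>2) / (1 + (chi_res P Capp)\<^sup>2)"


section \<open>Correctors and localization defect\<close>

definition supp :: "cfun \<Rightarrow> point set" where
  "supp w = closure {x. w x \<noteq> 0}"

definition W_loc :: "lod_problem \<Rightarrow> enat \<Rightarrow> point set \<Rightarrow> cfun set" where
  "W_loc P l S = {w \<in> W_h P. supp w \<subseteq> closure (patch P l S)}"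

definition Q_ideal :: "lod_problem \<Rightarrow> cfun \<Rightarrow> cfun" where
  "Q_ideal P v = (THE q. q \<in> W_h P \<and> (\<forall>w\<in>W_h P. aform P q w = aform P v w))"

definition q_loc :: "lod_problem \<Rightarrow> enat \<Rightarrow> point set \<Rightarrow> cfun \<Rightarrow> cfun" where
  "q_loc P l T v = (THE q. q \<in> W_loc P l T \<and>
     (\<forall>w\<in>W_loc P l T. aform P q w = aform_loc P T v w))"

definition q_loc_adj :: "lod_problem \<Rightarrow> enat \<Rightarrow> point set \<Rightarrow> cfun \<Rightarrow> cfun" where
  "q_loc_adj P l T v = (THE q. q \<in> W_loc P l T \<and>
     (\<forall>w\<in>W_loc P l T. aform P w q = aform_loc P T w v))"

definition Q_loc :: "lod_problem \<Rightarrow> enat \<Rightarrow> cfun \<Rightarrow> cfun" where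
  "Q_loc P l v = (\<lambda>x. \<Sum>T\<in>coarse_mesh P. q_loc P l T v x)"

definition Q_loc_adj :: "lod_problem \<Rightarrow> enat \<Rightarrow> cfun \<Rightarrow> cfun" where
  "Q_loc_adj P l v = (\<lambda>x. \<Sum>T\<in>coarse_mesh P. q_loc_adj P l T v x)"

definition T_adj :: "lod_problem \<Rightarrow> enat \<Rightarrow> cfun \<Rightarrow> cfun" where
  "T_adj P l v = (\<lambda>x. v x - Q_loc_adj P l v x)"

definition defect :: "lod_problem \<Rightarrow> enat \<Rightarrow> cfun \<Rightarrow> cfun" where
  "defect P l v = (\<lambda>x. Q_ideal P v x - Q_loc P l v x)"

text \<open>The inserted 0 fixes the value of the suprema for \<open>V_H P = {0}\<close>; otherwise it has no
  effect, since all quotients are nonnegative.\<close>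

definition delta :: "lod_problem \<Rightarrow> enat \<Rightarrow> real" where
  "delta P l = Sup (insert 0
     {knorm P (defect P l v) / knorm P v | v. v \<in> V_H P \<and> v \<noteq> (\<lambda>x. 0)})"


section \<open>Residual indicator\<close>

definition W_vertex :: "lod_problem \<Rightarrow> point \<Rightarrow> cfun set" where
  "W_vertex P z = W_loc P (enat 2) {z}"

definition xi :: "lod_problem \<Rightarrow> (cfun \<Rightarrow> complex) \<Rightarrow> point \<Rightarrow> cfun" where
  "xi P G z = (THE \<xi>. \<xi> \<in> W_vertex P z \<and> (\<forall>w\<in>W_vertex P z. bform P \<xi> w = G w))"

definition eta :: "lod_problem \<Rightarrow> (cfun \<Rightarrow> complex) \<Rightarrow> real" where
  "eta P G = sqrt (\<Sum>z\<in>vertices (coarse_mesh P). (knorm P (xi P G z))\<^sup>2)"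

definition G_res :: "lod_problem \<Rightarrow> enat \<Rightarrow> cfun \<Rightarrow> cfun \<Rightarrow> complex" where
  "G_res P l v w = cnj (aform P w (T_adj P l v))"

definition Theta :: "lod_problem \<Rightarrow> enat \<Rightarrow> real" where
  "Theta P l = Sup (insert 0
     {eta P (G_res P l v) / knorm P v | v. v \<in> V_H P \<and> v \<noteq> (\<lambda>x. 0)})"


section \<open>Standing assumptions\<close>

definition lod_setting :: "lod_problem \<Rightarrow> bool" where
  "lod_setting P \<longleftrightarrow>
     lipschitz_domain (Om P) \<and> bounded (Om P) \<and> polygonal_boundary (Om P) (bedges P) \<and>
     boundary_partition (Om P) (GamD P) (GamN P) (GamR P) \<and>
     0 < arc_length (bedges P) (GamR P) \<and>
     conforming_mesh (Om P) (coarse_mesh P) \<and> resolves_boundary P (coarse_mesh P) \<and>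
     conforming_mesh (Om P) (fine_mesh P) \<and> resolves_boundary P (fine_mesh P) \<and>
     refines (fine_mesh P) (coarse_mesh P)"

definition continuity_const :: "lod_problem \<Rightarrow> real \<Rightarrow> bool" where
  "continuity_const P Ca \<longleftrightarrow>
     (\<forall>v\<in>Vspace P. \<forall>w\<in>Vspace P. cmod (aform P v w) \<le> Ca * knorm P v * knorm P w)"

definition approximation_const :: "lod_problem \<Rightarrow> real \<Rightarrow> bool" where
  "approximation_const P Capp \<longleftrightarrow>
     (\<forall>v\<in>Vspace P. \<forall>T\<in>coarse_mesh P.
        L2norm T (\<lambda>x. v x - I_H P v x) / diameter T \<le> Capp * grad_norm P (nbhd (coarse_mesh P) T) v)"

definition stable_decomposition_const :: "lod_problem \<Rightarrow> real \<Rightarrow> bool" where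
  "stable_decomposition_const P Csd \<longleftrightarrow>
     (\<forall>w\<in>W_h P. \<exists>wz. (\<forall>z\<in>vertices (coarse_mesh P). wz z \<in> W_vertex P z) \<and>
        w = (\<lambda>x. \<Sum>z\<in>vertices (coarse_mesh P). wz z x) \<and>
        (\<Sum>z\<in>vertices (coarse_mesh P). (knorm P (wz z))\<^sup>2) \<le> Csd\<^sup>2 * (knorm P w)\<^sup>2)"

definition synthesis_const :: "lod_problem \<Rightarrow> real \<Rightarrow> bool" where
  "synthesis_const P Csyn \<longleftrightarrow>
     (\<forall>wz. (\<forall>z\<in>vertices (coarse_mesh P). wz z \<in> W_vertex P z) \<longrightarrow>
        (knorm P (\<lambda>x. \<Sum>z\<in>vertices (coarse_mesh P). wz z x))\<^sup>2
          \<le> Csyn\<^sup>2 * (\<Sum>z\<in>vertices (coarse_mesh P). (knorm P (wz z))\<^sup>2))"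

end

theory Submission
  imports Defs
begin

text \<open>
  The localization defect is compared with the indicator through one identity.  Let \<open>v\<close> be a coarse function
  and let \<open>u\<close> be the difference of its ideal and its localized adjoint corrector, an element of \<open>W_h\<close>.  For
  \<open>w\<close> in \<open>W_h\<close> the ideal adjoint corrector reproduces \<open>a(w, v)\<close>, hence \<open>a(w, T_adj v) = a(w, u)\<close>: on \<open>W_h\<close> the
  residual is the functional that \<open>a\<close> associates with the adjoint defect (\<open>residual_eq\<close>).

  Let \<open>\<xi>\<^sub>z\<close> be the local representatives of the residual with respect to \<open>b\<close>.  Testing the residual with their sum gives
  \<open>\<eta>\<^sup>2\<close>, which continuity and synthesis bound by \<open>C_a C_syn \<eta> \<parallel>u\<parallel>\<close> (\<open>efficiency\<close>).  Testing it with \<open>u\<close>, decomposed as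
  \<open>u = \<Sum>\<^sub>z u\<^sub>z\<close>, gives at least \<open>c_W \<parallel>u\<parallel>\<^sup>2\<close> by coercivity and at most \<open>\<Sum>\<^sub>z \<parallel>\<xi>\<^sub>z\<parallel> \<parallel>u\<^sub>z\<parallel> \<le> C_sd \<eta> \<parallel>u\<parallel>\<close> by the Cauchy-Schwarz
  inequality (\<open>reliability\<close>).  These bounds concern the adjoint defect, whereas \<open>delta\<close> is the norm of the primal
  one.  The two have the same norm because conjugation maps primal corrector problems to adjoint ones
  (\<open>q_loc_adj_eq\<close>), and the suprema over the coarse space are finite because that space is
  finite-dimensional (\<open>defect_bounded\<close>).

  The larger part of the work is to see that the objects behave as this argument presupposes.  Correctors,
  representatives and elementwise projections are definite descriptions; they exist uniquely by a
  representation lemma for definite forms on spaces of functions that are determined by finitely many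
  point values (\<open>riesz_ex1\<close>).  The forms are sesquilinear because weak gradients are unique almost everywhere
  (\<open>weak_gradient_unique\<close>), which rests on smooth bumps approximating boxes, and because the trace of a
  finite element function is its restriction to the boundary (\<open>bdtrace_continuous\<close>).  Coercivity on \<open>W_h\<close>
  with constant \<open>c_W\<close> follows from the approximation property and the overlap of neighbourhoods
  (\<open>resolution_estimate\<close>).
\<close>

section \<open>Sesquilinear forms on spaces determined by point values\<close>

text \<open>Closure under \<open>u + c v\<close> covers sums and scalar multiples at once; below, linearity of maps and forms is
  likewise expressed through this one operation.\<close>

definition csubspace :: "('a \<Rightarrow> complex) set \<Rightarrow> bool" where
  "csubspace W \<longleftrightarrow> (\<lambda>x. 0) \<in> W \<and> (\<forall>c. \<forall>u\<in>W. \<forall>v\<in>W. (\<lambda>x. u x + c * v x) \<in> W)"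

text \<open>Finite dimension is used only in this form: for finite \<open>S\<close>, an element of \<open>W\<close> is known from finitely
  many values, as a finite element function is known from its values at the vertices.  Induction on \<open>S\<close>
  then replaces any choice of a basis.\<close>

definition determined_on :: "'a set \<Rightarrow> ('a \<Rightarrow> complex) set \<Rightarrow> bool" where
  "determined_on S W \<longleftrightarrow> (\<forall>w\<in>W. (\<forall>s\<in>S. w s = 0) \<longrightarrow> w = (\<lambda>x. 0))"

definition antilinear_on :: "('a \<Rightarrow> complex) set \<Rightarrow> (('a \<Rightarrow> complex) \<Rightarrow> complex) \<Rightarrow> bool" where
  "antilinear_on W F \<longleftrightarrow> (\<forall>c. \<forall>u\<in>W. \<forall>v\<in>W. F (\<lambda>x. u x + c * v x) = F u + cnj c * F v)"

text \<open>Linearity in the first argument is phrased as antilinearity of the conjugate, so that facts about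
  antilinear functionals apply to both arguments.\<close>

definition sesquilinear_on ::
    "('a \<Rightarrow> complex) set \<Rightarrow> (('a \<Rightarrow> complex) \<Rightarrow> ('a \<Rightarrow> complex) \<Rightarrow> complex) \<Rightarrow> bool" where
  "sesquilinear_on W B \<longleftrightarrow>
     (\<forall>w\<in>W. antilinear_on W (B w) \<and> antilinear_on W (\<lambda>v. cnj (B v w)))"

lemma csubspace_zero: "csubspace W \<Longrightarrow> (\<lambda>x. 0) \<in> W"
  by (simp add: csubspace_def)

lemma csubspace_axpy: "csubspace W \<Longrightarrow> u \<in> W \<Longrightarrow> v \<in> W \<Longrightarrow> (\<lambda>x. u x + c * v x) \<in> W"
  by (simp add: csubspace_def)

lemma csubspace_add: "csubspace W \<Longrightarrow> u \<in> W \<Longrightarrow> v \<in> W \<Longrightarrow> (\<lambda>x. u x + v x) \<in> W"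
  using csubspace_axpy[of W u v 1] by simp

lemma csubspace_diff: "csubspace W \<Longrightarrow> u \<in> W \<Longrightarrow> v \<in> W \<Longrightarrow> (\<lambda>x. u x - v x) \<in> W"
  using csubspace_axpy[of W u v "-1"] by simp

lemma csubspace_sum:
  assumes "csubspace W" "\<And>i. i \<in> I \<Longrightarrow> f i \<in> W"
  shows "(\<lambda>x. \<Sum>i\<in>I. f i x) \<in> W"
  using assms(2)
proof (induction I rule: infinite_finite_induct)
  case (insert i I)
  then show ?case using csubspace_add[OF assms(1), of "f i" "\<lambda>x. \<Sum>i\<in>I. f i x"] by simp
qed (use csubspace_zero[OF assms(1)] in auto)

lemma antilinear_onD:
  "antilinear_on W F \<Longrightarrow> u \<in> W \<Longrightarrow> v \<in> W \<Longrightarrow> F (\<lambda>x. u x + c * v x) = F u + cnj c * F v"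
  by (simp add: antilinear_on_def)

lemma antilinear_on_zero:
  assumes "csubspace W" "antilinear_on W F"
  shows "F (\<lambda>x. 0) = 0"
  using antilinear_onD[OF assms(2), of "\<lambda>x. 0" "\<lambda>x. 0" 1] csubspace_zero[OF assms(1)] by simp

lemma antilinear_on_diff:
  assumes "antilinear_on W F" "u \<in> W" "v \<in> W"
  shows "F (\<lambda>x. u x - v x) = F u - F v"
  using antilinear_onD[OF assms, of "-1"] by simp

lemma antilinear_on_sum:
  assumes "csubspace W" "antilinear_on W F" "\<And>i. i \<in> I \<Longrightarrow> f i \<in> W"
  shows "F (\<lambda>x. \<Sum>i\<in>I. f i x) = (\<Sum>i\<in>I. F (f i))"
  using assms(3)
proof (induction I rule: infinite_finite_induct)
  case (insert i I)
  then show ?case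
    using antilinear_onD[OF assms(2), of "f i" "\<lambda>x. \<Sum>i\<in>I. f i x" 1]
      csubspace_sum[OF assms(1), of I f] by simp
qed (use antilinear_on_zero[OF assms(1,2)] in auto)

lemma antilinear_on_subset: "antilinear_on W F \<Longrightarrow> U \<subseteq> W \<Longrightarrow> antilinear_on U F"
  unfolding antilinear_on_def by blast

lemma determined_on_subset: "determined_on S W \<Longrightarrow> U \<subseteq> W \<Longrightarrow> determined_on S U"
  by (auto simp: determined_on_def)

lemma sesquilinear_on_subset: "sesquilinear_on W B \<Longrightarrow> U \<subseteq> W \<Longrightarrow> sesquilinear_on U B"
  unfolding sesquilinear_on_def using antilinear_on_subset by blast

lemma sesquilinear_on_antilinear: "sesquilinear_on W B \<Longrightarrow> w \<in> W \<Longrightarrow> antilinear_on W (B w)"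
  by (simp add: sesquilinear_on_def)

lemma sesquilinear_on_antilinear_cnj:
  "sesquilinear_on W B \<Longrightarrow> w \<in> W \<Longrightarrow> antilinear_on W (\<lambda>v. cnj (B v w))"
  by (simp add: sesquilinear_on_def)

lemma sesquilinear_on_right:
  "sesquilinear_on W B \<Longrightarrow> w \<in> W \<Longrightarrow> u \<in> W \<Longrightarrow> v \<in> W \<Longrightarrow>
     B w (\<lambda>x. u x + c * v x) = B w u + cnj c * B w v"
  using antilinear_onD[of W "B w" u v c] sesquilinear_on_antilinear by blast

lemma sesquilinear_on_left:
  assumes "sesquilinear_on W B" "w \<in> W" "u \<in> W" "v \<in> W"
  shows "B (\<lambda>x. u x + c * v x) w = B u w + c * B v w"
proof -
  have "cnj (B (\<lambda>x. u x + c * v x) w) = cnj (B u w + c * B v w)"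
    using antilinear_onD[OF sesquilinear_on_antilinear_cnj[OF assms(1,2)] assms(3,4), of c] by simp
  then show ?thesis by (simp only: complex_cnj_cancel_iff)
qed

lemma sesquilinear_on_left_diff:
  assumes "sesquilinear_on W B" "w \<in> W" "u \<in> W" "v \<in> W"
  shows "B (\<lambda>x. u x - v x) w = B u w - B v w"
  using sesquilinear_on_left[OF assms, of "-1"] by simp

text \<open>A definite form on a finite-dimensional space represents every antilinear functional.  The lemma is
  stated for definite forms to serve the coercive form \<open>a\<close>, the inner product \<open>b\<close> and
  the \<open>L\<^sup>2\<close> projections.  In the induction step the functions of \<open>W\<close> that vanish at the new point \<open>s\<close> form a subspace
  \<open>U\<close> of codimension at most one, on which the problem is solvable.  Some \<open>d\<close> with \<open>B d w = 0\<close> for all \<open>w\<close> in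
  \<open>U\<close> complements \<open>U\<close>, so a multiple of \<open>d\<close> can be added to the solution on \<open>U\<close> without disturbing it.\<close>

lemma riesz_existence:
  assumes "finite S" "csubspace W" "determined_on S W" "sesquilinear_on W B"
    and "\<And>w. w \<in> W \<Longrightarrow> w \<noteq> (\<lambda>x. 0) \<Longrightarrow> B w w \<noteq> 0" and "antilinear_on W F"
  shows "\<exists>q\<in>W. \<forall>w\<in>W. B q w = F w"
  using assms
proof (induction S arbitrary: W F rule: finite_induct)
  case empty
  then have "W = {\<lambda>x. 0}" by (auto simp: determined_on_def csubspace_def)
  moreover have "B (\<lambda>x. 0) (\<lambda>x. 0) = 0" "F (\<lambda>x. 0) = 0"
    using antilinear_on_zero[OF \<open>csubspace W\<close>] empty sesquilinear_on_antilinear csubspace_zero by blast+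
  ultimately show ?case by simp
next
  case (insert s S)
  define U where "U = {w \<in> W. w s = 0}"
  have sub: "U \<subseteq> W" by (auto simp: U_def)
  have csU: "csubspace U" using insert.prems(1) by (auto simp: U_def csubspace_def)
  have detU: "determined_on S U" using insert.prems(2) by (auto simp: U_def determined_on_def)
  have sU: "sesquilinear_on U B" by (rule sesquilinear_on_subset[OF insert.prems(3) sub])
  have solveU: "\<exists>q\<in>U. \<forall>w\<in>U. B q w = G w" if "antilinear_on W G" for G
    by (rule insert.IH[OF csU detU sU _ antilinear_on_subset[OF that sub]])
       (use insert.prems(4) sub in auto)
  show ?case
  proof (cases "U = W")
    case True
    then show ?thesis using solveU insert.prems(5) by blast
  next
    case False
    then obtain e where e: "e \<in> W" "e s \<noteq> 0" by (auto simp: U_def)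
    obtain q where q: "q \<in> U" "\<And>w. w \<in> U \<Longrightarrow> B q w = F w"
      using solveU insert.prems(5) by blast
    obtain p where p: "p \<in> U" "\<And>w. w \<in> U \<Longrightarrow> B p w = B e w"
      using solveU sesquilinear_on_antilinear[OF insert.prems(3) e(1)] by blast
    define d where "d = (\<lambda>x. e x - p x)"
    have pW: "p \<in> W" "q \<in> W" using p q sub by auto
    have dW: "d \<in> W" unfolding d_def by (rule csubspace_diff[OF insert.prems(1) e(1) pW(1)])
    have ds: "d s \<noteq> 0" using e p by (auto simp: d_def U_def)
    have d0: "B d w = 0" if "w \<in> U" for w
      using sesquilinear_on_left_diff[OF insert.prems(3) _ e(1) pW(1), of w] that sub p
      by (auto simp: d_def)
    have "d \<noteq> (\<lambda>x. 0)" using ds by auto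
    then have dd: "B d d \<noteq> 0" using insert.prems(4) dW by blast
    \<comment> \<open>The coefficient that makes \<open>q + c d\<close> correct when tested with \<open>d\<close>.\<close>
    define c where "c = (F d - B q d) / B d d"
    show ?thesis
    proof (intro bexI ballI)
      show "(\<lambda>x. q x + c * d x) \<in> W" by (rule csubspace_axpy[OF insert.prems(1) pW(2) dW])
      fix w assume w: "w \<in> W"
      \<comment> \<open>Subtracting \<open>t d\<close> removes the value at \<open>s\<close>, so that \<open>w\<close> splits into a part in \<open>U\<close> and a multiple of \<open>d\<close>.\<close>
      define t where "t = w s / d s"
      define u where "u = (\<lambda>x. w x - t * d x)"
      have uW: "u \<in> W" unfolding u_def
        using csubspace_axpy[OF insert.prems(1) w dW, of "-t"] by simp
      have uU: "u \<in> U" using uW ds by (auto simp: U_def u_def t_def)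
      have wu: "w = (\<lambda>x. u x + t * d x)" by (auto simp: u_def)
      have 1: "B (\<lambda>x. q x + c * d x) w = B q w + c * B d w"
        by (rule sesquilinear_on_left[OF insert.prems(3) w pW(2) dW])
      have 2: "B q w = B q u + cnj t * B q d" "B d w = B d u + cnj t * B d d"
        "F w = F u + cnj t * F d"
        unfolding wu using sesquilinear_on_right[OF insert.prems(3) _ uW dW] pW dW
          antilinear_onD[OF insert.prems(5) uW dW] by auto
      show "B (\<lambda>x. q x + c * d x) w = F w"
        unfolding 1 2 using q(2)[OF uU] d0[OF uU] dd by (simp add: c_def field_simps)
    qed
  qed
qed

lemma riesz_ex1:
  assumes "finite S" "csubspace W" "determined_on S W" "sesquilinear_on W B"
    and "\<And>w. w \<in> W \<Longrightarrow> w \<noteq> (\<lambda>x. 0) \<Longrightarrow> B w w \<noteq> 0" and "antilinear_on W F"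
  shows "\<exists>!q. q \<in> W \<and> (\<forall>w\<in>W. B q w = F w)"
proof (rule ex_ex1I)
  show "\<exists>q. q \<in> W \<and> (\<forall>w\<in>W. B q w = F w)" using riesz_existence[OF assms] by blast
  fix p q assume p: "p \<in> W \<and> (\<forall>w\<in>W. B p w = F w)" and q: "q \<in> W \<and> (\<forall>w\<in>W. B q w = F w)"
  have W: "(\<lambda>x. p x - q x) \<in> W" using csubspace_diff[OF assms(2)] p q by blast
  then have "B (\<lambda>x. p x - q x) (\<lambda>x. p x - q x) = 0"
    using sesquilinear_on_left_diff[OF assms(4) W] p q by simp
  then have "(\<lambda>x. p x - q x) = (\<lambda>x. 0)" using assms(5) W by blast
  then show "p = q" by (metis eq_iff_diff_eq_0 ext)
qed

definition semi_inner_on ::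
    "('a \<Rightarrow> complex) set \<Rightarrow> (('a \<Rightarrow> complex) \<Rightarrow> ('a \<Rightarrow> complex) \<Rightarrow> complex) \<Rightarrow> bool" where
  "semi_inner_on W B \<longleftrightarrow> sesquilinear_on W B \<and>
     (\<forall>u\<in>W. \<forall>v\<in>W. B v u = cnj (B u v)) \<and> (\<forall>u\<in>W. 0 \<le> Re (B u u))"

lemma semi_inner_on_sesquilinear: "semi_inner_on W B \<Longrightarrow> sesquilinear_on W B"
  unfolding semi_inner_on_def by blast

lemma semi_inner_on_hermitian:
  "semi_inner_on W B \<Longrightarrow> u \<in> W \<Longrightarrow> v \<in> W \<Longrightarrow> B v u = cnj (B u v)"
  unfolding semi_inner_on_def by blast

lemma semi_inner_on_nonneg: "semi_inner_on W B \<Longrightarrow> u \<in> W \<Longrightarrow> 0 \<le> Re (B u u)"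
  unfolding semi_inner_on_def by blast

lemma semi_inner_on_self:
  assumes "semi_inner_on W B" "u \<in> W"
  shows "B u u = of_real (Re (B u u))"
proof -
  have "B u u = cnj (B u u)" by (rule semi_inner_on_hermitian[OF assms assms(2)])
  then show ?thesis by (metis Reals_cnj_iff of_real_Re)
qed

lemma semi_inner_on_expand:
  assumes "semi_inner_on W B" "csubspace W" "u \<in> W" "v \<in> W"
  shows "Re (B (\<lambda>x. u x + c * v x) (\<lambda>x. u x + c * v x))
       = Re (B u u) + 2 * Re (cnj c * B u v) + (cmod c)\<^sup>2 * Re (B v v)"
proof -
  have s: "sesquilinear_on W B" and h: "B v u = cnj (B u v)"
    using semi_inner_on_sesquilinear semi_inner_on_hermitian assms by blast+
  let ?w = "\<lambda>x. u x + c * v x"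
  have w: "?w \<in> W" by (rule csubspace_axpy[OF assms(2-)])
  have "B ?w ?w = B u ?w + c * B v ?w" by (rule sesquilinear_on_left[OF s w assms(3,4)])
  also have "\<dots> = B u u + cnj c * B u v + c * (B v u + cnj c * B v v)"
    using sesquilinear_on_right[OF s _ assms(3,4)] assms by simp
  also have "\<dots> = B u u + (cnj c * B u v + cnj (cnj c * B u v)) + (c * cnj c) * B v v"
    by (simp add: h algebra_simps)
  also have "\<dots> = B u u + of_real (2 * Re (cnj c * B u v)) + of_real ((cmod c)\<^sup>2) * B v v"
    by (simp only: complex_norm_square complex_add_cnj)
  finally have *: "B ?w ?w
    = B u u + of_real (2 * Re (cnj c * B u v)) + of_real ((cmod c)\<^sup>2) * B v v" .
  show ?thesis unfolding * by simp
qed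

text \<open>With \<open>z = B u v\<close> the square of \<open>u - t z v\<close> is nonnegative for every real \<open>t\<close>.  The choice \<open>t = 1 / B v v\<close> gives the
  claim; if \<open>B v v = 0\<close>, a large \<open>t\<close> forces \<open>z = 0\<close>.\<close>

lemma semi_inner_on_cauchy_schwarz:
  assumes "semi_inner_on W B" "csubspace W" "u \<in> W" "v \<in> W"
  shows "cmod (B u v) \<le> sqrt (Re (B u u)) * sqrt (Re (B v v))"
proof -
  define a b z where "a = Re (B u u)" and "b = Re (B v v)" and "z = B u v"
  have ab: "0 \<le> a" "0 \<le> b" using assms semi_inner_on_nonneg unfolding a_def b_def by blast+
  have pos: "0 \<le> a + 2 * Re (cnj c * z) + (cmod c)\<^sup>2 * b" for c
    using semi_inner_on_expand[OF assms, of c] semi_inner_on_nonneg[OF assms(1) csubspace_axpy[OF assms(2-), of c]]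
    unfolding a_def b_def z_def by simp
  have real: "0 \<le> a - 2 * t * (cmod z)\<^sup>2 + t\<^sup>2 * (cmod z)\<^sup>2 * b" for t :: real
  proof -
    have "Re (cnj (- of_real t * z) * z) = - t * (cmod z)\<^sup>2"
      by (simp add: cmod_def power2_eq_square algebra_simps)
    moreover have "(cmod (- of_real t * z))\<^sup>2 = t\<^sup>2 * (cmod z)\<^sup>2"
      by (simp add: norm_mult power_mult_distrib)
    ultimately show ?thesis using pos[of "- of_real t * z"] by (simp add: algebra_simps)
  qed
  have "(cmod z)\<^sup>2 \<le> a * b"
  proof (cases "b = 0")
    case True
    have "cmod z = 0"
    proof (rule ccontr)
      assume "cmod z \<noteq> 0"
      then show False using real[of "(a + 1) / (cmod z)\<^sup>2"] True ab by simp
    qed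
    then show ?thesis using True by simp
  next
    case False
    have "0 \<le> a - (cmod z)\<^sup>2 / b"
      using real[of "1 / b"] False by (simp add: power2_eq_square field_simps)
    then show ?thesis using False ab by (simp add: field_simps)
  qed
  then have "cmod z \<le> sqrt (a * b)" by (rule real_le_rsqrt)
  then show ?thesis by (simp add: real_sqrt_mult a_def b_def z_def)
qed

lemma semi_inner_on_triangle:
  assumes "semi_inner_on W B" "csubspace W" "u \<in> W" "v \<in> W"
  shows "sqrt (Re (B (\<lambda>x. u x + c * v x) (\<lambda>x. u x + c * v x)))
       \<le> sqrt (Re (B u u)) + cmod c * sqrt (Re (B v v))"
proof -
  have "Re (cnj c * B u v) \<le> cmod c * (sqrt (Re (B u u)) * sqrt (Re (B v v)))"
    using complex_Re_le_cmod[of "cnj c * B u v"] semi_inner_on_cauchy_schwarz[OF assms]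
    by (simp add: norm_mult) (meson mult_left_mono norm_ge_zero order_trans)
  moreover have "0 \<le> Re (B u u)" "0 \<le> Re (B v v)" using assms semi_inner_on_nonneg by blast+
  ultimately have "Re (B (\<lambda>x. u x + c * v x) (\<lambda>x. u x + c * v x))
      \<le> (sqrt (Re (B u u)) + cmod c * sqrt (Re (B v v)))\<^sup>2"
    unfolding semi_inner_on_expand[OF assms] by (simp add: power2_sum power_mult_distrib) argo
  then show ?thesis by (rule real_le_lsqrt[rotated])
     (use \<open>0 \<le> Re (B u u)\<close> \<open>0 \<le> Re (B v v)\<close> in auto)
qed

text \<open>This makes the operator norms below finite, so that the suprema that define them are meaningful.
  Point evaluation at \<open>s\<close> is bounded because it has a representative \<open>r\<close> with respect to \<open>B\<close>; hence splitting off
  the part with value zero at \<open>s\<close> is a bounded operation, and the induction hypothesis applies to that part.\<close>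

lemma seminorm_bounded:
  assumes "finite S" "csubspace W" "determined_on S W" "semi_inner_on W B"
    and "\<And>w. w \<in> W \<Longrightarrow> w \<noteq> (\<lambda>x. 0) \<Longrightarrow> B w w \<noteq> 0"
    and "\<And>c u v. u \<in> W \<Longrightarrow> v \<in> W \<Longrightarrow> p (\<lambda>x. u x + c * v x) \<le> p u + cmod c * p v"
    and "p (\<lambda>x. 0) = 0"
  shows "\<exists>C. \<forall>w\<in>W. p w \<le> C * sqrt (Re (B w w))"
  using assms
proof (induction S arbitrary: W rule: finite_induct)
  case empty
  then have "W = {\<lambda>x. 0}" by (auto simp: determined_on_def csubspace_def)
  moreover have "B (\<lambda>x. 0) (\<lambda>x. 0) = 0"
    using antilinear_on_zero[OF \<open>csubspace W\<close>] empty sesquilinear_on_antilinear csubspace_zero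
    unfolding semi_inner_on_def by blast
  ultimately show ?case using empty.prems(6) by simp
next
  case (insert s S)
  define U where "U = {w \<in> W. w s = 0}"
  let ?N = "\<lambda>w. sqrt (Re (B w w))"
  have sub: "U \<subseteq> W" by (auto simp: U_def)
  have csU: "csubspace U" using insert.prems(1) by (auto simp: U_def csubspace_def)
  have detU: "determined_on S U" using insert.prems(2) by (auto simp: U_def determined_on_def)
  have sW: "sesquilinear_on W B" by (rule semi_inner_on_sesquilinear[OF insert.prems(3)])
  have sU: "semi_inner_on U B" using sesquilinear_on_subset[OF sW sub] insert.prems(3) sub
    unfolding semi_inner_on_def by blast
  have defU: "B w w \<noteq> 0" if "w \<in> U" "w \<noteq> (\<lambda>x. 0)" for w
    using insert.prems(4) that sub by blast
  have pU: "p (\<lambda>x. u x + c * v x) \<le> p u + cmod c * p v" if "u \<in> U" "v \<in> U" for c u v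
    by (rule insert.prems(5)) (use that sub in auto)
  have "\<exists>C. \<forall>w\<in>U. p w \<le> C * ?N w"
    by (rule insert.IH[OF csU detU sU defU pU insert.prems(6)])
  then obtain C where C: "\<And>w. w \<in> U \<Longrightarrow> p w \<le> C * ?N w" by blast
  show ?case
  proof (cases "U = W")
    case True
    then show ?thesis using C by blast
  next
    case False
    then obtain e where e: "e \<in> W" "e s \<noteq> 0" by (auto simp: U_def)
    have N0: "0 \<le> ?N w" if "w \<in> W" for w
      using semi_inner_on_nonneg[OF insert.prems(3) that] by simp
    have "antilinear_on W (\<lambda>v. cnj (v s))" by (auto simp: antilinear_on_def)
    then have "\<exists>r\<in>W. \<forall>w\<in>W. B r w = cnj (w s)"
      by (intro riesz_existence[where B = B and S = "insert s S"] insert.prems sW)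
        (use insert.hyps in auto)
    then obtain r where r: "r \<in> W" "\<And>w. w \<in> W \<Longrightarrow> B r w = cnj (w s)" by blast
    have ws: "cmod (w s) \<le> ?N r * ?N w" if "w \<in> W" for w
      using semi_inner_on_cauchy_schwarz[OF insert.prems(3,1) r(1) that] r(2)[OF that] by simp
    have "p w \<le> (\<bar>C\<bar> * (1 + ?N r * ?N e / cmod (e s)) + ?N r / cmod (e s) * \<bar>p e\<bar>) * ?N w"
      if w: "w \<in> W" for w
    proof -
      define t where "t = w s / e s"
      define u where "u = (\<lambda>x. w x + (-t) * e x)"
      have uW: "u \<in> W" unfolding u_def
        by (rule csubspace_axpy[OF insert.prems(1) w e(1)])
      have uU: "u \<in> U" using uW e by (auto simp: U_def u_def t_def)
      have wu: "w = (\<lambda>x. u x + t * e x)" by (auto simp: u_def)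
      have t: "cmod t \<le> ?N r / cmod (e s) * ?N w"
        using ws[OF w] e by (simp add: t_def norm_divide field_simps)
      have "p w \<le> p u + cmod t * p e"
        by (subst wu) (rule insert.prems(5)[OF uW e(1)])
      moreover have "p u \<le> \<bar>C\<bar> * ?N u" using C[OF uU] N0[OF uW]
        by (meson abs_ge_self mult_right_mono order_trans)
      moreover have "?N u \<le> ?N w + cmod t * ?N e"
        unfolding u_def using semi_inner_on_triangle[OF insert.prems(3,1) w e(1), of "-t"] by simp
      moreover have "cmod t * ?N e \<le> ?N r / cmod (e s) * ?N w * ?N e"
        by (rule mult_right_mono[OF t N0[OF e(1)]])
      ultimately have "p w \<le> \<bar>C\<bar> * (?N w + ?N r / cmod (e s) * ?N w * ?N e) + cmod t * p e"
        using mult_left_mono[of "?N u" "?N w + ?N r / cmod (e s) * ?N w * ?N e" "\<bar>C\<bar>"] by linarith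
      moreover have "cmod t * p e \<le> ?N r / cmod (e s) * ?N w * \<bar>p e\<bar>"
        using mult_right_mono[OF t, of "\<bar>p e\<bar>"] mult_left_mono[of "p e" "\<bar>p e\<bar>" "cmod t"] abs_ge_self[of "p e"]
          norm_ge_zero[of t] by linarith
      ultimately show ?thesis by (simp add: algebra_simps)
    qed
    then show ?thesis by blast
  qed
qed

section \<open>Smooth bumps supported in a box\<close>

lemma power_exp_bound:
  fixes x :: real
  assumes "0 \<le> x"
  shows "x ^ n * exp (- x) \<le> fact n"
proof -
  have "x ^ n / fact n \<le> exp x"
  proof -
    have "(\<Sum>k\<in>{n}. x ^ k /\<^sub>R fact k) \<le> (\<Sum>k. x ^ k /\<^sub>R fact k)"
      by (rule sum_le_suminf) (use assms summable_exp_generic[of x] in auto)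
    then show ?thesis by (simp add: exp_def field_simps)
  qed
  then show ?thesis by (simp add: exp_minus field_simps)
qed

text \<open>Used where the formulas for bumps change, at the end points of their support.\<close>

lemma DERIV_zero_of_quadratic_bound:
  fixes f :: "real \<Rightarrow> real"
  assumes "\<And>t. \<bar>f t\<bar> \<le> K * (t - t0)\<^sup>2"
  shows "(f has_real_derivative 0) (at t0)"
proof -
  have f0: "f t0 = 0" using assms[of t0] by simp
  have K: "0 \<le> K" using assms[of "t0 + 1"] by simp
  have "((\<lambda>t. (f t - f t0) / (t - t0)) \<longlongrightarrow> 0) (at t0)"
  proof (rule Lim_null_comparison)
    show "\<forall>\<^sub>F t in at t0. norm ((f t - f t0) / (t - t0)) \<le> K * \<bar>t - t0\<bar>"
    proof (rule eventually_mono[OF eventually_neq_at_within[of t0]])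
      fix t assume "t \<noteq> t0"
      then show "norm ((f t - f t0) / (t - t0)) \<le> K * \<bar>t - t0\<bar>"
        using assms[of t] by (simp add: f0 field_simps power2_eq_square abs_mult[symmetric])
    qed
    show "((\<lambda>t. K * \<bar>t - t0\<bar>) \<longlongrightarrow> 0) (at t0)"
      by (auto intro!: tendsto_eq_intros)
  qed
  then show ?thesis by (simp add: has_field_derivative_iff)
qed

text \<open>With \<open>s = 1 / ((t - a) (b - t))\<close> these are the functions \<open>p s\<^sup>m exp (- c s)\<close>, extended by zero.  For \<open>p = 1\<close> and \<open>m = 0\<close> one
  obtains the standard bump on \<open>(a, b)\<close>; the polynomial and the power of \<open>s\<close> are there to make the family
  closed under differentiation.\<close>

definition bump :: "real \<Rightarrow> real \<Rightarrow> real \<Rightarrow> real poly \<Rightarrow> nat \<Rightarrow> real \<Rightarrow> real" where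
  "bump a b c p m t = (if a < t \<and> t < b
     then poly p t * (1 / ((t - a) * (b - t))) ^ m * exp (- (c / ((t - a) * (b - t)))) else 0)"

text \<open>The exponential beats every power of \<open>s\<close>, in particular \<open>s\<close> to the power \<open>m + 2\<close>.\<close>

lemma bump_quadratic_bound:
  assumes "0 < c"
  obtains K where "\<And>t. \<bar>bump a b c p m t\<bar> \<le> K * ((t - a) * (b - t))\<^sup>2"
proof -
  have "bounded (poly p ` {a..b})"
    by (intro compact_imp_bounded compact_continuous_image continuous_intros) auto
  then obtain M where "\<forall>x\<in>{a..b}. \<bar>poly p x\<bar> \<le> M" by (auto simp: bounded_iff)
  then have M: "\<And>x. a < x \<Longrightarrow> x < b \<Longrightarrow> \<bar>poly p x\<bar> \<le> \<bar>M\<bar>" by (meson abs_ge_self atLeastAtMost_iff less_imp_le order_trans)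
  define K where "K = \<bar>M\<bar> * (fact (m + 2) / c ^ (m + 2))"
  have K0: "0 \<le> K" using assms by (simp add: K_def)
  have "\<bar>bump a b c p m t\<bar> \<le> K * ((t - a) * (b - t))\<^sup>2" for t
  proof (cases "a < t \<and> t < b")
    case False
    then have "bump a b c p m t = 0" unfolding bump_def by (rule if_not_P)
    then show ?thesis using K0 by simp
  next
    case True
    define q where "q = (t - a) * (b - t)"
    have q: "0 < q" using True by (simp add: q_def)
    have "(c / q) ^ (m + 2) * exp (- (c / q)) \<le> fact (m + 2)"
      by (rule power_exp_bound) (use q assms in auto)
    then have "(1 / q) ^ (m + 2) * exp (- (c / q)) \<le> fact (m + 2) / c ^ (m + 2)"
      using assms by (simp add: power_divide field_simps)
    then have "(1 / q) ^ (m + 2) * exp (- (c / q)) * q\<^sup>2 \<le> fact (m + 2) / c ^ (m + 2) * q\<^sup>2"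
      by (rule mult_right_mono) simp
    moreover have "(1 / q) ^ (m + 2) * exp (- (c / q)) * q\<^sup>2 = (1 / q) ^ m * exp (- (c / q))"
      using q by (simp add: power_add power2_eq_square)
    ultimately have 1: "(1 / q) ^ m * exp (- (c / q)) \<le> fact (m + 2) / c ^ (m + 2) * q\<^sup>2"
      by (simp only:)
    have "\<bar>poly p t\<bar> * ((1 / q) ^ m * exp (- (c / q)))
      \<le> \<bar>M\<bar> * (fact (m + 2) / c ^ (m + 2) * q\<^sup>2)"
      by (rule mult_mono[OF _ 1]) (use M True q in auto)
    moreover have "\<bar>bump a b c p m t\<bar> = \<bar>poly p t\<bar> * ((1 / q) ^ m * exp (- (c / q)))"
      using True q by (simp add: bump_def q_def abs_mult)
    ultimately show ?thesis by (simp add: K_def q_def mult.assoc)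
  qed
  then show ?thesis using that by blast
qed

text \<open>On the interval the product rule and \<open>s' = - q' s\<^sup>2\<close>, where \<open>q = 1 / s\<close>, show that differentiation raises the power of
  \<open>s\<close> by two and changes the polynomial.  Outside, and at the end points in particular, the quadratic bound
  gives the derivative zero.\<close>

lemma bump_has_derivative:
  assumes "0 < c"
  shows "\<exists>p'. \<forall>t. (bump a b c p m has_real_derivative bump a b c p' (m + 2) t) (at t)"
proof -
  define q where "q = [:-a, 1:] * [:b, -1:]"
  define p' where "p' = pderiv p * q\<^sup>2 - smult (of_nat m) (p * pderiv q * q) + smult c (p * pderiv q)"
  have q: "poly q t = (t - a) * (b - t)" for t by (simp add: q_def algebra_simps)
  have "(bump a b c p m has_real_derivative bump a b c p' (m + 2) t0) (at t0)" for t0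
  proof (cases "a < t0 \<and> t0 < b")
    case True
    have q0: "0 < poly q t0" using True by (simp add: q)
    have "((\<lambda>t. poly p t * (1 / poly q t) ^ m * exp (- (c / poly q t))) has_real_derivative
        bump a b c p' (m + 2) t0) (at t0)"
    proof -
      define s where "s = 1 / poly q t0"
      have qs: "poly q t0 * s = 1" using q0 by (simp add: s_def)
      have 1: "((\<lambda>t. 1 / poly q t) has_real_derivative - poly (pderiv q) t0 * s\<^sup>2) (at t0)"
        using DERIV_divide[OF DERIV_const poly_DERIV, of q t0 1] q0
        by (simp add: power2_eq_square s_def)
      have 2: "((\<lambda>t. (1 / poly q t) ^ m) has_real_derivative
        - of_nat m * poly (pderiv q) t0 * (s ^ m * s)) (at t0)"
        using DERIV_power[OF 1, of m]
        by (cases m) (simp_all add: power2_eq_square algebra_simps flip: s_def)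
      have 3: "((\<lambda>t. exp (- (c / poly q t))) has_real_derivative
        exp (- (c / poly q t0)) * (c * poly (pderiv q) t0 * s\<^sup>2)) (at t0)"
        using DERIV_fun_exp[OF DERIV_minus[OF DERIV_divide[OF DERIV_const poly_DERIV, of q t0 c]]] q0
        by (simp add: power2_eq_square s_def)
      have "((\<lambda>t. poly p t * (1 / poly q t) ^ m * exp (- (c / poly q t))) has_real_derivative
        (poly (pderiv p) t0 * (1 / poly q t0) ^ m
          + - of_nat m * poly (pderiv q) t0 * (s ^ m * s) * poly p t0) * exp (- (c / poly q t0))
        + exp (- (c / poly q t0)) * (c * poly (pderiv q) t0 * s\<^sup>2)
          * (poly p t0 * (1 / poly q t0) ^ m)) (at t0)"
        by (intro DERIV_mult poly_DERIV 2 3)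
      moreover have "bump a b c p' (m + 2) t0 =
        (poly (pderiv p) t0 * (1 / poly q t0) ^ m
          + - of_nat m * poly (pderiv q) t0 * (s ^ m * s) * poly p t0) * exp (- (c / poly q t0))
        + exp (- (c / poly q t0)) * (c * poly (pderiv q) t0 * s\<^sup>2)
          * (poly p t0 * (1 / poly q t0) ^ m)"
      proof -
        have b: "bump a b c p' (m + 2) t0 = poly p' t0 * (s ^ m * s\<^sup>2) * exp (- (c / poly q t0))"
          using True by (simp add: bump_def q s_def power_add power2_eq_square)
        have p': "poly p' t0 = poly (pderiv p) t0 * (poly q t0)\<^sup>2
             - of_nat m * (poly p t0 * poly (pderiv q) t0 * poly q t0)
             + c * (poly p t0 * poly (pderiv q) t0)"
          by (simp add: p'_def)
        have alg: "(P * Q\<^sup>2 - M * (R * D * Q) + c * (R * D)) * (S * s\<^sup>2) * E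
            = (P * S + - M * D * (S * s) * R) * E + E * (c * D * s\<^sup>2) * (R * S)"
          if "Q * s = 1" for P Q M R D S E :: real
          using that by algebra
        show ?thesis unfolding b p' s_def[symmetric] by (rule alg[OF qs])
      qed
      ultimately show ?thesis by simp
    qed
    then show ?thesis
      by (rule has_field_derivative_transform_within_open[of _ _ _ "{a<..<b}"])
         (use True in \<open>auto simp: bump_def q\<close>)
  next
    case False
    obtain K where K: "\<And>t. \<bar>bump a b c p m t\<bar> \<le> K * ((t - a) * (b - t))\<^sup>2"
      using bump_quadratic_bound[OF assms, where a = a and b = b and p = p and m = m] by blast
    have "(bump a b c p m has_real_derivative 0) (at t0)"
    proof (rule DERIV_zero_of_quadratic_bound[where K = "\<bar>K\<bar> * (b - a)\<^sup>2"])
      fix t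
      show "\<bar>bump a b c p m t\<bar> \<le> \<bar>K\<bar> * (b - a)\<^sup>2 * (t - t0)\<^sup>2"
      proof (cases "a < t \<and> t < b")
        case True
        have "(t - a) * (b - t) \<le> (b - a) * \<bar>t - t0\<bar>"
        proof (cases "t0 \<le> a")
          case True
          have "(b - t) * (t - a) \<le> (b - a) * \<bar>t - t0\<bar>"
            by (rule mult_mono) (use True \<open>a < t \<and> t < b\<close> in auto)
          then show ?thesis by (simp add: mult.commute)
        next
          case F: False
          show ?thesis
            by (rule mult_mono) (use F False \<open>a < t \<and> t < b\<close> in auto)
        qed
        then have "((t - a) * (b - t))\<^sup>2 \<le> ((b - a) * \<bar>t - t0\<bar>)\<^sup>2"
          using True by (intro power_mono) auto
        then have "\<bar>K\<bar> * ((t - a) * (b - t))\<^sup>2 \<le> \<bar>K\<bar> * ((b - a) * \<bar>t - t0\<bar>)\<^sup>2"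
          by (rule mult_left_mono) simp
        moreover have "K * ((t - a) * (b - t))\<^sup>2 \<le> \<bar>K\<bar> * ((t - a) * (b - t))\<^sup>2"
          by (rule mult_right_mono) auto
        ultimately show ?thesis using K[of t] by (simp add: power_mult_distrib)
      next
        case False
        then have "bump a b c p m t = 0" unfolding bump_def by (rule if_not_P)
        then show ?thesis by simp
      qed
    qed
    moreover have "bump a b c p' (m + 2) t0 = 0" using False unfolding bump_def by (rule if_not_P)
    ultimately show ?thesis by simp
  qed
  then show ?thesis by blast
qed

definition tensor :: "(real \<Rightarrow> real) \<Rightarrow> (real \<Rightarrow> real) \<Rightarrow> point \<Rightarrow> real" where
  "tensor f g x = f (x $ 1) * g (x $ 2)"

lemma tensor_has_derivative:
  assumes "\<And>t. (f has_real_derivative f' t) (at t)" "\<And>t. (g has_real_derivative g' t) (at t)"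
  shows "(tensor f g has_derivative (\<lambda>h. f' (x $ 1) * h $ 1 * g (x $ 2) + f (x $ 1) * (g' (x $ 2) * h $ 2))) (at x)"
proof -
  have 1: "((\<lambda>x. f (x $ 1)) has_derivative (\<lambda>h. f' (x $ 1) * h $ 1)) (at x)"
    by (rule has_derivative_compose[of "\<lambda>x. x $ 1" "\<lambda>h. h $ 1", OF _ assms(1)[unfolded has_field_derivative_def]])
       (rule bounded_linear_imp_has_derivative[OF bounded_linear_vec_nth])
  have 2: "((\<lambda>x. g (x $ 2)) has_derivative (\<lambda>h. g' (x $ 2) * h $ 2)) (at x)"
    by (rule has_derivative_compose[of "\<lambda>x. x $ 2" "\<lambda>h. h $ 2", OF _ assms(2)[unfolded has_field_derivative_def]])
       (rule bounded_linear_imp_has_derivative[OF bounded_linear_vec_nth])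
  have "tensor f g = (\<lambda>x. f (x $ 1) * g (x $ 2))" by (auto simp: tensor_def)
  then show ?thesis using has_derivative_mult[OF 1 2] by (simp add: algebra_simps)
qed

lemma partial_eq:
  assumes "(f has_derivative D) (at x)"
  shows "partial i f x = D (axis i 1)"
  using frechet_derivative_at[OF assms] by (simp add: partial_def)

lemma partial_tensor:
  assumes "\<And>t. (f has_real_derivative f' t) (at t)" "\<And>t. (g has_real_derivative g' t) (at t)"
  shows "partial 1 (tensor f g) = tensor f' g" "partial 2 (tensor f g) = tensor f g'"
  using partial_eq[OF tensor_has_derivative[OF assms]]
  by (auto simp: fun_eq_iff tensor_def axis_def)

text \<open>Smoothness asks for all iterated partial derivatives; a family that is closed under partial
  derivatives yields them without any formula for the iterates.\<close>

lemma smooth_coinduct: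
  assumes "f \<in> C" "\<And>g x. g \<in> C \<Longrightarrow> g differentiable (at x)" "\<And>g i. g \<in> C \<Longrightarrow> partial i g \<in> C"
  shows "smooth f"
proof -
  have "foldr partial js f \<in> C" for js by (induction js) (use assms in auto)
  then show ?thesis using assms(2) by (auto simp: smooth_def)
qed

lemma smooth_tensor_bump:
  assumes "0 < c" "0 < c'"
  shows "smooth (tensor (bump a b c p m) (bump a' b' c' p' m'))"
proof -
  define C where "C = {tensor (bump a b c p m) (bump a' b' c' p' m') | p m p' m'. True}"
  show ?thesis
  proof (rule smooth_coinduct[of _ C])
    show "tensor (bump a b c p m) (bump a' b' c' p' m') \<in> C" by (auto simp: C_def)
    fix g assume "g \<in> C"
    then obtain p m p' m' where g: "g = tensor (bump a b c p m) (bump a' b' c' p' m')"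
      by (auto simp: C_def)
    obtain q where q: "\<And>t. (bump a b c p m has_real_derivative bump a b c q (m + 2) t) (at t)"
      using bump_has_derivative[OF assms(1)] by blast
    obtain q' where q': "\<And>t. (bump a' b' c' p' m' has_real_derivative bump a' b' c' q' (m' + 2) t) (at t)"
      using bump_has_derivative[OF assms(2)] by blast
    show "g differentiable (at x)" for x
      unfolding g differentiable_def using tensor_has_derivative[OF q q'] by blast
    show "partial i g \<in> C" for i
      using exhaust_2[of i] partial_tensor[OF q q'] by (auto simp: g C_def)
  qed
qed

lemma Lim_bump:
  "((\<lambda>n. bump a b (1 / real (Suc n)) 1 0 t) \<longlongrightarrow> (if a < t \<and> t < b then 1 else 0)) sequentially"
proof (cases "a < t \<and> t < b")
  case True
  have "((\<lambda>n. 1 / real (Suc n) / ((t - a) * (b - t))) \<longlongrightarrow> 0 / ((t - a) * (b - t))) sequentially"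
    by (intro tendsto_divide LIMSEQ_Suc[OF lim_1_over_n] tendsto_const) (use True in auto)
  then have "((\<lambda>n. exp (- (1 / real (Suc n) / ((t - a) * (b - t))))) \<longlongrightarrow> exp (- (0 / ((t - a) * (b - t))))) sequentially"
    by (intro tendsto_exp tendsto_minus)
  then show ?thesis using True by (simp add: bump_def)
next
  case False
  then show ?thesis by (auto simp: bump_def)
qed

lemma bump_bounds: "0 < c \<Longrightarrow> 0 \<le> bump a b c 1 0 t \<and> bump a b c 1 0 t \<le> 1"
  by (auto simp: bump_def)

text \<open>The decay parameter tends to zero, so these bumps increase to the indicator function of the open box.\<close>

definition box_bump :: "point \<Rightarrow> point \<Rightarrow> nat \<Rightarrow> point \<Rightarrow> real" where
  "box_bump a b n = tensor (bump (a $ 1) (b $ 1) (1 / real (Suc n)) 1 0)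
     (bump (a $ 2) (b $ 2) (1 / real (Suc n)) 1 0)"

lemma mem_box_2: "(x :: point) \<in> box a b \<longleftrightarrow> a $ 1 < x $ 1 \<and> x $ 1 < b $ 1 \<and> a $ 2 < x $ 2 \<and> x $ 2 < b $ 2"
  by (auto simp: mem_box_cart forall_2)

lemma box_bump_bounds: "0 \<le> box_bump a b n x" "box_bump a b n x \<le> 1"
  using bump_bounds[of "1 / real (Suc n)"] by (auto simp: box_bump_def tensor_def intro!: mult_le_one)

lemma Lim_box_bump: "((\<lambda>n. box_bump a b n x) \<longlongrightarrow> indicat_real (box a b) x) sequentially"
proof -
  have "((\<lambda>n. box_bump a b n x) \<longlongrightarrow> (if a $ 1 < x $ 1 \<and> x $ 1 < b $ 1 then 1 else 0) * (if a $ 2 < x $ 2 \<and> x $ 2 < b $ 2 then 1 else 0)) sequentially"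
    unfolding box_bump_def tensor_def by (intro tendsto_mult Lim_bump)
  moreover have "(if a $ 1 < x $ 1 \<and> x $ 1 < b $ 1 then 1 else 0) * (if a $ 2 < x $ 2 \<and> x $ 2 < b $ 2 then 1 else 0)
      = indicat_real (box a b) x" by (auto simp: indicator_def mem_box_2)
  ultimately show ?thesis by (simp only:)
qed

lemma box_bump_test_function:
  assumes "cbox a b \<subseteq> \<Omega>"
  shows "box_bump a b n \<in> test_functions \<Omega>"
proof -
  have "{x. box_bump a b n x \<noteq> 0} \<subseteq> cbox a b"
    by (auto simp: box_bump_def tensor_def bump_def mem_box_cart forall_2 split: if_splits)
  then have sub: "closure {x. box_bump a b n x \<noteq> 0} \<subseteq> cbox a b"
    by (rule closure_minimal) (rule closed_cbox)
  then have "compact (closure {x. box_bump a b n x \<noteq> 0})"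
    by (metis compact_eq_bounded_closed bounded_subset bounded_cbox closed_closure)
  then show ?thesis using sub assms smooth_tensor_bump
    by (auto simp: test_functions_def box_bump_def)
qed

section \<open>Functions orthogonal to all test functions\<close>

lemma sigma_finite_lebesgue: "sigma_finite_measure (lebesgue :: 'a::euclidean_space measure)"
proof
  show "\<exists>A. countable A \<and> A \<subseteq> sets lebesgue \<and> \<Union> A = space (lebesgue :: 'a measure)
      \<and> (\<forall>a\<in>A. emeasure lebesgue a \<noteq> \<infinity>)"
  proof (intro exI[of _ "range (\<lambda>n :: nat. cball (0 :: 'a) n)"] conjI)
    show "\<Union> (range (\<lambda>n :: nat. cball (0 :: 'a) n)) = space lebesgue"
      by (auto simp: real_arch_simple)
    show "\<forall>a\<in>range (\<lambda>n :: nat. cball (0 :: 'a) n). emeasure lebesgue a \<noteq> \<infinity>"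
      using fmeasurableD2[OF lmeasurable_cball] by fastforce
  qed auto
qed

text \<open>Boxes are stable under intersection and generate the Borel sets, and the sets over which the
  integral of \<open>f\<close> vanishes form a Dynkin system.  A Lebesgue measurable set differs from a Borel set by a null set.\<close>

lemma lebesgue_integral_zero_of_zero_on_boxes:
  fixes f :: "'a::euclidean_space \<Rightarrow> complex"
  assumes f: "integrable lebesgue f" and box: "\<And>a b. (LINT x:box a b|lebesgue. f x) = 0"
    and UN: "(LINT x|lebesgue. f x) = 0"
  shows "AE x in lebesgue. f x = 0"
proof (rule sigma_finite_measure.density_zero[OF sigma_finite_lebesgue f])
  have si: "set_integrable lebesgue A f" if "A \<in> sets lebesgue" for A
    unfolding set_integrable_def by (rule integrable_mult_indicator[OF that f])
  have borel: "(LINT x:A|lebesgue. f x) = 0" if A: "A \<in> sets borel" for A :: "'a set"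
  proof -
    have eq: "sets borel = sigma_sets UNIV (range (\<lambda>(a, b). box a b :: 'a set))"
      by (subst borel_eq_box) (simp add: sets_measure_of)
    have leb: "B \<in> sets lebesgue" if "B \<in> sigma_sets UNIV (range (\<lambda>(a, b). box a b))" for B :: "'a set"
      using that unfolding eq[symmetric] by simp
    have A': "A \<in> sigma_sets UNIV (range (\<lambda>(a, b). box a b :: 'a set))"
      using A unfolding eq .
    show ?thesis
    proof (rule sigma_sets_induct_disjoint[OF _ _ A', where P = "\<lambda>A. (LINT x:A|lebesgue. f x) = 0"])
      show "Int_stable (range (\<lambda>(a, b). box a b :: 'a set))"
        by (auto simp: Int_stable_def box_Int_box)
      show "(LINT x:B|lebesgue. f x) = 0" if "B \<in> range (\<lambda>(a, b). box a b)" for B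
        using that box by auto
      show "(LINT x:(UNIV - B)|lebesgue. f x) = 0"
        if B: "B \<in> sigma_sets UNIV (range (\<lambda>(a, b). box a b))" and 0: "(LINT x:B|lebesgue. f x) = 0" for B
      proof -
        have "(LINT x:(UNIV - B) \<union> B|lebesgue. f x)
            = (LINT x:(UNIV - B)|lebesgue. f x) + (LINT x:B|lebesgue. f x)"
        proof (rule set_integral_Un)
          show "set_integrable lebesgue (UNIV - B) f"
            using sets.compl_sets[OF leb[OF B]] by (intro si) simp
          show "set_integrable lebesgue B f" by (rule si[OF leb[OF B]])
        qed auto
        moreover have "UNIV - B \<union> B = UNIV" by auto
        ultimately show ?thesis using 0 UN by (simp add: set_lebesgue_integral_def)
      qed
      show "(LINT x:(\<Union>i. B i)|lebesgue. f x) = 0"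
        if B: "disjoint_family B" "range B \<subseteq> sigma_sets UNIV (range (\<lambda>(a, b). box a b))"
          "\<And>i. (LINT x:B i|lebesgue. f x) = 0" for B :: "nat \<Rightarrow> 'a set"
      proof -
        have m: "B i \<in> sets lebesgue" for i using B(2) by (intro leb) auto
        have "(LINT x:(\<Union>i. B i)|lebesgue. f x) = (\<Sum>i. (LINT x:B i|lebesgue. f x))"
        proof (rule lebesgue_integral_countable_add[OF m])
          show "set_integrable lebesgue (\<Union> (range B)) f" using m by (intro si) auto
        qed (use B(1) in \<open>auto simp: disjoint_family_on_def\<close>)
        then show ?thesis using B(3) by simp
      qed
    qed (auto simp: set_lebesgue_integral_def)
  qed
  show "(LINT x:A|lebesgue. f x) = 0" if A: "A \<in> sets lebesgue" for A
  proof -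
    obtain S N N' where S: "A = S \<union> N" "N \<subseteq> N'" "N' \<in> null_sets lborel" "S \<in> sets lborel"
      using sets_completionE[OF A] by metis
    have N: "N \<in> null_sets lebesgue" using S
      by (metis null_sets_completionI null_sets_completion_subset)
    have "AE x in lebesgue. indicat_real A x *\<^sub>R f x = indicat_real S x *\<^sub>R f x"
      using AE_not_in[OF N] by (rule eventually_mono) (auto simp: S(1) indicator_def)
    then have "(LINT x:A|lebesgue. f x) = (LINT x:S|lebesgue. f x)"
      unfolding set_lebesgue_integral_def
      by (rule integral_cong_AE[rotated 2])
        (use A S(4) in \<open>auto intro!: borel_measurable_scaleR borel_measurable_indicator borel_measurable_integrable[OF f]\<close>)
    then show ?thesis using borel S(4) by simp
  qed
qed

text \<open>The fundamental lemma of the calculus of variations.  Box bumps are test functions that converge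
  boundedly to indicator functions, so \<open>h\<close> has integral zero over every box whose closure lies in \<open>\<Omega>\<close>; hence it vanishes almost
  everywhere on each such box, and countably many of them exhaust \<open>\<Omega>\<close>.\<close>

lemma AE_zero_of_orthogonal_to_test_functions:
  fixes h :: cfun
  assumes \<Omega>: "open \<Omega>" and h: "integrable (lebesgue_on \<Omega>) h"
    and orth: "\<And>\<phi>. \<phi> \<in> test_functions \<Omega> \<Longrightarrow> (LINT x|lebesgue_on \<Omega>. h x * of_real (\<phi> x)) = 0"
  shows "AE x in lebesgue_on \<Omega>. h x = 0"
proof -
  have \<Omega>m: "\<Omega> \<in> sets lebesgue" using \<Omega> by (simp add: borel_open)
  define f where "f x = indicat_real \<Omega> x *\<^sub>R h x" for x
  have f: "integrable lebesgue f"
    using h \<Omega>m unfolding f_def by (simp add: integrable_restrict_space)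
  have box0: "(LINT x:box a b|lebesgue. f x) = 0" if ab: "cbox a b \<subseteq> \<Omega>" for a b
  proof -
    have m: "box_bump a b n \<in> borel_measurable lebesgue" for n
    proof -
      have "smooth (box_bump a b n)"
        using box_bump_test_function[OF ab, of n] by (simp add: test_functions_def)
      then have "box_bump a b n differentiable (at x)" for x
        unfolding smooth_def by (auto dest: spec[of _ "[]"])
      then have "continuous_on UNIV (box_bump a b n)"
        by (simp add: continuous_on_eq_continuous_at differentiable_imp_continuous_within)
      then show ?thesis
        by (intro measurable_completion) (simp add: borel_measurable_continuous_onI)
    qed
    have "(\<lambda>n. LINT x|lebesgue. box_bump a b n x *\<^sub>R f x) \<longlonglongrightarrow> (LINT x|lebesgue. indicat_real (box a b) x *\<^sub>R f x)"
    proof (rule integral_dominated_convergence[where w = "\<lambda>x. norm (f x)"])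
      show "AE x in lebesgue. (\<lambda>n. box_bump a b n x *\<^sub>R f x) \<longlonglongrightarrow> indicat_real (box a b) x *\<^sub>R f x"
        by (intro AE_I2 tendsto_scaleR Lim_box_bump tendsto_const)
      show "AE x in lebesgue. norm (box_bump a b n x *\<^sub>R f x) \<le> norm (f x)" for n
        by (auto intro!: mult_left_le_one_le simp: box_bump_bounds)
      have fm: "f \<in> borel_measurable lebesgue" by (rule borel_measurable_integrable[OF f])
      show "(\<lambda>x. indicat_real (box a b) x *\<^sub>R f x) \<in> borel_measurable lebesgue"
        by (intro borel_measurable_scaleR borel_measurable_indicator fm) simp
      show "(\<lambda>x. box_bump a b n x *\<^sub>R f x) \<in> borel_measurable lebesgue" for n
        by (intro borel_measurable_scaleR m fm)
      show "integrable lebesgue (\<lambda>x. norm (f x))" by (rule integrable_norm[OF f])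
    qed
    moreover have "(LINT x|lebesgue. box_bump a b n x *\<^sub>R f x) = 0" for n
    proof -
      have "(LINT x|lebesgue. box_bump a b n x *\<^sub>R f x)
          = (LINT x|lebesgue_on \<Omega>. h x * of_real (box_bump a b n x))"
        unfolding f_def using \<Omega>m
        by (simp add: integral_restrict_space scaleR_conv_of_real mult_ac)
      then show ?thesis using orth[OF box_bump_test_function[OF ab]] by simp
    qed
    ultimately have "(LINT x|lebesgue. indicat_real (box a b) x *\<^sub>R f x) = 0"
      by (simp add: LIMSEQ_const_iff)
    then show ?thesis by (simp add: set_lebesgue_integral_def)
  qed
  have local: "AE x in lebesgue. x \<in> cbox a b \<longrightarrow> f x = 0" if ab: "cbox a b \<subseteq> \<Omega>" for a b
  proof -
    define g where "g x = indicat_real (box a b) x *\<^sub>R f x" for x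
    have g: "integrable lebesgue g" unfolding g_def
      by (rule integrable_mult_indicator[OF _ f]) simp
    have sub: "(LINT x:box c d|lebesgue. g x) = 0" for c d
    proof -
      have "\<exists>a' b'. box a b \<inter> box c d = box a' b'" unfolding box_Int_box by blast
      then obtain a' b' where ab': "box a b \<inter> box c d = box a' b'" by blast
      have eq: "(LINT x:box c d|lebesgue. g x) = (LINT x:box a' b'|lebesgue. f x)"
        unfolding set_lebesgue_integral_def g_def ab'[symmetric]
        by (rule Bochner_Integration.integral_cong) (auto simp: indicator_def)
      show ?thesis
      proof (cases "box a' b' = {}")
        case True
        then show ?thesis unfolding eq by (simp add: set_lebesgue_integral_def)
      next
        case False
        have "box a' b' \<subseteq> cbox a b" using ab' box_subset_cbox by blast
        then have "closure (box a' b') \<subseteq> cbox a b" by (rule closure_minimal) (rule closed_cbox)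
        then have "cbox a' b' \<subseteq> \<Omega>" using closure_box[OF False] ab by auto
        then show ?thesis unfolding eq by (rule box0)
      qed
    qed
    have "AE x in lebesgue. g x = 0"
    proof (rule lebesgue_integral_zero_of_zero_on_boxes[OF g sub])
      show "(LINT x|lebesgue. g x) = 0" using box0[OF ab] by (simp add: g_def set_lebesgue_integral_def)
    qed
    moreover have "AE x in lebesgue. x \<notin> cbox a b - box a b"
      using negligible_frontier_interval[of a b] negligible_iff_null_sets AE_not_in by blast
    ultimately show ?thesis by eventually_elim (auto simp: g_def)
  qed
  obtain D where D: "countable D" "D \<subseteq> Pow \<Omega>" "\<And>X. X \<in> D \<Longrightarrow> \<exists>a b. X = cbox a b" "\<Union>D = \<Omega>"
    using open_countable_Union_open_cbox[OF \<Omega>] by metis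
  have "AE x in lebesgue. \<forall>X\<in>D. x \<in> X \<longrightarrow> f x = 0"
    unfolding AE_ball_countable[OF D(1)] using D local by (metis PowD subsetD)
  then have "AE x in lebesgue. x \<in> \<Omega> \<longrightarrow> h x = 0"
    by eventually_elim (metis D(4) UnionE f_def indicator_simps(1) scaleR_one)
  then show ?thesis using \<Omega>m by (simp add: AE_restrict_space_iff)
qed

section \<open>Square integrable functions\<close>

lemma L2_axpy:
  assumes "u \<in> L2 S" "v \<in> L2 S" "S \<in> sets lebesgue"
  shows "(\<lambda>x. u x + c * v x) \<in> L2 S"
proof -
  have m: "u \<in> borel_measurable (lebesgue_on S)" "v \<in> borel_measurable (lebesgue_on S)"
    and i: "integrable (lebesgue_on S) (\<lambda>x. (cmod (u x))\<^sup>2)" "integrable (lebesgue_on S) (\<lambda>x. (cmod (v x))\<^sup>2)"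
    using assms by (auto simp: L2_def)
  have "integrable (lebesgue_on S) (\<lambda>x. (cmod (u x + c * v x))\<^sup>2)"
  proof (rule Bochner_Integration.integrable_bound)
    show "integrable (lebesgue_on S) (\<lambda>x. 2 * (cmod (u x))\<^sup>2 + 2 * (cmod c)\<^sup>2 * (cmod (v x))\<^sup>2)"
      using i by simp
    show "AE x in lebesgue_on S. norm ((cmod (u x + c * v x))\<^sup>2)
        \<le> norm (2 * (cmod (u x))\<^sup>2 + 2 * (cmod c)\<^sup>2 * (cmod (v x))\<^sup>2)"
    proof (intro AE_I2)
      fix x
      have "(cmod (u x + c * v x))\<^sup>2 \<le> (cmod (u x) + cmod (c * v x))\<^sup>2"
        by (intro power_mono norm_triangle_ineq) auto
      also have "\<dots> \<le> 2 * (cmod (u x))\<^sup>2 + 2 * (cmod (c * v x))\<^sup>2"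
        using sum_squares_bound[of "cmod (u x)" "cmod (c * v x)"] by (simp add: power2_sum)
      finally show "norm ((cmod (u x + c * v x))\<^sup>2)
        \<le> norm (2 * (cmod (u x))\<^sup>2 + 2 * (cmod c)\<^sup>2 * (cmod (v x))\<^sup>2)"
        by (simp add: norm_mult power_mult_distrib)
    qed
  qed (use m in measurable)
  then show ?thesis using m by (simp add: L2_def)
qed

lemma L2_cnj:
  assumes "u \<in> L2 S"
  shows "(\<lambda>x. cnj (u x)) \<in> L2 S"
proof -
  have "(\<lambda>x. cnj (u x)) \<in> borel_measurable (lebesgue_on S)"
    using assms by (intro measurable_compose[of u _ borel cnj])
      (auto simp: L2_def intro!: borel_measurable_continuous_onI continuous_intros)
  then show ?thesis using assms by (simp add: L2_def)
qed

lemma L2_mult_integrable: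
  assumes "u \<in> L2 S" "v \<in> L2 S"
  shows "integrable (lebesgue_on S) (\<lambda>x. u x * v x)"
proof (rule Bochner_Integration.integrable_bound)
  show "integrable (lebesgue_on S) (\<lambda>x. (cmod (u x))\<^sup>2 + (cmod (v x))\<^sup>2)"
    using assms by (simp add: L2_def)
  show "AE x in lebesgue_on S. norm (u x * v x) \<le> norm ((cmod (u x))\<^sup>2 + (cmod (v x))\<^sup>2)"
  proof (intro AE_I2)
    fix x
    have "2 * cmod (u x) * cmod (v x) \<le> (cmod (u x))\<^sup>2 + (cmod (v x))\<^sup>2"
      by (rule sum_squares_bound)
    moreover have "0 \<le> cmod (u x) * cmod (v x)" by simp
    ultimately have "cmod (u x) * cmod (v x) \<le> (cmod (u x))\<^sup>2 + (cmod (v x))\<^sup>2" by linarith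
    then show "norm (u x * v x) \<le> norm ((cmod (u x))\<^sup>2 + (cmod (v x))\<^sup>2)"
      by (simp add: norm_mult)
  qed
qed (use assms in \<open>auto simp: L2_def intro!: borel_measurable_times\<close>)

lemma L2_mult_cnj_integrable:
  assumes "u \<in> L2 S" "v \<in> L2 S"
  shows "integrable (lebesgue_on S) (\<lambda>x. u x * cnj (v x))"
  by (rule L2_mult_integrable[OF assms(1) L2_cnj[OF assms(2)]])

lemma one_in_L2: "S \<in> lmeasurable \<Longrightarrow> (\<lambda>x. 1) \<in> L2 S"
  using finite_measure.integrable_const[OF finite_measure_lebesgue_on[of S], of "1 :: real"]
  by (simp add: L2_def)

lemma L2_integrable: "S \<in> lmeasurable \<Longrightarrow> u \<in> L2 S \<Longrightarrow> integrable (lebesgue_on S) u"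
  using L2_mult_integrable[OF _ one_in_L2, of u S] by simp

text \<open>Weak gradients and \<open>L\<^sup>2\<close> functions are controlled on the open domain only, whereas the forms are
  integrated over closed triangles, which protrude from the domain by a null set.\<close>

lemma integrable_null_extension:
  fixes f :: "'a::euclidean_space \<Rightarrow> 'b::euclidean_space"
  assumes "integrable (lebesgue_on \<Omega>) f" "\<Omega> \<in> sets lebesgue" "S \<in> sets lebesgue" "negligible (S - \<Omega>)"
  shows "integrable (lebesgue_on S) f"
proof -
  have "f absolutely_integrable_on \<Omega>"
    using assms by (simp add: integrable_restrict_space set_integrable_def)
  then have "f absolutely_integrable_on (S \<inter> \<Omega>)"
    by (rule set_integrable_subset) (use assms in auto)
  moreover have "f absolutely_integrable_on S \<longleftrightarrow> f absolutely_integrable_on (S \<inter> \<Omega>)"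
    by (rule absolutely_integrable_spike_set_eq)
       (auto intro: negligible_subset[OF assms(4)])
  ultimately show ?thesis using assms by (simp add: integrable_restrict_space set_integrable_def)
qed

lemma AE_null_extension:
  fixes \<Omega> S :: "'a::euclidean_space set"
  assumes "AE x in lebesgue_on \<Omega>. Q x" "\<Omega> \<in> sets lebesgue" "S \<in> sets lebesgue" "negligible (S - \<Omega>)"
  shows "AE x in lebesgue_on S. Q x"
proof -
  have "AE x in lebesgue. x \<in> \<Omega> \<longrightarrow> Q x" using assms by (simp add: AE_restrict_space_iff)
  moreover have "AE x in lebesgue. x \<notin> S - \<Omega>"
    using assms(4) by (intro AE_not_in) (simp add: negligible_iff_null_sets)
  ultimately have "AE x in lebesgue. x \<in> S \<longrightarrow> Q x" by eventually_elim auto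
  then show ?thesis using assms by (simp add: AE_restrict_space_iff)
qed

section \<open>Weak gradients\<close>

lemma continuous_on_smooth: "smooth f \<Longrightarrow> continuous_on UNIV f"
  unfolding smooth_def
  by (auto simp: continuous_on_eq_continuous_at dest: spec[of _ "[]"]
      intro!: differentiable_imp_continuous_within)

lemma smooth_partial: "smooth f \<Longrightarrow> smooth (partial i f)"
  unfolding smooth_def
proof (intro allI)
  fix js x assume "\<forall>js x. foldr partial js f differentiable at x"
  from this[rule_format, of "js @ [i]" x] show "foldr partial js (partial i f) differentiable at x"
    by simp
qed

lemma partial_zero_outside_support:
  assumes "x \<notin> closure {x. f x \<noteq> 0}"
  shows "partial i f x = 0"
proof -
  have "(f has_derivative (\<lambda>h. 0)) (at x)"
  proof (rule has_derivative_transform_within_open[where f = "\<lambda>x. 0" and s = "- closure {x. f x \<noteq> 0}"])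
    show "open (- closure {x. f x \<noteq> 0})" by (intro open_Compl closed_closure)
    show "0 = f y" if "y \<in> - closure {x. f x \<noteq> 0}" for y
      using that closure_subset[of "{x. f x \<noteq> 0}"] by auto
  qed (use assms in auto)
  then show ?thesis by (subst partial_eq) auto
qed

lemma continuous_compact_support_bounded:
  fixes f :: "point \<Rightarrow> real"
  assumes "continuous_on UNIV f" "compact K" "\<And>x. x \<notin> K \<Longrightarrow> f x = 0"
  obtains M where "\<And>x. \<bar>f x\<bar> \<le> M"
proof -
  have "bounded (f ` K)"
    by (intro compact_imp_bounded compact_continuous_image continuous_on_subset[OF assms(1)] assms(2)) auto
  then obtain M where "\<forall>x\<in>K. \<bar>f x\<bar> \<le> M" by (auto simp: bounded_iff)
  then have "\<bar>f x\<bar> \<le> \<bar>M\<bar>" for x by (cases "x \<in> K") (use assms(3) in force)+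
  then show ?thesis using that by blast
qed

lemma integrable_mult_compact_support:
  fixes h :: cfun
  assumes "integrable (lebesgue_on \<Omega>) h" "continuous_on UNIV f" "compact K" "\<And>x. x \<notin> K \<Longrightarrow> f x = 0"
  shows "integrable (lebesgue_on \<Omega>) (\<lambda>x. h x * of_real (f x))"
proof -
  obtain M where M: "\<And>x. \<bar>f x\<bar> \<le> M" using continuous_compact_support_bounded[OF assms(2-)] by blast
  have "f \<in> borel_measurable lebesgue"
    using assms(2) by (intro measurable_completion) (simp add: borel_measurable_continuous_onI)
  then have f: "f \<in> borel_measurable (lebesgue_on \<Omega>)" by (rule measurable_restrict_space1)
  have "0 \<le> M" using M[of 0] by simp
  show ?thesis
  proof (rule Bochner_Integration.integrable_bound)
    show "integrable (lebesgue_on \<Omega>) (\<lambda>x. of_real M * h x)" using assms(1) by simp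
    show "AE x in lebesgue_on \<Omega>. norm (h x * of_real (f x)) \<le> norm (of_real M * h x)"
      using M \<open>0 \<le> M\<close> by (intro AE_I2) (simp add: norm_mult mult.commute mult_right_mono)
    show "(\<lambda>x. h x * of_real (f x)) \<in> borel_measurable (lebesgue_on \<Omega>)"
      using f assms(1) by (intro borel_measurable_times borel_measurable_of_real) auto
  qed
qed

lemma integrable_mult_test_function:
  fixes h :: cfun
  assumes "integrable (lebesgue_on \<Omega>) h" "\<phi> \<in> test_functions \<Omega>"
  shows "integrable (lebesgue_on \<Omega>) (\<lambda>x. h x * of_real (\<phi> x))"
    and "integrable (lebesgue_on \<Omega>) (\<lambda>x. h x * of_real (partial i \<phi> x))"
proof -
  have s: "smooth \<phi>" and K: "compact (closure {x. \<phi> x \<noteq> 0})"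
    using assms(2) by (auto simp: test_functions_def)
  show "integrable (lebesgue_on \<Omega>) (\<lambda>x. h x * of_real (\<phi> x))"
    by (rule integrable_mult_compact_support[OF assms(1) continuous_on_smooth[OF s] K])
       (use closure_subset[of "{x. \<phi> x \<noteq> 0}"] in blast)
  show "integrable (lebesgue_on \<Omega>) (\<lambda>x. h x * of_real (partial i \<phi> x))"
    by (rule integrable_mult_compact_support[OF assms(1) continuous_on_smooth[OF smooth_partial[OF s]] K])
       (rule partial_zero_outside_support)
qed

lemma is_weak_gradientD:
  "is_weak_gradient \<Omega> v g \<Longrightarrow> \<phi> \<in> test_functions \<Omega> \<Longrightarrow>
     (LINT x|lebesgue_on \<Omega>. v x * of_real (partial i \<phi> x))
       = - (LINT x|lebesgue_on \<Omega>. g x $ i * of_real (\<phi> x))"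
  unfolding is_weak_gradient_def by blast

lemma is_weak_gradient_axpy:
  assumes \<Omega>: "\<Omega> \<in> lmeasurable" and u: "u \<in> L2 \<Omega>" "is_weak_gradient \<Omega> u g"
    and v: "v \<in> L2 \<Omega>" "is_weak_gradient \<Omega> v k"
  shows "is_weak_gradient \<Omega> (\<lambda>x. u x + c * v x) (\<lambda>x. \<chi> i. g x $ i + c * k x $ i)"
  unfolding is_weak_gradient_def
proof (intro conjI allI ballI)
  have m: "\<Omega> \<in> sets lebesgue" using \<Omega> by auto
  have gk: "(\<lambda>x. g x $ i) \<in> L2 \<Omega>" "(\<lambda>x. k x $ i) \<in> L2 \<Omega>" for i
    using u(2) v(2) by (auto simp: is_weak_gradient_def)
  show "(\<lambda>x. (\<chi> i. g x $ i + c * k x $ i) $ i) \<in> L2 \<Omega>" for i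
    using L2_axpy[OF gk m] by simp
  fix \<phi> i assume \<phi>: "\<phi> \<in> test_functions \<Omega>"
  note int = integrable_mult_test_function[OF L2_integrable[OF \<Omega>] \<phi>]
  have "(LINT x|lebesgue_on \<Omega>. (u x + c * v x) * of_real (partial i \<phi> x))
      = (LINT x|lebesgue_on \<Omega>. u x * of_real (partial i \<phi> x))
        + c * (LINT x|lebesgue_on \<Omega>. v x * of_real (partial i \<phi> x))"
    using int(2)[OF u(1)] int(2)[OF v(1)]
    by (simp add: distrib_right mult.assoc)
  also have "\<dots> = - (LINT x|lebesgue_on \<Omega>. g x $ i * of_real (\<phi> x))
        - c * (LINT x|lebesgue_on \<Omega>. k x $ i * of_real (\<phi> x))"
    by (simp add: is_weak_gradientD[OF u(2) \<phi>] is_weak_gradientD[OF v(2) \<phi>])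
  also have "\<dots> = - (LINT x|lebesgue_on \<Omega>. (\<chi> i. g x $ i + c * k x $ i) $ i * of_real (\<phi> x))"
    using int(1)[OF gk(1)] int(1)[OF gk(2)]
    by (simp add: distrib_right mult.assoc)
  finally show "(LINT x|lebesgue_on \<Omega>. (u x + c * v x) * of_real (partial i \<phi> x))
    = - (LINT x|lebesgue_on \<Omega>. (\<chi> i. g x $ i + c * k x $ i) $ i * of_real (\<phi> x))" .
qed

lemma is_weak_gradient_cnj:
  assumes "is_weak_gradient \<Omega> u g"
  shows "is_weak_gradient \<Omega> (\<lambda>x. cnj (u x)) (\<lambda>x. \<chi> i. cnj (g x $ i))"
  unfolding is_weak_gradient_def
proof (intro conjI allI ballI)
  show "(\<lambda>x. (\<chi> i. cnj (g x $ i)) $ i) \<in> L2 \<Omega>" for i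
    using L2_cnj assms by (simp add: is_weak_gradient_def)
  fix \<phi> i assume \<phi>: "\<phi> \<in> test_functions \<Omega>"
  have cnj: "(LINT x|lebesgue_on \<Omega>. cnj (f x) * of_real (r x)) = cnj (LINT x|lebesgue_on \<Omega>. f x * of_real (r x))"
    for f :: cfun and r
    using Bochner_Integration.integral_cnj[of "lebesgue_on \<Omega>" "\<lambda>x. f x * of_real (r x)"] by simp
  show "(LINT x|lebesgue_on \<Omega>. cnj (u x) * of_real (partial i \<phi> x))
    = - (LINT x|lebesgue_on \<Omega>. (\<chi> i. cnj (g x $ i)) $ i * of_real (\<phi> x))"
    by (simp add: cnj is_weak_gradientD[OF assms \<phi>])
qed

text \<open>The operator \<open>wgrad\<close> selects one weak gradient for each function without regard to linear structure.  Uniqueness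
  almost everywhere is what makes it linear and compatible with conjugation up to null sets.\<close>

lemma weak_gradient_unique:
  assumes "open \<Omega>" "\<Omega> \<in> lmeasurable" "is_weak_gradient \<Omega> v g" "is_weak_gradient \<Omega> v k"
  shows "AE x in lebesgue_on \<Omega>. g x = k x"
proof -
  have m: "\<Omega> \<in> sets lebesgue" using assms(2) by auto
  have gk: "(\<lambda>x. g x $ i) \<in> L2 \<Omega>" "(\<lambda>x. k x $ i) \<in> L2 \<Omega>" for i
    using assms by (auto simp: is_weak_gradient_def)
  have "AE x in lebesgue_on \<Omega>. g x $ i - k x $ i = 0" for i
  proof (rule AE_zero_of_orthogonal_to_test_functions[OF assms(1)])
    show "integrable (lebesgue_on \<Omega>) (\<lambda>x. g x $ i - k x $ i)"
      using L2_integrable[OF assms(2)] gk by auto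
    fix \<phi> assume \<phi>: "\<phi> \<in> test_functions \<Omega>"
    have "(LINT x|lebesgue_on \<Omega>. (g x $ i - k x $ i) * of_real (\<phi> x))
        = (LINT x|lebesgue_on \<Omega>. g x $ i * of_real (\<phi> x)) - (LINT x|lebesgue_on \<Omega>. k x $ i * of_real (\<phi> x))"
      using integrable_mult_test_function(1)[OF L2_integrable[OF assms(2)] \<phi>] gk
      by (simp add: left_diff_distrib)
    also have "\<dots> = 0"
    proof -
      have "- (LINT x|lebesgue_on \<Omega>. g x $ i * of_real (\<phi> x)) = - (LINT x|lebesgue_on \<Omega>. k x $ i * of_real (\<phi> x))"
        by (rule trans[OF is_weak_gradientD[OF assms(3) \<phi>, symmetric] is_weak_gradientD[OF assms(4) \<phi>]])
      then show ?thesis by simp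
    qed
    finally show "(LINT x|lebesgue_on \<Omega>. (g x $ i - k x $ i) * of_real (\<phi> x)) = 0" .
  qed
  then have "AE x in lebesgue_on \<Omega>. \<forall>i. g x $ i - k x $ i = 0"
    by (simp add: AE_all_countable)
  then show ?thesis by eventually_elim (simp add: vec_eq_iff)
qed

lemma H1_L2: "v \<in> H1 \<Omega> \<Longrightarrow> v \<in> L2 \<Omega>"
  by (simp add: H1_def)

lemma is_weak_gradient_wgrad: "v \<in> H1 \<Omega> \<Longrightarrow> is_weak_gradient \<Omega> v (wgrad \<Omega> v)"
  unfolding H1_def wgrad_def by (simp add: someI_ex)

lemma wgrad_L2: "v \<in> H1 \<Omega> \<Longrightarrow> (\<lambda>x. wgrad \<Omega> v x $ i) \<in> L2 \<Omega>"
  using is_weak_gradient_wgrad[of v \<Omega>] by (simp add: is_weak_gradient_def)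

lemma H1_axpy: "\<Omega> \<in> lmeasurable \<Longrightarrow> u \<in> H1 \<Omega> \<Longrightarrow> v \<in> H1 \<Omega> \<Longrightarrow> (\<lambda>x. u x + c * v x) \<in> H1 \<Omega>"
  using is_weak_gradient_axpy[OF _ H1_L2 is_weak_gradient_wgrad H1_L2 is_weak_gradient_wgrad, of \<Omega> u v c]
    L2_axpy[OF H1_L2 H1_L2, of u \<Omega> v c] fmeasurableD[of \<Omega> lebesgue]
  by (auto simp: H1_def)

lemma H1_cnj: "u \<in> H1 \<Omega> \<Longrightarrow> (\<lambda>x. cnj (u x)) \<in> H1 \<Omega>"
  using is_weak_gradient_cnj[OF is_weak_gradient_wgrad, of u \<Omega>] L2_cnj[OF H1_L2, of u \<Omega>]
  by (auto simp: H1_def)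

lemma H1_zero: "(\<lambda>x. 0) \<in> H1 \<Omega>"
  by (auto simp: H1_def L2_def is_weak_gradient_def intro!: exI[of _ "\<lambda>x. 0"])

lemma csubspace_H1: "\<Omega> \<in> lmeasurable \<Longrightarrow> csubspace (H1 \<Omega>)"
  by (simp add: csubspace_def H1_zero H1_axpy)

lemma wgrad_axpy:
  assumes "open \<Omega>" "\<Omega> \<in> lmeasurable" "u \<in> H1 \<Omega>" "v \<in> H1 \<Omega>"
  shows "AE x in lebesgue_on \<Omega>. wgrad \<Omega> (\<lambda>x. u x + c * v x) x $ i = wgrad \<Omega> u x $ i + c * wgrad \<Omega> v x $ i"
  using weak_gradient_unique[OF assms(1,2) is_weak_gradient_wgrad[OF H1_axpy[OF assms(2-), of c]]
      is_weak_gradient_axpy[OF assms(2) H1_L2 is_weak_gradient_wgrad H1_L2 is_weak_gradient_wgrad]] assms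
  by (auto elim: eventually_mono)

lemma wgrad_cnj:
  assumes "open \<Omega>" "\<Omega> \<in> lmeasurable" "u \<in> H1 \<Omega>"
  shows "AE x in lebesgue_on \<Omega>. wgrad \<Omega> (\<lambda>x. cnj (u x)) x $ i = cnj (wgrad \<Omega> u x $ i)"
  using weak_gradient_unique[OF assms(1,2) is_weak_gradient_wgrad[OF H1_cnj[OF assms(3)]]
      is_weak_gradient_cnj[OF is_weak_gradient_wgrad[OF assms(3)]]]
  by (auto elim: eventually_mono)

section \<open>Volume forms\<close>

text \<open>The integration domains that occur (the domain itself, triangles, unions of triangles) are of this
  form; a property that holds almost everywhere in \<open>\<Omega>\<close> then holds almost everywhere in \<open>S\<close>.\<close>

definition essential_part :: "'a::euclidean_space set \<Rightarrow> 'a set \<Rightarrow> bool" where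
  "essential_part \<Omega> S \<longleftrightarrow> S \<in> sets lebesgue \<and> negligible (S - \<Omega>)"

lemma ip_integrable:
  assumes "\<Omega> \<in> sets lebesgue" "essential_part \<Omega> S" "u \<in> L2 \<Omega>" "v \<in> L2 \<Omega>"
  shows "integrable (lebesgue_on S) (\<lambda>x. u x * cnj (v x))"
  using assms integrable_null_extension[OF L2_mult_cnj_integrable[OF assms(3,4)]]
  by (simp add: essential_part_def)

lemma ip_cong_AE:
  assumes "\<Omega> \<in> sets lebesgue" "essential_part \<Omega> S" "u \<in> L2 \<Omega>" "v \<in> L2 \<Omega>" "u' \<in> L2 \<Omega>" "v' \<in> L2 \<Omega>"
    and "AE x in lebesgue_on \<Omega>. u x = u' x" "AE x in lebesgue_on \<Omega>. v x = v' x"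
  shows "ip S u v = ip S u' v'"
  unfolding ip_def
proof (rule integral_cong_AE)
  show "(\<lambda>x. u x * cnj (v x)) \<in> borel_measurable (lebesgue_on S)"
    "(\<lambda>x. u' x * cnj (v' x)) \<in> borel_measurable (lebesgue_on S)"
    using ip_integrable[OF assms(1,2)] assms by (blast intro: borel_measurable_integrable)+
  have "AE x in lebesgue_on \<Omega>. u x * cnj (v x) = u' x * cnj (v' x)"
    using assms(7,8) by eventually_elim simp
  then show "AE x in lebesgue_on S. u x * cnj (v x) = u' x * cnj (v' x)"
    using assms(1,2) AE_null_extension by (auto simp: essential_part_def)
qed

lemma ip_axpy_right:
  assumes "\<Omega> \<in> sets lebesgue" "essential_part \<Omega> S" "w \<in> L2 \<Omega>" "u \<in> L2 \<Omega>" "v \<in> L2 \<Omega>"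
  shows "ip S w (\<lambda>x. u x + c * v x) = ip S w u + cnj c * ip S w v"
proof -
  have eq: "w x * cnj (u x + c * v x) = w x * cnj (u x) + cnj c * (w x * cnj (v x))" for x
    by (simp add: algebra_simps)
  show ?thesis unfolding ip_def eq
    using ip_integrable[OF assms(1,2)] assms(3-) by simp
qed

lemma ip_cnj_commute: "ip S w v = cnj (ip S v w)"
  using Bochner_Integration.integral_cnj[of "lebesgue_on S" "\<lambda>x. v x * cnj (w x)"]
  by (simp add: ip_def mult.commute)

lemma ip_cnj_cnj: "ip S (\<lambda>x. cnj (w x)) (\<lambda>x. cnj (v x)) = ip S v w"
  by (simp add: ip_def mult.commute)

lemma ip_self: "ip S v v = of_real (LINT x|lebesgue_on S. (cmod (v x))\<^sup>2)"
  unfolding ip_def complex_norm_square[symmetric] by (rule integral_complex_of_real)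

lemma ip_self_nonneg: "0 \<le> Re (ip S v v)"
  by (simp add: ip_self)

lemma grad_ip_eq:
  assumes "Om P \<in> sets lebesgue" "essential_part (Om P) S" "v \<in> H1 (Om P)" "w \<in> H1 (Om P)"
  shows "grad_ip P S v w = (\<Sum>i\<in>UNIV. ip S (\<lambda>x. wgrad (Om P) v x $ i) (\<lambda>x. wgrad (Om P) w x $ i))"
  unfolding grad_ip_def ip_def
  by (rule Bochner_Integration.integral_sum) (intro ip_integrable[OF assms(1,2)] wgrad_L2 assms)

text \<open>Hermitian symmetry reduces linearity in the first argument to antilinearity in the second.\<close>

lemma sesquilinear_on_hermitian:
  assumes "\<And>w. w \<in> W \<Longrightarrow> antilinear_on W (B w)" "\<And>v w. v \<in> W \<Longrightarrow> w \<in> W \<Longrightarrow> B v w = cnj (B w v)"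
    and "csubspace W"
  shows "sesquilinear_on W B"
  unfolding sesquilinear_on_def
proof (intro ballI conjI)
  fix w assume w: "w \<in> W"
  show "antilinear_on W (B w)" by (rule assms(1)[OF w])
  show "antilinear_on W (\<lambda>v. cnj (B v w))"
    unfolding antilinear_on_def
  proof (intro allI ballI)
    fix c u v assume uv: "u \<in> W" "v \<in> W"
    then have "cnj (B z w) = B w z" if "z \<in> W" for z using assms(2)[OF w that] by simp
    then show "cnj (B (\<lambda>x. u x + c * v x) w) = cnj (B u w) + cnj c * cnj (B v w)"
      using antilinear_onD[OF assms(1)[OF w] uv] csubspace_axpy[OF assms(3) uv] uv by simp
  qed
qed

lemma sesquilinear_on_combine:
  assumes "sesquilinear_on W A" "sesquilinear_on W B"
  shows "sesquilinear_on W (\<lambda>u v. A u v + c * B u v)"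
proof -
  have *: "antilinear_on W (\<lambda>v. F v + d * G v)" if "antilinear_on W F" "antilinear_on W G" for F G d
    using that by (auto simp: antilinear_on_def algebra_simps)
  show ?thesis
    unfolding sesquilinear_on_def
    using assms *[of "A _" "B _" c] *[of "\<lambda>v. cnj (A v _)" "\<lambda>v. cnj (B v _)" "cnj c"]
    by (simp add: sesquilinear_on_def)
qed

lemma sesquilinear_on_ip:
  assumes "\<Omega> \<in> lmeasurable" "essential_part \<Omega> S"
  shows "sesquilinear_on (H1 \<Omega>) (ip S)"
proof (rule sesquilinear_on_hermitian[OF _ ip_cnj_commute csubspace_H1[OF assms(1)]])
  fix w assume "w \<in> H1 \<Omega>"
  then show "antilinear_on (H1 \<Omega>) (ip S w)"
    unfolding antilinear_on_def
    by (intro allI ballI ip_axpy_right[OF fmeasurableD[OF assms(1)] assms(2)] H1_L2)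
qed

lemma grad_ip_cnj_commute:
  assumes "Om P \<in> sets lebesgue" "essential_part (Om P) S" "v \<in> H1 (Om P)" "w \<in> H1 (Om P)"
  shows "grad_ip P S w v = cnj (grad_ip P S v w)"
  unfolding grad_ip_eq[OF assms] grad_ip_eq[OF assms(1,2,4,3)] cnj_sum
  by (intro sum.cong refl ip_cnj_commute)

lemma grad_ip_cnj_cnj:
  assumes "open (Om P)" "Om P \<in> lmeasurable" "essential_part (Om P) S" "v \<in> H1 (Om P)" "w \<in> H1 (Om P)"
  shows "grad_ip P S (\<lambda>x. cnj (w x)) (\<lambda>x. cnj (v x)) = grad_ip P S v w"
proof -
  have m: "Om P \<in> sets lebesgue" using assms by auto
  have "ip S (\<lambda>x. wgrad (Om P) (\<lambda>x. cnj (w x)) x $ i) (\<lambda>x. wgrad (Om P) (\<lambda>x. cnj (v x)) x $ i)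
      = ip S (\<lambda>x. wgrad (Om P) v x $ i) (\<lambda>x. wgrad (Om P) w x $ i)" for i
  proof -
    have "ip S (\<lambda>x. wgrad (Om P) (\<lambda>x. cnj (w x)) x $ i) (\<lambda>x. wgrad (Om P) (\<lambda>x. cnj (v x)) x $ i)
      = ip S (\<lambda>x. cnj (wgrad (Om P) w x $ i)) (\<lambda>x. cnj (wgrad (Om P) v x $ i))"
      by (rule ip_cong_AE[OF m assms(3)]) (intro wgrad_L2 H1_cnj L2_cnj wgrad_cnj assms)+
    then show ?thesis by (simp only: ip_cnj_cnj)
  qed
  then show ?thesis by (simp add: grad_ip_eq[OF m assms(3)] assms H1_cnj)
qed

lemma sesquilinear_on_grad_ip:
  assumes "open (Om P)" "Om P \<in> lmeasurable" "essential_part (Om P) S"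
  shows "sesquilinear_on (H1 (Om P)) (grad_ip P S)"
proof (rule sesquilinear_on_hermitian[OF _ grad_ip_cnj_commute csubspace_H1[OF assms(2)]])
  have m: "Om P \<in> sets lebesgue" using assms by auto
  fix w assume w: "w \<in> H1 (Om P)"
  show "antilinear_on (H1 (Om P)) (grad_ip P S w)"
    unfolding antilinear_on_def
  proof (intro allI ballI)
    fix c u v assume uv: "u \<in> H1 (Om P)" "v \<in> H1 (Om P)"
    let ?g = "\<lambda>w i x. wgrad (Om P) w x $ i"
    have "ip S (?g w i) (?g (\<lambda>x. u x + c * v x) i) = ip S (?g w i) (?g u i) + cnj c * ip S (?g w i) (?g v i)" for i
    proof -
      have "ip S (?g w i) (?g (\<lambda>x. u x + c * v x) i) = ip S (?g w i) (\<lambda>x. ?g u i x + c * ?g v i x)"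
        by (rule ip_cong_AE[OF m assms(3)])
          (intro wgrad_L2 L2_axpy H1_axpy wgrad_axpy w uv m assms AE_I2 refl)+
      also have "\<dots> = ip S (?g w i) (?g u i) + cnj c * ip S (?g w i) (?g v i)"
        by (rule ip_axpy_right[OF m assms(3)]) (intro wgrad_L2 w uv)+
      finally show ?thesis .
    qed
    then show "grad_ip P S w (\<lambda>x. u x + c * v x) = grad_ip P S w u + cnj c * grad_ip P S w v"
      by (simp add: grad_ip_eq[OF m assms(3)] w uv H1_axpy[OF assms(2)] sum.distrib sum_distrib_left)
  qed
qed (use assms in auto)

lemma grad_ip_self:
  assumes "Om P \<in> sets lebesgue" "essential_part (Om P) S" "v \<in> H1 (Om P)"
  shows "grad_ip P S v v = of_real (\<Sum>i\<in>UNIV. LINT x|lebesgue_on S. (cmod (wgrad (Om P) v x $ i))\<^sup>2)"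
  by (simp add: grad_ip_eq assms ip_self)

lemma grad_ip_self_nonneg:
  assumes "Om P \<in> sets lebesgue" "essential_part (Om P) S" "v \<in> H1 (Om P)"
  shows "0 \<le> Re (grad_ip P S v v)"
  by (simp add: grad_ip_self assms sum_nonneg)

section \<open>Traces of continuous functions\<close>

lemma integrable_on_bounded_continuous:
  fixes f :: "'a::euclidean_space \<Rightarrow> complex"
  assumes "S \<in> lmeasurable" "continuous_on S f" "bounded (f ` S)"
  shows "integrable (lebesgue_on S) f"
proof -
  obtain M where M: "\<forall>x\<in>S. cmod (f x) \<le> M" using assms(3) by (auto simp: bounded_iff)
  interpret finite_measure "lebesgue_on S" by (rule finite_measure_lebesgue_on[OF assms(1)])
  show ?thesis
  proof (rule integrable_const_bound[of _ M])
    show "AE x in lebesgue_on S. cmod (f x) \<le> M" using M by (intro AE_I2) simp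
    show "f \<in> borel_measurable (lebesgue_on S)"
      by (rule continuous_imp_measurable_on_sets_lebesgue[OF assms(2)]) (use assms(1) in auto)
  qed
qed

lemma measure_pos_of_open:
  fixes A :: "'a::euclidean_space set"
  assumes "open A" "bounded A" "A \<noteq> {}"
  shows "0 < measure lebesgue A"
proof -
  have "A \<in> lmeasurable" using assms by (simp add: lmeasurable_open)
  then have "measure lebesgue A \<noteq> 0"
    using open_not_negligible[OF assms(1,3)] by (simp add: negligible_iff_measure)
  then show ?thesis by (simp add: zero_less_measure_iff)
qed

text \<open>The mean value over \<open>\<Omega> \<inter> ball x r\<close> differs from \<open>v x\<close> by at most the oscillation of \<open>v\<close> near \<open>x\<close>.  The positive measure of
  these sets, which are open and nonempty, makes the mean value meaningful.\<close>

lemma bdtrace_continuous: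
  assumes \<Omega>: "open \<Omega>" "bounded \<Omega>" and x: "x \<in> closure \<Omega>" and v: "continuous_on (closure \<Omega>) v"
  shows "bdtrace \<Omega> v x = v x"
proof -
  let ?A = "\<lambda>r. \<Omega> \<inter> ball x r" let ?m = "\<lambda>r. measure lebesgue (?A r)"
  have "compact (closure \<Omega>)" using \<Omega> by (simp add: compact_closure)
  then have bv: "bounded (v ` closure \<Omega>)" by (intro compact_imp_bounded compact_continuous_image v)
  have A: "open (?A r)" "bounded (?A r)" "?A r \<in> lmeasurable" for r
    using \<Omega> by (auto intro: lmeasurable_open bounded_Int)
  have m: "0 < ?m r" if "0 < r" for r
  proof (rule measure_pos_of_open[OF A(1,2)])
    have "\<exists>y\<in>\<Omega>. dist y x < r" using x that by (simp add: closure_approachable)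
    then obtain y where "y \<in> \<Omega>" "dist y x < r" by blast
    then have "y \<in> ?A r" by (simp add: dist_commute)
    then show "?A r \<noteq> {}" by blast
  qed
  have sub: "?A r \<subseteq> closure \<Omega>" for r using closure_subset by auto
  have iv: "integrable (lebesgue_on (?A r)) v" for r
    by (rule integrable_on_bounded_continuous[OF A(3) continuous_on_subset[OF v sub] bounded_subset[OF bv]])
       (use sub in auto)
  have ic: "integrable (lebesgue_on (?A r)) (\<lambda>y. c)" for r and c :: "'b::{banach, second_countable_topology}"
    by (rule finite_measure.integrable_const[OF finite_measure_lebesgue_on[OF A(3)]])
  have mA: "measure (lebesgue_on (?A r)) (?A r) = ?m r" for r
    using A(3)[of r] by (simp add: measure_restrict_space)
  have "((\<lambda>r. (LINT y|lebesgue_on (?A r). v y) / of_real (?m r)) \<longlongrightarrow> v x) (at_right 0)"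
  proof (rule tendstoI)
    fix e :: real assume e: "0 < e"
    obtain d where d: "0 < d" "\<And>y. y \<in> closure \<Omega> \<Longrightarrow> dist y x < d \<Longrightarrow> dist (v y) (v x) < e / 2"
      using v x e unfolding continuous_on_iff by (meson half_gt_zero)
    have "dist ((LINT y|lebesgue_on (?A r). v y) / of_real (?m r)) (v x) < e" if r: "0 < r" "r < d" for r
    proof -
      have "cmod (LINT y|lebesgue_on (?A r). v y - v x) \<le> (LINT y|lebesgue_on (?A r). cmod (v y - v x))"
        by (rule integral_norm_bound)
      also have "\<dots> \<le> (LINT y|lebesgue_on (?A r). e / 2)"
      proof (rule integral_mono)
        show "integrable (lebesgue_on (?A r)) (\<lambda>y. cmod (v y - v x))"
          by (intro integrable_norm Bochner_Integration.integrable_diff iv ic)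
        fix y assume "y \<in> space (lebesgue_on (?A r))"
        then show "cmod (v y - v x) \<le> e / 2"
          using d(2)[of y] r sub[of r] by (auto simp: dist_norm norm_minus_commute)
      qed (rule ic)
      also have "\<dots> = e / 2 * ?m r" by (simp add: mA)
      finally have 1: "cmod (LINT y|lebesgue_on (?A r). v y - v x) \<le> e / 2 * ?m r" .
      have "(LINT y|lebesgue_on (?A r). v y - v x) = (LINT y|lebesgue_on (?A r). v y) - of_real (?m r) * v x"
        using iv[of r] ic[of r "v x"] by (simp add: mA scaleR_conv_of_real)
      then have "(LINT y|lebesgue_on (?A r). v y) / of_real (?m r) - v x
          = (LINT y|lebesgue_on (?A r). v y - v x) / of_real (?m r)"
        using m[OF r(1)] by (simp add: field_simps)
      then have "dist ((LINT y|lebesgue_on (?A r). v y) / of_real (?m r)) (v x)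
          = cmod (LINT y|lebesgue_on (?A r). v y - v x) / ?m r"
        using m[OF r(1)] by (simp add: dist_norm norm_divide)
      also have "\<dots> \<le> e / 2" using 1 m[OF r(1)] by (simp add: field_simps)
      finally show ?thesis using e by simp
    qed
    then show "\<forall>\<^sub>F r in at_right 0. dist ((LINT y|lebesgue_on (?A r). v y) / of_real (?m r)) (v x) < e"
      using d(1) unfolding eventually_at_right[OF d(1)] by blast
  qed
  then show ?thesis unfolding bdtrace_def by (intro tendsto_Lim) auto
qed

section \<open>The Robin form\<close>

lemma arc_integrand_integrable:
  assumes f: "continuous_on F f" and seg: "closed_segment p q \<subseteq> F"
    and R: "R = A \<inter> F" "A \<in> sets borel"
  shows "integrable (lebesgue_on {0..1}) (\<lambda>t. if linepath p q t \<in> R then f (linepath p q t) else 0 :: complex)"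
proof -
  have lp: "linepath p q ` {0..1} \<subseteq> F" using seg by (simp add: linepath_image_01)
  have "continuous_on {0..1} (\<lambda>t. f (linepath p q t))"
    by (rule continuous_on_compose2[OF f _ lp]) (intro continuous_on_linepath)
  then have int: "integrable (lebesgue_on {0..1}) (\<lambda>t. f (linepath p q t))"
    by (intro integrable_on_bounded_continuous)
      (auto intro!: compact_imp_bounded compact_continuous_image)
  have m: "linepath p q -` A \<in> sets lebesgue"
  proof -
    have "linepath p q \<in> borel_measurable borel"
      by (intro borel_measurable_continuous_onI continuous_on_linepath)
    then have "linepath p q -` A \<inter> space borel \<in> sets borel" by (rule measurable_sets[OF _ R(2)])
    then show ?thesis by (simp add: sets_completionI_sets)
  qed
  have "integrable (lebesgue_on {0..1}) (\<lambda>t. indicat_real (linepath p q -` A \<inter> {0..1}) t *\<^sub>R f (linepath p q t))"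
    using m by (intro integrable_mult_indicator int) (auto simp: sets_restrict_space_iff)
  then show ?thesis
    by (rule Bochner_Integration.integrable_cong[THEN iffD1, OF refl, rotated])
      (use lp R(1) in \<open>auto simp: indicator_def image_subset_iff\<close>)
qed

lemma arc_integral_cong:
  assumes "\<And>p q. (p, q) \<in> E \<Longrightarrow> closed_segment p q \<subseteq> F" "\<And>x. x \<in> F \<Longrightarrow> f x = g x"
  shows "arc_integral E R f = arc_integral E R g"
proof -
  have "(LINT t|lebesgue_on {0..1}. (if linepath p q t \<in> R then f (linepath p q t) else 0))
      = (LINT t|lebesgue_on {0..1}. (if linepath p q t \<in> R then g (linepath p q t) else 0))"
    if "(p, q) \<in> E" for p q
  proof (rule Bochner_Integration.integral_cong[OF refl])
    fix t :: real assume "t \<in> space (lebesgue_on {0..1})"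
    then have "linepath p q t \<in> F" using assms(1)[OF that] by (auto simp: linepath_image_01[symmetric])
    then show "(if linepath p q t \<in> R then f (linepath p q t) else 0)
      = (if linepath p q t \<in> R then g (linepath p q t) else 0)" using assms(2) by simp
  qed
  then show ?thesis unfolding arc_integral_def by (intro sum.cong refl) auto
qed

lemma arc_integral_axpy:
  assumes "\<And>p q. (p, q) \<in> E \<Longrightarrow> closed_segment p q \<subseteq> F" "continuous_on F f" "continuous_on F g"
    and "R = A \<inter> F" "A \<in> sets borel"
  shows "arc_integral E R (\<lambda>x. f x + c * g x) = arc_integral E R f + c * arc_integral E R g"
proof -
  have "(LINT t|lebesgue_on {0..1}. (if linepath p q t \<in> R then f (linepath p q t) + c * g (linepath p q t) else 0))
      = (LINT t|lebesgue_on {0..1}. (if linepath p q t \<in> R then f (linepath p q t) else 0))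
        + c * (LINT t|lebesgue_on {0..1}. (if linepath p q t \<in> R then g (linepath p q t) else 0))"
    if "(p, q) \<in> E" for p q
  proof -
    note int = arc_integrand_integrable[OF _ assms(1)[OF that] assms(4,5)]
    have "(LINT t|lebesgue_on {0..1}. (if linepath p q t \<in> R then f (linepath p q t) + c * g (linepath p q t) else 0))
      = (LINT t|lebesgue_on {0..1}. (if linepath p q t \<in> R then f (linepath p q t) else 0)
          + c * (if linepath p q t \<in> R then g (linepath p q t) else 0))"
      by (rule Bochner_Integration.integral_cong) auto
    then show ?thesis using int[OF assms(2)] int[OF assms(3)] by simp
  qed
  then show ?thesis
    unfolding arc_integral_def sum_distrib_left sum.distrib[symmetric]
    by (intro sum.cong refl) (auto simp: algebra_simps)
qed

lemma arc_integral_cnj: "arc_integral E R (\<lambda>x. cnj (f x)) = cnj (arc_integral E R f)"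
proof -
  have "(LINT t|lebesgue_on {0..1}. (if linepath p q t \<in> R then cnj (f (linepath p q t)) else 0))
      = cnj (LINT t|lebesgue_on {0..1}. (if linepath p q t \<in> R then f (linepath p q t) else 0))" for p q
    unfolding Bochner_Integration.integral_cnj[symmetric]
    by (rule Bochner_Integration.integral_cong) auto
  then show ?thesis by (simp add: arc_integral_def case_prod_beta)
qed

section \<open>Triangles\<close>

lemma affine_fun_zero_of_interior:
  assumes "p \<in> affine_funs" "interior T \<noteq> {}" "\<And>x. x \<in> T \<Longrightarrow> p x = 0"
  shows "p = (\<lambda>x. 0)"
proof -
  obtain \<alpha> \<beta> \<gamma> where p: "p = (\<lambda>x. \<alpha> + \<beta> * of_real (x $ 1) + \<gamma> * of_real (x $ 2))"
    using assms(1) by (auto simp: affine_funs_def)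
  obtain y where "y \<in> interior T" using assms(2) by auto
  then obtain e where e: "0 < e" "ball y e \<subseteq> T" by (auto simp: mem_interior)
  have in_T: "y + (e / 2) *\<^sub>R axis i 1 \<in> T" for i :: 2
    using e by (auto simp: dist_norm norm_axis_1)
  have y: "p y = 0" using e centre_in_ball assms(3) by blast
  have "p (y + (e / 2) *\<^sub>R axis 1 1) = p y + \<beta> * of_real (e / 2)"
    "p (y + (e / 2) *\<^sub>R axis 2 1) = p y + \<gamma> * of_real (e / 2)"
    by (simp_all add: p axis_def algebra_simps)
  then have "\<beta> = 0" "\<gamma> = 0" using assms(3)[OF in_T] y e by auto
  then show ?thesis using y by (simp add: p)
qed

lemma csubspace_affine_funs: "csubspace affine_funs"
  unfolding csubspace_def
proof (intro conjI allI ballI)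
  show "(\<lambda>x. 0) \<in> affine_funs" unfolding affine_funs_def by (intro CollectI exI[of _ 0]) simp
  fix c u v assume "u \<in> affine_funs" "v \<in> affine_funs"
  then obtain a b d a' b' d' where
    "u = (\<lambda>x. a + b * of_real (x $ 1) + d * of_real (x $ 2))"
    "v = (\<lambda>x. a' + b' * of_real (x $ 1) + d' * of_real (x $ 2))"
    by (auto simp: affine_funs_def)
  then have "(\<lambda>x. u x + c * v x)
    = (\<lambda>x. (a + c * a') + (b + c * b') * of_real (x $ 1) + (d + c * d') * of_real (x $ 2))"
    by (auto simp: algebra_simps)
  then show "(\<lambda>x. u x + c * v x) \<in> affine_funs" by (auto simp: affine_funs_def)
qed

lemma cnj_affine_funs: "p \<in> affine_funs \<Longrightarrow> (\<lambda>x. cnj (p x)) \<in> affine_funs"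
proof -
  assume "p \<in> affine_funs"
  then obtain a b d where "p = (\<lambda>x. a + b * of_real (x $ 1) + d * of_real (x $ 2))"
    by (auto simp: affine_funs_def)
  then have "(\<lambda>x. cnj (p x)) = (\<lambda>x. cnj a + cnj b * of_real (x $ 1) + cnj d * of_real (x $ 2))" by simp
  then show ?thesis by (auto simp: affine_funs_def)
qed

lemma continuous_on_affine_fun: "p \<in> affine_funs \<Longrightarrow> continuous_on S p"
  by (auto simp: affine_funs_def intro!: continuous_intros)

lemma determined_on_affine_funs: "determined_on {0, axis 1 1, axis 2 1} affine_funs"
  unfolding determined_on_def by (auto simp: affine_funs_def axis_def)

locale triangle =
  fixes T :: "point set"
  assumes simplex: "2 simplex T"
begin

definition corners :: "point set" where "corners = {z. z extreme_point_of T}"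

lemma corners: "\<not> affine_dependent corners" "card corners = 3" "T = convex hull corners"
proof -
  obtain C where C: "\<not> affine_dependent C" "int (card C) = 2 + 1" "T = convex hull C"
    using simplex unfolding simplex_def by blast
  have "corners = {z. z extreme_point_of (convex hull C)}"
    by (simp add: corners_def flip: C(3))
  then have "corners = C"
    using extreme_point_of_convex_hull_affine_independent[OF C(1)] by auto
  then show "\<not> affine_dependent corners" "card corners = 3" "T = convex hull corners"
    using C by auto
qed

lemma finite_corners: "finite corners"
  using corners(2) by (metis card.infinite zero_neq_numeral)

lemma shape: "compact T" "convex T" "aff_dim T = 2" "closed T"
  using compact_simplex convex_simplex aff_dim_simplex closed_simplex simplex by blast+

lemma interior_nonempty: "interior T \<noteq> {}"
proof
  assume "interior T = {}"
  have "affine hull T = UNIV" using aff_dim_eq_full[of T] shape(3) by simp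
  then have "rel_interior T = interior T" by (simp add: rel_interior_interior)
  moreover have "T \<noteq> {}" using shape(3) by auto
  ultimately show False using rel_interior_eq_empty[OF shape(2)] \<open>interior T = {}\<close> by simp
qed

lemma affine_fun_zero_of_corners:
  assumes "p \<in> affine_funs" "\<And>z. z extreme_point_of T \<Longrightarrow> p z = 0"
  shows "p = (\<lambda>x. 0)"
proof (rule affine_fun_zero_of_interior[OF assms(1) interior_nonempty])
  obtain a b d where p: "p = (\<lambda>x. a + b * of_real (x $ 1) + d * of_real (x $ 2))"
    using assms(1) by (auto simp: affine_funs_def)
  have comb: "p (s *\<^sub>R x + t *\<^sub>R y) = of_real s * p x + of_real t * p y" if "s + t = 1" for s t x y
  proof -
    have "a = (of_real s + of_real t) * a" using that by (simp flip: of_real_add)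
    then show ?thesis by (simp add: p algebra_simps)
  qed
  have "convex {x. p x = 0}" by (auto simp: convex_def comb)
  then have "convex hull corners \<subseteq> {x. p x = 0}"
    by (intro hull_minimal) (auto simp: corners_def assms(2))
  then show "p x = 0" if "x \<in> T" for x using that corners(3) by auto
qed

text \<open>Evaluation at the three corners is an injective linear map from \<open>complex ^ 3\<close>, the space of
  coefficients, to itself, and therefore surjective.\<close>

lemma affine_interpolation: "\<exists>!p. p \<in> affine_funs \<and> (\<forall>z. z extreme_point_of T \<longrightarrow> p z = c z)"
proof (rule ex_ex1I)
  fix p q assume p: "p \<in> affine_funs \<and> (\<forall>z. z extreme_point_of T \<longrightarrow> p z = c z)"
    and q: "q \<in> affine_funs \<and> (\<forall>z. z extreme_point_of T \<longrightarrow> q z = c z)"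
  then have "(\<lambda>x. p x - q x) = (\<lambda>x. 0)"
    by (intro affine_fun_zero_of_corners csubspace_diff[OF csubspace_affine_funs]) auto
  then show "p = q" by (metis eq_iff_diff_eq_0 ext)
next
  obtain f :: "3 \<Rightarrow> point" where f: "bij_betw f UNIV corners"
    using finite_same_card_bij[OF finite[of "UNIV :: 3 set"] finite_corners] corners(2) by auto
  define P :: "complex ^ 3 \<Rightarrow> cfun" where
    "P v = (\<lambda>x. v $ 1 + v $ 2 * of_real (x $ 1) + v $ 3 * of_real (x $ 2))" for v
  define L :: "complex ^ 3 \<Rightarrow> complex ^ 3" where "L v = (\<chi> j. P v (f j))" for v
  have aff: "P v \<in> affine_funs" for v unfolding P_def affine_funs_def by blast
  have lin: "linear L"
    by (rule linearI) (simp_all add: L_def P_def vec_eq_iff algebra_simps)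
  have "inj L"
  proof (subst linear_injective_0[OF lin], intro allI impI)
    fix v assume "L v = 0"
    then have "P v (f j) = 0" for j by (simp add: L_def vec_eq_iff)
    then have "P v z = 0" if "z extreme_point_of T" for z
      using that f by (metis bij_betw_imp_surj_on corners_def imageE mem_Collect_eq)
    then have 0: "P v = (\<lambda>x. 0)" by (rule affine_fun_zero_of_corners[OF aff])
    have "P v 0 = 0" "P v (axis 1 1) = 0" "P v (axis 2 1) = 0" by (simp_all add: 0)
    then show "v = 0" by (simp add: P_def axis_def vec_eq_iff forall_3)
  qed
  then have "surj L" by (rule linear_inj_imp_surj[OF lin])
  then obtain v where v: "(\<chi> j. c (f j)) = L v" by (rule surjE)
  have "P v z = c z" if "z extreme_point_of T" for z
  proof -
    have "z \<in> range f" using that bij_betw_imp_surj_on[OF f] by (simp add: corners_def)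
    then obtain j where "z = f j" by blast
    moreover have "c (f j) = P v (f j)" using arg_cong[OF v, of "\<lambda>w. w $ j"] by (simp add: L_def)
    ultimately show ?thesis by simp
  qed
  then show "\<exists>p. p \<in> affine_funs \<and> (\<forall>z. z extreme_point_of T \<longrightarrow> p z = c z)" using aff by blast
qed

lemma continuous_L2: "continuous_on T v \<Longrightarrow> v \<in> L2 T"
proof -
  assume v: "continuous_on T v"
  have "T \<in> lmeasurable" using shape by (simp add: lmeasurable_compact)
  moreover have "continuous_on T (\<lambda>x. (cmod (v x))\<^sup>2)" by (intro continuous_intros v)
  moreover have "integrable (lebesgue_on T) (\<lambda>x. v x * cnj (v x))"
    by (rule integrable_on_bounded_continuous[OF \<open>T \<in> lmeasurable\<close>])
       (auto intro!: continuous_intros v compact_imp_bounded compact_continuous_image shape)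
  ultimately show ?thesis
    using continuous_imp_measurable_on_sets_lebesgue[OF v] complex_of_real_integrable_eq[of "lebesgue_on T"]
    unfolding L2_def by (auto simp: complex_norm_square[symmetric] simp del: of_real_power)
qed

text \<open>An affine function whose square has integral zero vanishes almost everywhere on the triangle, hence on
  its interior by continuity, hence identically.  This is what makes the elementwise projection unique.\<close>

lemma ip_affine_definite:
  assumes "p \<in> affine_funs" "p \<noteq> (\<lambda>x. 0)"
  shows "ip T p p \<noteq> 0"
proof
  assume "ip T p p = 0"
  then have "(LINT x|lebesgue_on T. (cmod (p x))\<^sup>2) = 0" by (simp add: ip_self del: of_real_power)
  moreover have "integrable (lebesgue_on T) (\<lambda>x. (cmod (p x))\<^sup>2)"
    using continuous_L2[OF continuous_on_affine_fun[OF assms(1)]] by (simp add: L2_def)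
  ultimately have "AE x in lebesgue_on T. (cmod (p x))\<^sup>2 = 0"
    by (subst (asm) integral_nonneg_eq_0_iff_AE) auto
  then have "AE x in lebesgue. x \<in> T \<longrightarrow> p x = 0"
    using shape by (simp add: AE_restrict_space_iff)
  then obtain N where N: "N \<in> null_sets lebesgue" "{x. \<not> (x \<in> T \<longrightarrow> p x = 0)} \<subseteq> N"
    by (auto simp: eventually_ae_filter)
  then have neg: "negligible {x. \<not> (x \<in> T \<longrightarrow> p x = 0)}"
    using negligible_subset negligible_iff_null_sets by blast
  define U where "U = interior T \<inter> - {x. p x = 0}"
  have "closed {x. p x = 0}"
    using continuous_closed_preimage_constant[OF continuous_on_affine_fun[OF assms(1)] closed_UNIV, of 0] by simp
  then have "open U" unfolding U_def by (intro open_Int open_interior open_Compl)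
  moreover have "negligible U" by (rule negligible_subset[OF neg]) (use interior_subset in \<open>auto simp: U_def\<close>)
  ultimately have "U = {}" using open_not_negligible by blast
  then have "p x = 0" if "x \<in> interior T" for x using that by (auto simp: U_def)
  then have "p = (\<lambda>x. 0)"
    by (intro affine_fun_zero_of_interior[OF assms(1), of "interior T"]) (use interior_nonempty in auto)
  then show False using assms(2) by simp
qed

end

section \<open>Meshes\<close>

lemma negligible_closed_segment: "negligible (closed_segment a (b :: point))"
  by (simp add: negligible_convex_interior interior_closed_segment_ge2)

locale mesh =
  fixes \<Omega> :: "point set" and \<T> :: "point set set"
  assumes open_domain: "open \<Omega>" and bounded_domain: "bounded \<Omega>"
    and negligible_frontier: "negligible (frontier \<Omega>)"
    and conforming: "conforming_mesh \<Omega> \<T>"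
begin

lemma finite_mesh: "finite \<T>" and triangle: "T \<in> \<T> \<Longrightarrow> triangle T"
  and face: "T \<in> \<T> \<Longrightarrow> T' \<in> \<T> \<Longrightarrow> T \<inter> T' face_of T" and cover: "\<Union>\<T> = closure \<Omega>"
  using conforming by (auto simp: conforming_mesh_def triangulation_def triangle_def)

lemma subset_closure: "T \<in> \<T> \<Longrightarrow> T \<subseteq> closure \<Omega>"
  using cover by auto

lemma closure_diff_negligible: "negligible (closure \<Omega> - \<Omega>)"
  using negligible_frontier open_domain by (simp add: frontier_def interior_open)

lemma essential_triangle: "T \<in> \<T> \<Longrightarrow> essential_part \<Omega> T"
  using triangle.shape(1)[OF triangle] subset_closure[of T]
  by (auto simp: essential_part_def intro!: negligible_subset[OF closure_diff_negligible]
      lmeasurable_compact fmeasurableD)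

text \<open>The intersection is a face of both triangles, and a proper face of at least one of them, so its
  dimension is at most one.\<close>

lemma negligible_overlap:
  assumes "T \<in> \<T>" "T' \<in> \<T>" "T \<noteq> T'"
  shows "negligible (T \<inter> T')"
proof -
  have "T \<inter> T' \<noteq> T \<or> T \<inter> T' \<noteq> T'" using assms(3) by auto
  then obtain S where S: "S \<in> \<T>" "T \<inter> T' face_of S" "T \<inter> T' \<noteq> S"
    using assms face[of T T'] face[of T' T] by (auto simp: Int_commute)
  have "aff_dim (T \<inter> T') < aff_dim S"
    by (rule face_of_aff_dim_lt[OF _ S(2,3)]) (rule triangle.shape(2)[OF triangle[OF S(1)]])
  then have "aff_dim (T \<inter> T') \<noteq> DIM(point)" using triangle.shape(3)[OF triangle[OF S(1)]] by simp
  then have "interior (T \<inter> T') = {}" using aff_dim_nonempty_interior by blast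
  moreover have "convex (T \<inter> T')"
    using assms triangle.shape(2) triangle by (intro convex_Int) auto
  ultimately show ?thesis by (simp add: negligible_convex_interior)
qed

lemma finite_vertices: "finite (vertices \<T>)"
proof -
  have "vertices \<T> = (\<Union>T\<in>\<T>. triangle.corners T)"
    by (auto simp: vertices_def triangle.corners_def[OF triangle])
  then show ?thesis using finite_mesh triangle.finite_corners[OF triangle] by auto
qed

lemma AE_unique_triangle: "AE x in lebesgue. \<forall>T\<in>\<T>. \<forall>T'\<in>\<T>. x \<in> T \<longrightarrow> x \<in> T' \<longrightarrow> T = T'"
proof -
  have "AE x in lebesgue. x \<in> T \<longrightarrow> x \<in> T' \<longrightarrow> T = T'" if "T \<in> \<T>" "T' \<in> \<T>" for T T'
  proof (cases "T = T'")
    case False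
    then have "AE x in lebesgue. x \<notin> T \<inter> T'"
      using negligible_overlap[OF that] by (intro AE_not_in) (simp add: negligible_iff_null_sets)
    then show ?thesis by eventually_elim auto
  qed simp
  then show ?thesis by (intro AE_finite_allI[OF finite_mesh])
qed

end

section \<open>Finite element spaces\<close>

locale lod =
  fixes P :: lod_problem
  assumes setting: "lod_setting P" and wavenum_pos: "0 < wavenum P"
begin

lemma domain: "open (Om P)" "bounded (Om P)"
  using setting by (auto simp: lod_setting_def lipschitz_domain_def)

lemma domain_lmeasurable: "Om P \<in> lmeasurable" "Om P \<in> sets lebesgue"
  using domain lmeasurable_open by auto

lemma edges: "finite (bedges P)" "frontier (Om P) = (\<Union>(p, q)\<in>bedges P. closed_segment p q)"
  using setting by (auto simp: lod_setting_def polygonal_boundary_def)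

lemma edge_subset: "(p, q) \<in> bedges P \<Longrightarrow> closed_segment p q \<subseteq> frontier (Om P)"
  using edges(2) by auto

lemma frontier_negligible: "negligible (frontier (Om P))"
  unfolding edges(2) using edges(1) negligible_closed_segment by (intro negligible_Union) auto

sublocale coarse: mesh "Om P" "coarse_mesh P"
  using setting domain frontier_negligible by unfold_locales (auto simp: lod_setting_def)

sublocale fine: mesh "Om P" "fine_mesh P"
  using setting domain frontier_negligible by unfold_locales (auto simp: lod_setting_def)

lemma essential_domain: "essential_part (Om P) (Om P)"
  using domain_lmeasurable by (simp add: essential_part_def)

lemma bdtrace_eq: "continuous_on (closure (Om P)) v \<Longrightarrow> x \<in> frontier (Om P) \<Longrightarrow> bdtrace (Om P) v x = v x"
  using bdtrace_continuous[OF domain(1,2)] by (simp add: frontier_def)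

text \<open>For continuous functions the Dirichlet condition concerns plain values, which makes it stable under
  linear combinations; the limit in the definition of the trace is not linear without further knowledge.\<close>

lemma arc_AE_trace_iff:
  assumes "continuous_on (closure (Om P)) v"
  shows "arc_AE (bedges P) (\<lambda>x. x \<in> GamD P \<longrightarrow> bdtrace (Om P) v x = 0)
    \<longleftrightarrow> arc_AE (bedges P) (\<lambda>x. x \<in> GamD P \<longrightarrow> v x = 0)"
proof -
  have "(AE t in lebesgue_on {0..1}. linepath p q t \<in> GamD P \<longrightarrow> bdtrace (Om P) v (linepath p q t) = 0)
    \<longleftrightarrow> (AE t in lebesgue_on {0..1}. linepath p q t \<in> GamD P \<longrightarrow> v (linepath p q t) = 0)"
    if pq: "(p, q) \<in> bedges P" for p q
  proof (rule AE_cong)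
    fix t :: real assume "t \<in> space (lebesgue_on {0..1})"
    then have "linepath p q t \<in> closed_segment p q" by (simp flip: linepath_image_01)
    then have "linepath p q t \<in> frontier (Om P)" using edge_subset[OF pq] by blast
    then show "(linepath p q t \<in> GamD P \<longrightarrow> bdtrace (Om P) v (linepath p q t) = 0)
      \<longleftrightarrow> (linepath p q t \<in> GamD P \<longrightarrow> v (linepath p q t) = 0)"
      using bdtrace_eq[OF assms] by simp
  qed
  then show ?thesis unfolding arc_AE_def by blast
qed

lemma fe_space_iff:
  "v \<in> fe_space P \<T> \<longleftrightarrow> v \<in> H1 (Om P) \<and> arc_AE (bedges P) (\<lambda>x. x \<in> GamD P \<longrightarrow> v x = 0)
    \<and> continuous_on (closure (Om P)) v \<and> (\<forall>T\<in>\<T>. \<exists>p\<in>affine_funs. \<forall>x\<in>T. v x = p x)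
    \<and> (\<forall>x. x \<notin> closure (Om P) \<longrightarrow> v x = 0)"
  unfolding fe_space_def Vspace_def using arc_AE_trace_iff by blast

lemma csubspace_fe_space: "csubspace (fe_space P \<T>)"
  unfolding csubspace_def
proof (intro conjI allI ballI)
  show "(\<lambda>x. 0) \<in> fe_space P \<T>"
    using csubspace_zero[OF csubspace_affine_funs] by (auto simp: fe_space_iff arc_AE_def H1_zero)
  fix c u v assume uv: "u \<in> fe_space P \<T>" "v \<in> fe_space P \<T>"
  show "(\<lambda>x. u x + c * v x) \<in> fe_space P \<T>"
    unfolding fe_space_iff
  proof (intro conjI ballI allI impI)
    show "(\<lambda>x. u x + c * v x) \<in> H1 (Om P)"
      using uv by (intro H1_axpy domain_lmeasurable) (auto simp: fe_space_iff)
    show "continuous_on (closure (Om P)) (\<lambda>x. u x + c * v x)"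
      using uv by (auto simp: fe_space_iff intro!: continuous_intros)
    show "u x + c * v x = 0" if "x \<notin> closure (Om P)" for x
      using uv that by (simp add: fe_space_iff)
    show "arc_AE (bedges P) (\<lambda>x. x \<in> GamD P \<longrightarrow> u x + c * v x = 0)"
      unfolding arc_AE_def
    proof (clarify)
      fix p q assume "(p, q) \<in> bedges P"
      then have "AE t in lebesgue_on {0..1}. linepath p q t \<in> GamD P \<longrightarrow> u (linepath p q t) = 0"
        "AE t in lebesgue_on {0..1}. linepath p q t \<in> GamD P \<longrightarrow> v (linepath p q t) = 0"
        using uv by (auto simp: fe_space_iff arc_AE_def)
      then show "AE t in lebesgue_on {0..1}. linepath p q t \<in> GamD P \<longrightarrow>
          u (linepath p q t) + c * v (linepath p q t) = 0"
        by eventually_elim simp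
    qed
    fix T assume "T \<in> \<T>"
    then obtain p q where "p \<in> affine_funs" "\<forall>x\<in>T. u x = p x" "q \<in> affine_funs" "\<forall>x\<in>T. v x = q x"
      using uv unfolding fe_space_iff by blast
    then show "\<exists>p\<in>affine_funs. \<forall>x\<in>T. u x + c * v x = p x"
      by (intro bexI[OF _ csubspace_axpy[OF csubspace_affine_funs, of p q c]]) auto
  qed
qed

lemma cnj_fe_space: "v \<in> fe_space P \<T> \<Longrightarrow> (\<lambda>x. cnj (v x)) \<in> fe_space P \<T>"
proof -
  assume v: "v \<in> fe_space P \<T>"
  show ?thesis
    unfolding fe_space_iff
  proof (intro conjI ballI allI impI)
    show "(\<lambda>x. cnj (v x)) \<in> H1 (Om P)"
      using v by (intro H1_cnj) (auto simp: fe_space_iff)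
    show "continuous_on (closure (Om P)) (\<lambda>x. cnj (v x))"
      using v by (auto simp: fe_space_iff intro!: continuous_intros)
    show "cnj (v x) = 0" if "x \<notin> closure (Om P)" for x
      using v that by (simp add: fe_space_iff)
    show "arc_AE (bedges P) (\<lambda>x. x \<in> GamD P \<longrightarrow> cnj (v x) = 0)"
      using v by (simp add: fe_space_iff)
    fix T assume "T \<in> \<T>"
    then obtain p where "p \<in> affine_funs" "\<forall>x\<in>T. v x = p x"
      using v unfolding fe_space_iff by blast
    then show "\<exists>p\<in>affine_funs. \<forall>x\<in>T. cnj (v x) = p x"
      by (intro bexI[OF _ cnj_affine_funs[of p]]) auto
  qed
qed

lemma fe_space_H1: "v \<in> fe_space P \<T> \<Longrightarrow> v \<in> H1 (Om P)"
  by (simp add: fe_space_iff)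

lemma fe_space_Vspace: "v \<in> fe_space P \<T> \<Longrightarrow> v \<in> Vspace P"
  by (simp add: fe_space_def)

lemma fe_space_continuous: "v \<in> fe_space P \<T> \<Longrightarrow> continuous_on (closure (Om P)) v"
  by (simp add: fe_space_iff)

lemma V_h_determined: "determined_on (vertices (fine_mesh P)) (V_h P)"
  unfolding determined_on_def
proof (intro ballI impI ext)
  fix v x assume v: "v \<in> V_h P" and 0: "\<forall>s\<in>vertices (fine_mesh P). v s = 0"
  show "v x = 0"
  proof (cases "x \<in> closure (Om P)")
    case True
    then obtain T where T: "T \<in> fine_mesh P" "x \<in> T" using fine.cover by auto
    then obtain p where p: "p \<in> affine_funs" "\<forall>x\<in>T. v x = p x" using v unfolding fe_space_iff by blast
    have "p = (\<lambda>x. 0)"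
    proof (rule triangle.affine_fun_zero_of_corners[OF fine.triangle[OF T(1)] p(1)])
      fix z assume z: "z extreme_point_of T"
      then have "z \<in> T" "z \<in> vertices (fine_mesh P)" using T(1) by (auto simp: extreme_point_of_def vertices_def)
      then have "v z = p z" "v z = 0" using p(2) 0 by blast+
      then show "p z = 0" by simp
    qed
    then show ?thesis using p(2) T(2) by simp
  next
    case False
    then show ?thesis using v by (simp add: fe_space_iff)
  qed
qed

lemma V_H_subset_V_h: "V_H P \<subseteq> V_h P"
proof
  fix v assume v: "v \<in> V_H P"
  have "\<exists>p\<in>affine_funs. \<forall>x\<in>T'. v x = p x" if T': "T' \<in> fine_mesh P" for T'
  proof -
    obtain T where T: "T \<in> coarse_mesh P" "T' \<subseteq> T"
      using setting T' by (auto simp: lod_setting_def refines_def)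
    obtain p where "p \<in> affine_funs" "\<forall>x\<in>T. v x = p x"
      using v T(1) unfolding fe_space_iff by blast
    then show ?thesis using T(2) by blast
  qed
  then show "v \<in> V_h P" using v by (simp add: fe_space_iff)
qed

section \<open>The sesquilinear forms on the fine space\<close>

lemma V_h_sub_H1: "V_h P \<subseteq> H1 (Om P)"
  using fe_space_H1 by auto

text \<open>On the finite element space the trace is the restriction to the boundary, so the integrand is
  continuous along each edge and integrable over the part that is mapped into \<open>R\<close>.\<close>

lemma Robin_sesquilinear:
  assumes "R = A \<inter> frontier (Om P)" "A \<in> sets borel"
  shows "sesquilinear_on (V_h P) (\<lambda>v w. arc_integral (bedges P) R (\<lambda>x. bdtrace (Om P) v x * cnj (bdtrace (Om P) w x)))"
    (is "sesquilinear_on _ ?r")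
proof (rule sesquilinear_on_hermitian[OF _ _ csubspace_fe_space])
  have c: "continuous_on (frontier (Om P)) v" if "v \<in> V_h P" for v
    using fe_space_continuous[OF that] by (rule continuous_on_subset) (simp add: frontier_def)
  have eq: "?r v w = arc_integral (bedges P) R (\<lambda>x. v x * cnj (w x))" if "v \<in> V_h P" "w \<in> V_h P" for v w
    by (rule arc_integral_cong[OF edge_subset]) (use bdtrace_eq that fe_space_continuous in auto)
  show "?r v w = cnj (?r w v)" for v w
    by (subst arc_integral_cnj[symmetric]) (simp add: mult.commute)
  fix w assume w: "w \<in> V_h P"
  show "antilinear_on (V_h P) (?r w)"
    unfolding antilinear_on_def
  proof (intro allI ballI)
    fix d u v assume uv: "u \<in> V_h P" "v \<in> V_h P"
    have "arc_integral (bedges P) R (\<lambda>x. w x * cnj (u x + d * v x))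
        = arc_integral (bedges P) R (\<lambda>x. w x * cnj (u x) + cnj d * (w x * cnj (v x)))"
      by (simp add: algebra_simps)
    also have "\<dots> = arc_integral (bedges P) R (\<lambda>x. w x * cnj (u x)) + cnj d * arc_integral (bedges P) R (\<lambda>x. w x * cnj (v x))"
      by (rule arc_integral_axpy[OF edge_subset _ _ assms]) (use c w uv in \<open>auto intro!: continuous_intros\<close>)
    finally show "?r w (\<lambda>x. u x + d * v x) = ?r w u + cnj d * ?r w v"
      by (simp only: eq[OF w uv(1)] eq[OF w uv(2)] eq[OF w csubspace_axpy[OF csubspace_fe_space uv]])
  qed
qed

lemma aform_on_sesquilinear:
  assumes "essential_part (Om P) S" "R = A \<inter> frontier (Om P)" "A \<in> sets borel"
  shows "sesquilinear_on (V_h P) (aform_on P S R)"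
proof -
  have g: "sesquilinear_on (V_h P) (grad_ip P S)"
    by (rule sesquilinear_on_subset[OF sesquilinear_on_grad_ip[OF domain(1) domain_lmeasurable(1) assms(1)] V_h_sub_H1])
  have i: "sesquilinear_on (V_h P) (ip S)"
    by (rule sesquilinear_on_subset[OF sesquilinear_on_ip[OF domain_lmeasurable(1) assms(1)] V_h_sub_H1])
  show ?thesis
    using sesquilinear_on_combine[OF sesquilinear_on_combine[OF g i] Robin_sesquilinear[OF assms(2,3)],
        of "- (of_real ((wavenum P)\<^sup>2))" "- (\<i> * of_real (wavenum P))"]
    by (simp add: aform_on_def[abs_def])
qed

text \<open>Conjugation exchanges the two arguments without conjugating the form, since its coefficients multiply
  symmetric bilinear expressions in \<open>v\<close> and the conjugate of \<open>w\<close>.  It therefore turns adjoint corrector problems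
  into primal ones.\<close>

lemma aform_on_cnj_cnj:
  assumes "essential_part (Om P) S" "v \<in> V_h P" "w \<in> V_h P"
  shows "aform_on P S R (\<lambda>x. cnj (w x)) (\<lambda>x. cnj (v x)) = aform_on P S R v w"
proof -
  have "arc_integral (bedges P) R (\<lambda>x. bdtrace (Om P) (\<lambda>x. cnj (w x)) x * cnj (bdtrace (Om P) (\<lambda>x. cnj (v x)) x))
      = arc_integral (bedges P) R (\<lambda>x. bdtrace (Om P) v x * cnj (bdtrace (Om P) w x))"
    by (rule arc_integral_cong[OF edge_subset])
      (use bdtrace_eq assms(2,3) fe_space_continuous cnj_fe_space in \<open>auto simp: mult.commute\<close>)
  then show ?thesis
    using grad_ip_cnj_cnj[OF domain(1) domain_lmeasurable(1) assms(1), of v w] assms V_h_sub_H1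
    by (auto simp: aform_on_def ip_cnj_cnj)
qed

lemma GamR_borel: "\<exists>A. GamR P = A \<inter> frontier (Om P) \<and> A \<in> sets borel"
  using setting by (auto simp: lod_setting_def boundary_partition_def openin_open Int_commute)

lemma aform_sesquilinear: "sesquilinear_on (V_h P) (aform P)"
  using aform_on_sesquilinear[OF essential_domain] GamR_borel unfolding aform_def by blast

lemma aform_loc_sesquilinear:
  assumes "T \<in> coarse_mesh P"
  shows "sesquilinear_on (V_h P) (aform_loc P T)"
proof -
  obtain A where A: "GamR P = A \<inter> frontier (Om P)" "A \<in> sets borel" using GamR_borel by blast
  show ?thesis unfolding aform_loc_def
    by (rule aform_on_sesquilinear[OF coarse.essential_triangle[OF assms], of _ "A \<inter> closure T"]) (use A in auto)
qed

lemma bform_semi_inner: "semi_inner_on (V_h P) (bform P)"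
  unfolding semi_inner_on_def
proof (intro conjI ballI)
  have g: "sesquilinear_on (V_h P) (grad_ip P (Om P))"
    by (rule sesquilinear_on_subset[OF sesquilinear_on_grad_ip[OF domain(1) domain_lmeasurable(1) essential_domain] V_h_sub_H1])
  have i: "sesquilinear_on (V_h P) (ip (Om P))"
    by (rule sesquilinear_on_subset[OF sesquilinear_on_ip[OF domain_lmeasurable(1) essential_domain] V_h_sub_H1])
  show "sesquilinear_on (V_h P) (bform P)"
    using sesquilinear_on_combine[OF g i, of "of_real ((wavenum P)\<^sup>2)"] by (simp add: bform_def[abs_def])
  fix u v assume uv: "u \<in> V_h P" "v \<in> V_h P"
  show "bform P v u = cnj (bform P u v)"
    using grad_ip_cnj_commute[OF domain_lmeasurable(2) essential_domain] uv V_h_sub_H1 ip_cnj_commute[of "Om P" u v]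
    by (auto simp: bform_def)
next
  fix u assume "u \<in> V_h P"
  then show "0 \<le> Re (bform P u u)"
    using grad_ip_self_nonneg[OF domain_lmeasurable(2) essential_domain] V_h_sub_H1 ip_self_nonneg
    by (auto simp: bform_def simp flip: of_real_power)
qed

text \<open>As \<open>k > 0\<close>, the mass term forces \<open>v = 0\<close> almost everywhere in the domain; continuity extends this to the closure.\<close>

lemma bform_definite:
  assumes v: "v \<in> V_h P" and 0: "bform P v v = 0"
  shows "v = (\<lambda>x. 0)"
proof
  fix x
  have "0 = Re (grad_ip P (Om P) v v) + (wavenum P)\<^sup>2 * Re (ip (Om P) v v)"
    using 0 by (simp add: bform_def complex_eq_iff flip: of_real_power)
  moreover have "0 \<le> Re (grad_ip P (Om P) v v)"
    by (rule grad_ip_self_nonneg[OF domain_lmeasurable(2) essential_domain fe_space_H1[OF v]])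
  moreover have "0 \<le> (wavenum P)\<^sup>2 * Re (ip (Om P) v v)" using ip_self_nonneg by simp
  ultimately have "(wavenum P)\<^sup>2 * Re (ip (Om P) v v) = 0" by linarith
  then have "(LINT x|lebesgue_on (Om P). (cmod (v x))\<^sup>2) = 0"
    using wavenum_pos by (simp add: ip_self)
  moreover have "integrable (lebesgue_on (Om P)) (\<lambda>x. (cmod (v x))\<^sup>2)"
    using H1_L2[OF fe_space_H1[OF v]] by (simp add: L2_def)
  ultimately have "AE x in lebesgue_on (Om P). (cmod (v x))\<^sup>2 = 0"
    by (subst (asm) integral_nonneg_eq_0_iff_AE) auto
  then have "AE x in lebesgue. x \<in> Om P \<longrightarrow> v x = 0"
    using domain_lmeasurable by (simp add: AE_restrict_space_iff)
  then obtain N where N: "N \<in> null_sets lebesgue" "{x. \<not> (x \<in> Om P \<longrightarrow> v x = 0)} \<subseteq> N"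
    by (auto simp: eventually_ae_filter)
  define U where "U = {x \<in> Om P. v x \<in> - {0}}"
  have "open U" unfolding U_def
    using continuous_open_preimage[OF continuous_on_subset[OF fe_space_continuous[OF v] closure_subset] domain(1),
        of "- {0}"] open_delete[OF open_UNIV, of "0 :: complex"]
    by (simp add: vimage_def Int_def Compl_eq_Diff_UNIV)
  moreover have "negligible U"
    using N by (intro negligible_subset[of N U]) (auto simp: U_def negligible_iff_null_sets)
  ultimately have "U = {}" using open_not_negligible by blast
  then have "v ` Om P \<subseteq> {0}" by (auto simp: U_def)
  then have "v ` closure (Om P) \<subseteq> {0}"
    by (intro image_closure_subset[OF fe_space_continuous[OF v]]) auto
  then show "v x = 0" using v by (cases "x \<in> closure (Om P)") (auto simp: fe_space_iff)
qed

lemma knorm_cnj: "v \<in> V_h P \<Longrightarrow> knorm P (\<lambda>x. cnj (v x)) = knorm P v"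
  using grad_ip_cnj_cnj[OF domain(1) domain_lmeasurable(1) essential_domain, of v v] fe_space_H1
  by (simp add: knorm_def bform_def ip_cnj_cnj)

lemma knorm_pos: "v \<in> V_h P \<Longrightarrow> v \<noteq> (\<lambda>x. 0) \<Longrightarrow> 0 < knorm P v"
  using bform_definite[of v] semi_inner_on_self[OF bform_semi_inner, of v]
    semi_inner_on_nonneg[OF bform_semi_inner, of v]
  by (simp add: knorm_def) (metis less_eq_real_def of_real_0)

lemma knorm_nonneg: "v \<in> V_h P \<Longrightarrow> 0 \<le> knorm P v"
  using semi_inner_on_nonneg[OF bform_semi_inner, of v] by (simp add: knorm_def)

lemma knorm_sq: "v \<in> V_h P \<Longrightarrow> (knorm P v)\<^sup>2 = Re (bform P v v)"
  using semi_inner_on_nonneg[OF bform_semi_inner, of v] by (simp add: knorm_def)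

end

section \<open>The quasi-interpolation operator\<close>

context triangle
begin

lemma ip_sesquilinear: "sesquilinear_on {v. continuous_on T v} (ip T)"
proof (rule sesquilinear_on_hermitian[OF _ ip_cnj_commute])
  have m: "T \<in> sets lebesgue" using shape(1) by (simp add: lmeasurable_compact fmeasurableD)
  then have e: "essential_part T T" by (simp add: essential_part_def)
  show "csubspace {v. continuous_on T v}" by (auto simp: csubspace_def intro!: continuous_intros)
  fix w :: cfun assume "w \<in> {v. continuous_on T v}"
  then show "antilinear_on {v. continuous_on T v} (ip T w)"
    unfolding antilinear_on_def by (intro allI ballI ip_axpy_right[OF m e] continuous_L2) auto
qed

lemma affine_funs_continuous: "affine_funs \<subseteq> {v. continuous_on T v}"
  using continuous_on_affine_fun by auto

text \<open>The orthogonality condition says that the affine function represents \<open>ip T v\<close>, to which the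
  representation lemma applies on the space of affine functions.\<close>

lemma dg_proj_ex1:
  assumes "continuous_on T v"
  shows "\<exists>!p. p \<in> affine_funs \<and> (\<forall>q\<in>affine_funs. ip T (\<lambda>x. v x - p x) q = 0)"
proof -
  have "\<exists>!p. p \<in> affine_funs \<and> (\<forall>q\<in>affine_funs. ip T p q = ip T v q)"
  proof (rule riesz_ex1[OF _ csubspace_affine_funs determined_on_affine_funs])
    show "sesquilinear_on affine_funs (ip T)"
      by (rule sesquilinear_on_subset[OF ip_sesquilinear affine_funs_continuous])
    show "antilinear_on affine_funs (ip T v)"
      using antilinear_on_subset[OF sesquilinear_on_antilinear[OF ip_sesquilinear] affine_funs_continuous] assms
      by simp
  qed (use ip_affine_definite in auto)
  moreover have "ip T (\<lambda>x. v x - p x) q = ip T v q - ip T p q" if "p \<in> affine_funs" "q \<in> affine_funs" for p q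
    by (rule sesquilinear_on_left_diff[OF ip_sesquilinear]) (use that affine_funs_continuous assms in auto)
  then have "(p \<in> affine_funs \<and> (\<forall>q\<in>affine_funs. ip T (\<lambda>x. v x - p x) q = 0))
      \<longleftrightarrow> (p \<in> affine_funs \<and> (\<forall>q\<in>affine_funs. ip T p q = ip T v q))" for p
    by auto
  ultimately show ?thesis by (simp only:)
qed

lemma dg_proj_affine:
  "continuous_on T v \<Longrightarrow> dg_proj v T \<in> affine_funs"
  and dg_proj_orthogonal:
  "continuous_on T v \<Longrightarrow> q \<in> affine_funs \<Longrightarrow> ip T (\<lambda>x. v x - dg_proj v T x) q = 0"
  using theI'[OF dg_proj_ex1, of v] unfolding dg_proj_def by blast+

lemma dg_proj_eqI:
  assumes "continuous_on T v" "p \<in> affine_funs" "\<And>q. q \<in> affine_funs \<Longrightarrow> ip T (\<lambda>x. v x - p x) q = 0"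
  shows "dg_proj v T = p"
  unfolding dg_proj_def by (rule the1_equality[OF dg_proj_ex1[OF assms(1)]]) (use assms in auto)

lemma dg_proj_axpy:
  assumes "continuous_on T u" "continuous_on T v"
  shows "dg_proj (\<lambda>x. u x + c * v x) T = (\<lambda>x. dg_proj u T x + c * dg_proj v T x)"
proof (rule dg_proj_eqI)
  show "continuous_on T (\<lambda>x. u x + c * v x)" by (intro continuous_intros assms)
  show "(\<lambda>x. dg_proj u T x + c * dg_proj v T x) \<in> affine_funs"
    by (intro csubspace_axpy[OF csubspace_affine_funs] dg_proj_affine assms)
  fix q assume q: "q \<in> affine_funs"
  have "ip T (\<lambda>x. (u x - dg_proj u T x) + c * (v x - dg_proj v T x)) q
      = ip T (\<lambda>x. u x - dg_proj u T x) q + c * ip T (\<lambda>x. v x - dg_proj v T x) q"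
    by (rule sesquilinear_on_left[OF ip_sesquilinear])
       (simp_all add: continuous_on_affine_fun q continuous_on_diff dg_proj_affine assms)
  also have "\<dots> = 0" by (simp add: dg_proj_orthogonal assms q)
  finally show "ip T (\<lambda>x. u x + c * v x - (dg_proj u T x + c * dg_proj v T x)) q = 0"
    by (simp add: algebra_simps)
qed

lemma dg_proj_cnj:
  assumes "continuous_on T v"
  shows "dg_proj (\<lambda>x. cnj (v x)) T = (\<lambda>x. cnj (dg_proj v T x))"
proof (rule dg_proj_eqI)
  show "continuous_on T (\<lambda>x. cnj (v x))" by (intro continuous_intros assms)
  show "(\<lambda>x. cnj (dg_proj v T x)) \<in> affine_funs"
    by (intro cnj_affine_funs dg_proj_affine assms)
  fix q assume q: "q \<in> affine_funs"
  have "ip T (\<lambda>x. cnj (v x - dg_proj v T x)) (\<lambda>x. cnj (cnj (q x))) = ip T (\<lambda>x. cnj (q x)) (\<lambda>x. v x - dg_proj v T x)"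
    by (rule ip_cnj_cnj)
  also have "\<dots> = cnj (ip T (\<lambda>x. v x - dg_proj v T x) (\<lambda>x. cnj (q x)))" by (rule ip_cnj_commute)
  also have "\<dots> = 0" by (simp add: dg_proj_orthogonal assms cnj_affine_funs q)
  finally show "ip T (\<lambda>x. cnj (v x) - cnj (dg_proj v T x)) q = 0" by simp
qed

definition nodal_affine :: "cfun \<Rightarrow> cfun" where
  "nodal_affine c = (THE p. p \<in> affine_funs \<and> (\<forall>z. z extreme_point_of T \<longrightarrow> p z = c z))"

lemma nodal_affine: "nodal_affine c \<in> affine_funs" "z extreme_point_of T \<Longrightarrow> nodal_affine c z = c z"
  using theI'[OF affine_interpolation, of c] unfolding nodal_affine_def by blast+

lemma nodal_affine_eqI:
  "p \<in> affine_funs \<Longrightarrow> (\<And>z. z extreme_point_of T \<Longrightarrow> p z = c z) \<Longrightarrow> nodal_affine c = p"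
  unfolding nodal_affine_def by (rule the1_equality[OF affine_interpolation]) auto

lemma nodal_affine_axpy:
  "nodal_affine (\<lambda>z. c z + a * d z) = (\<lambda>x. nodal_affine c x + a * nodal_affine d x)"
  by (rule nodal_affine_eqI)
     (auto intro!: csubspace_axpy[OF csubspace_affine_funs] simp: nodal_affine)

lemma nodal_affine_cnj: "nodal_affine (\<lambda>z. cnj (c z)) = (\<lambda>x. cnj (nodal_affine c x))"
  by (rule nodal_affine_eqI) (auto intro!: cnj_affine_funs simp: nodal_affine)

end

context mesh
begin

text \<open>The triangle depends on \<open>x\<close> but not on the nodal values, so linearity on a single triangle carries over.\<close>

lemma pw_affine_interp_eq:
  assumes "x \<in> \<Union>\<T>"
  shows "\<exists>T\<in>\<T>. \<forall>c. pw_affine_interp \<T> c x = triangle.nodal_affine T c x"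
proof -
  have "(SOME T. T \<in> \<T> \<and> x \<in> T) \<in> \<T>" using someI_ex[of "\<lambda>T. T \<in> \<T> \<and> x \<in> T"] assms by auto
  then show ?thesis
    using assms triangle by (auto simp: pw_affine_interp_def triangle.nodal_affine_def Let_def)
qed

lemma pw_affine_interp_axpy:
  "pw_affine_interp \<T> (\<lambda>z. c z + a * d z) = (\<lambda>x. pw_affine_interp \<T> c x + a * pw_affine_interp \<T> d x)"
proof
  fix x
  show "pw_affine_interp \<T> (\<lambda>z. c z + a * d z) x = pw_affine_interp \<T> c x + a * pw_affine_interp \<T> d x"
  proof (cases "x \<in> \<Union>\<T>")
    case True
    then show ?thesis
      using pw_affine_interp_eq[OF True] triangle.nodal_affine_axpy[OF triangle] by auto
  qed (simp add: pw_affine_interp_def)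
qed

lemma pw_affine_interp_cnj:
  "pw_affine_interp \<T> (\<lambda>z. cnj (c z)) = (\<lambda>x. cnj (pw_affine_interp \<T> c x))"
proof
  fix x
  show "pw_affine_interp \<T> (\<lambda>z. cnj (c z)) x = cnj (pw_affine_interp \<T> c x)"
  proof (cases "x \<in> \<Union>\<T>")
    case True
    then show ?thesis
      using pw_affine_interp_eq[OF True] triangle.nodal_affine_cnj[OF triangle] by auto
  qed (simp add: pw_affine_interp_def)
qed

end

context lod
begin

lemma continuous_on_coarse_triangle: "T \<in> coarse_mesh P \<Longrightarrow> v \<in> V_h P \<Longrightarrow> continuous_on T v"
  by (rule continuous_on_subset[OF fe_space_continuous coarse.subset_closure])

lemma I_H_axpy:
  assumes "u \<in> V_h P" "v \<in> V_h P"
  shows "I_H P (\<lambda>x. u x + c * v x) = (\<lambda>x. I_H P u x + c * I_H P v x)"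
proof -
  have eq: "avg_nodal P (dg_proj (\<lambda>x. u x + c * v x))
      = (\<lambda>z. avg_nodal P (dg_proj u) z + c * avg_nodal P (dg_proj v) z)"
  proof
    fix z
    have "dg_proj (\<lambda>x. u x + c * v x) T z = dg_proj u T z + c * dg_proj v T z" if "T \<in> coarse_mesh P" for T
      using triangle.dg_proj_axpy[OF coarse.triangle[OF that]] continuous_on_coarse_triangle[OF that] assms by simp
    then show "avg_nodal P (dg_proj (\<lambda>x. u x + c * v x)) z
      = avg_nodal P (dg_proj u) z + c * avg_nodal P (dg_proj v) z"
      by (simp add: avg_nodal_def distrib_right sum.distrib add_divide_distrib sum_distrib_left mult.assoc)
  qed
  show ?thesis unfolding I_H_def eq by (rule coarse.pw_affine_interp_axpy)
qed

lemma I_H_cnj: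
  assumes "v \<in> V_h P"
  shows "I_H P (\<lambda>x. cnj (v x)) = (\<lambda>x. cnj (I_H P v x))"
proof -
  have eq: "avg_nodal P (dg_proj (\<lambda>x. cnj (v x))) = (\<lambda>z. cnj (avg_nodal P (dg_proj v) z))"
  proof
    fix z
    have "dg_proj (\<lambda>x. cnj (v x)) T z = cnj (dg_proj v T z)" if "T \<in> coarse_mesh P" for T
      using triangle.dg_proj_cnj[OF coarse.triangle[OF that]] continuous_on_coarse_triangle[OF that] assms by simp
    then show "avg_nodal P (dg_proj (\<lambda>x. cnj (v x))) z = cnj (avg_nodal P (dg_proj v) z)"
      by (simp add: avg_nodal_def)
  qed
  show ?thesis unfolding I_H_def eq by (rule coarse.pw_affine_interp_cnj)
qed

lemma I_H_zero: "I_H P (\<lambda>x. 0) = (\<lambda>x. 0)"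
  using I_H_axpy[OF csubspace_zero[OF csubspace_fe_space] csubspace_zero[OF csubspace_fe_space], of "-1"]
  by simp

lemma W_h_sub: "W_h P \<subseteq> V_h P"
  by (auto simp: W_h_def)

lemma csubspace_W_h: "csubspace (W_h P)"
  unfolding csubspace_def
  using csubspace_zero[OF csubspace_fe_space] csubspace_axpy[OF csubspace_fe_space] I_H_zero I_H_axpy
  by (simp add: W_h_def)

lemma cnj_W_h: "w \<in> W_h P \<Longrightarrow> (\<lambda>x. cnj (w x)) \<in> W_h P"
  using cnj_fe_space I_H_cnj by (auto simp: W_h_def)

lemma supp_subset_iff: "closed C \<Longrightarrow> supp w \<subseteq> C \<longleftrightarrow> (\<forall>x. x \<notin> C \<longrightarrow> w x = 0)"
  unfolding supp_def using closure_subset[of "{x. w x \<noteq> 0}"] closure_minimal[of "{x. w x \<noteq> 0}" C] by blast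

lemma W_loc_iff: "w \<in> W_loc P l S \<longleftrightarrow> w \<in> W_h P \<and> (\<forall>x. x \<notin> closure (patch P l S) \<longrightarrow> w x = 0)"
  by (simp add: W_loc_def supp_subset_iff)

lemma csubspace_W_loc: "csubspace (W_loc P l S)"
  unfolding csubspace_def
  using csubspace_zero[OF csubspace_W_h] csubspace_axpy[OF csubspace_W_h] by (simp add: W_loc_iff)

lemma cnj_W_loc: "w \<in> W_loc P l S \<Longrightarrow> (\<lambda>x. cnj (w x)) \<in> W_loc P l S"
  using cnj_W_h by (auto simp: W_loc_iff)

lemma W_loc_sub: "W_loc P l S \<subseteq> W_h P"
  by (auto simp: W_loc_def)

end

section \<open>Coercivity on the kernel of the quasi-interpolation\<close>

lemma (in triangle) diameter_pos: "0 < diameter T"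
proof -
  obtain x where "x \<in> interior T" using interior_nonempty by auto
  then obtain e where e: "0 < e" "ball x e \<subseteq> T" by (auto simp: mem_interior)
  let ?y = "x + (e / 2) *\<^sub>R axis 1 1"
  have "x \<in> T" "?y \<in> T" using e by (auto simp: dist_norm norm_axis_1)
  then have "dist x ?y \<le> diameter T"
    using diameter_bounded_bound[OF compact_imp_bounded[OF shape(1)]] by blast
  then show ?thesis using e by (simp add: dist_norm norm_axis_1)
qed

lemma integral_le_sum_of_cover:
  fixes f :: "'a::euclidean_space \<Rightarrow> real"
  assumes "finite \<T>" "\<Omega> \<subseteq> \<Union>\<T>" "\<And>x. 0 \<le> f x" "\<Omega> \<in> sets lebesgue" "\<And>T. T \<in> \<T> \<Longrightarrow> T \<in> sets lebesgue"
    and "integrable (lebesgue_on \<Omega>) f" "\<And>T. T \<in> \<T> \<Longrightarrow> integrable (lebesgue_on T) f"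
  shows "(LINT x|lebesgue_on \<Omega>. f x) \<le> (\<Sum>T\<in>\<T>. LINT x|lebesgue_on T. f x)"
proof -
  have i: "integrable lebesgue (\<lambda>x. indicat_real T x *\<^sub>R f x)" if "T \<in> \<T>" for T
    using assms(5,7)[OF that] by (simp add: integrable_restrict_space)
  have "(LINT x|lebesgue. indicat_real \<Omega> x *\<^sub>R f x) \<le> (LINT x|lebesgue. (\<Sum>T\<in>\<T>. indicat_real T x *\<^sub>R f x))"
  proof (rule integral_mono)
    show "integrable lebesgue (\<lambda>x. indicat_real \<Omega> x *\<^sub>R f x)"
      using assms by (simp add: integrable_restrict_space)
    show "integrable lebesgue (\<lambda>x. \<Sum>T\<in>\<T>. indicat_real T x *\<^sub>R f x)"
      by (intro Bochner_Integration.integrable_sum i)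
    fix x
    show "indicat_real \<Omega> x *\<^sub>R f x \<le> (\<Sum>T\<in>\<T>. indicat_real T x *\<^sub>R f x)"
    proof (cases "x \<in> \<Omega>")
      case True
      then obtain T where "T \<in> \<T>" "x \<in> T" using assms(2) by blast
      then have "f x \<le> (\<Sum>T\<in>{T}. indicat_real T x *\<^sub>R f x)" by simp
      also have "\<dots> \<le> (\<Sum>T\<in>\<T>. indicat_real T x *\<^sub>R f x)"
        by (intro sum_mono2) (use assms \<open>T \<in> \<T>\<close> in auto)
      finally show ?thesis using True by simp
    next
      case False
      then show ?thesis using assms(3) by (simp add: sum_nonneg)
    qed
  qed
  also have "\<dots> = (\<Sum>T\<in>\<T>. LINT x|lebesgue. indicat_real T x *\<^sub>R f x)"
    by (intro Bochner_Integration.integral_sum i)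
  finally show ?thesis using assms(4,5) by (simp add: integral_restrict_space)
qed

context lod
begin

lemma coarse_closure: "T \<in> coarse_mesh P \<Longrightarrow> closure T = T"
  using triangle.shape(4)[OF coarse.triangle] by simp

lemma nbhd_eq: "T \<in> coarse_mesh P \<Longrightarrow> nbhd (coarse_mesh P) T = \<Union>{K \<in> coarse_mesh P. K \<inter> T \<noteq> {}}"
  using coarse_closure by (auto simp: nbhd_def)

lemma essential_nbhd: "T \<in> coarse_mesh P \<Longrightarrow> essential_part (Om P) (nbhd (coarse_mesh P) T)"
proof -
  assume T: "T \<in> coarse_mesh P"
  have "nbhd (coarse_mesh P) T \<in> sets lebesgue"
    unfolding nbhd_eq[OF T] using coarse.finite_mesh coarse.essential_triangle
    by (intro sets.finite_Union) (auto simp: essential_part_def)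
  moreover have "nbhd (coarse_mesh P) T - Om P \<subseteq> closure (Om P) - Om P"
    unfolding nbhd_eq[OF T] using coarse.subset_closure by blast
  ultimately show ?thesis
    unfolding essential_part_def using negligible_subset[OF coarse.closure_diff_negligible] by blast
qed

lemma neighbour_count:
  assumes "K \<in> coarse_mesh P"
  shows "card {T \<in> coarse_mesh P. K \<inter> T \<noteq> {}} \<le> C_patch P 1"
proof -
  have p: "patch P (enat 1) K = nbhd (coarse_mesh P) K" by (simp add: patch_def)
  have "{T \<in> coarse_mesh P. K \<inter> T \<noteq> {}} \<subseteq> {T \<in> coarse_mesh P. T \<subseteq> patch P (enat 1) K}"
    unfolding p nbhd_eq[OF assms] by auto
  then have "card {T \<in> coarse_mesh P. K \<inter> T \<noteq> {}} \<le> card {T \<in> coarse_mesh P. T \<subseteq> patch P (enat 1) K}"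
    using coarse.finite_mesh by (intro card_mono) auto
  also have "\<dots> \<le> C_patch P 1"
    unfolding C_patch_def using coarse.finite_mesh assms by (intro Max_ge) auto
  finally show ?thesis .
qed

text \<open>Almost every point lies in a single triangle \<open>K\<close>.  It belongs to the neighbourhood of \<open>T\<close> only if \<open>T\<close> meets \<open>K\<close>, and
  the number of such \<open>T\<close> is at most the number of triangles in the first patch of \<open>K\<close>.\<close>

lemma sum_nbhd_integral_le:
  fixes f :: "point \<Rightarrow> real"
  assumes f: "\<And>x. 0 \<le> f x" and int: "integrable (lebesgue_on (Om P)) f"
  shows "(\<Sum>T\<in>coarse_mesh P. LINT x|lebesgue_on (nbhd (coarse_mesh P) T). f x)
    \<le> real (C_patch P 1) * (LINT x|lebesgue_on (Om P). f x)"
proof -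
  let ?N = "nbhd (coarse_mesh P)"
  have N: "?N T \<in> sets lebesgue" "negligible (?N T - Om P)" if "T \<in> coarse_mesh P" for T
    using essential_nbhd[OF that] by (auto simp: essential_part_def)
  have i: "integrable lebesgue (\<lambda>x. indicat_real (?N T) x *\<^sub>R f x)" if "T \<in> coarse_mesh P" for T
    using integrable_null_extension[OF int domain_lmeasurable(2) N[OF that]] N[OF that]
    by (simp add: integrable_restrict_space)
  have "(\<Sum>T\<in>coarse_mesh P. LINT x|lebesgue_on (?N T). f x)
      = (\<Sum>T\<in>coarse_mesh P. LINT x|lebesgue. indicat_real (?N T) x *\<^sub>R f x)"
    using N(1) by (intro sum.cong) (auto simp: integral_restrict_space)
  also have "\<dots> = (LINT x|lebesgue. (\<Sum>T\<in>coarse_mesh P. indicat_real (?N T) x *\<^sub>R f x))"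
    by (rule Bochner_Integration.integral_sum[symmetric, OF i])
  also have "\<dots> \<le> (LINT x|lebesgue. real (C_patch P 1) * (indicat_real (Om P) x *\<^sub>R f x))"
  proof (rule integral_mono_AE)
    show "integrable lebesgue (\<lambda>x. \<Sum>T\<in>coarse_mesh P. indicat_real (?N T) x *\<^sub>R f x)"
      by (intro Bochner_Integration.integrable_sum i)
    show "integrable lebesgue (\<lambda>x. real (C_patch P 1) * (indicat_real (Om P) x *\<^sub>R f x))"
      using int domain_lmeasurable by (intro integrable_mult_right) (simp add: integrable_restrict_space)
    have "AE x in lebesgue. x \<notin> closure (Om P) - Om P"
      using coarse.closure_diff_negligible by (intro AE_not_in) (simp add: negligible_iff_null_sets)
    then show "AE x in lebesgue. (\<Sum>T\<in>coarse_mesh P. indicat_real (?N T) x *\<^sub>R f x)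
        \<le> real (C_patch P 1) * (indicat_real (Om P) x *\<^sub>R f x)"
      using coarse.AE_unique_triangle
    proof eventually_elim
      case (elim x)
      show ?case
      proof (cases "x \<in> Om P")
        case False
        then have "x \<notin> closure (Om P)" using elim(1) by blast
        then have "x \<notin> ?N T" if "T \<in> coarse_mesh P" for T
          unfolding nbhd_eq[OF that] using coarse.subset_closure by blast
        then show ?thesis using f by (simp add: sum_nonneg)
      next
        case True
        then obtain K where K: "K \<in> coarse_mesh P" "x \<in> K"
          using coarse.cover closure_subset by blast
        have "{T \<in> coarse_mesh P. x \<in> ?N T} \<subseteq> {T \<in> coarse_mesh P. K \<inter> T \<noteq> {}}"
        proof clarify
          fix T assume T: "T \<in> coarse_mesh P" "x \<in> ?N T" "K \<inter> T = {}"
          then obtain K' where "K' \<in> coarse_mesh P" "x \<in> K'" "K' \<inter> T \<noteq> {}" by (auto simp: nbhd_eq)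
          then show False using elim(2) K T(3) by blast
        qed
        then have "card {T \<in> coarse_mesh P. x \<in> ?N T} \<le> card {T \<in> coarse_mesh P. K \<inter> T \<noteq> {}}"
          by (rule card_mono[rotated]) (simp add: coarse.finite_mesh)
        then have "card {T \<in> coarse_mesh P. x \<in> ?N T} \<le> C_patch P 1"
          using neighbour_count[OF K(1)] by (rule order_trans)
        moreover have "(\<Sum>T\<in>coarse_mesh P. indicat_real (?N T) x *\<^sub>R f x)
            = real (card {T \<in> coarse_mesh P. x \<in> ?N T}) * f x"
          using coarse.finite_mesh
          by (simp add: indicator_def sum.If_cases Int_def flip: sum_distrib_right)
        ultimately show ?thesis using True f by (simp add: mult_right_mono)
      qed
    qed
  qed
  also have "\<dots> = real (C_patch P 1) * (LINT x|lebesgue_on (Om P). f x)"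
    using domain_lmeasurable by (simp add: integral_restrict_space)
  finally show ?thesis .
qed

abbreviation kH_norm :: real where
  "kH_norm \<equiv> Linf_norm (Om P) (\<lambda>x. wavenum P * mesh_size (coarse_mesh P) x)"

text \<open>Almost every point of \<open>T\<close> lies in no other triangle, so the mesh size there is the diameter of \<open>T\<close>; the interior
  of \<open>T\<close> is not a null set, so the essential supremum sees this value.\<close>

lemma kH_norm_bounds: "0 \<le> kH_norm" "T \<in> coarse_mesh P \<Longrightarrow> wavenum P * diameter T \<le> kH_norm"
proof -
  let ?f = "\<lambda>x. wavenum P * mesh_size (coarse_mesh P) x"
  let ?S = "{c. 0 \<le> c \<and> (AE x in lebesgue_on (Om P). \<bar>?f x\<bar> \<le> c)}"
  have dp: "0 < diameter T" if "T \<in> coarse_mesh P" for T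
    using triangle.diameter_pos[OF coarse.triangle[OF that]] .
  have some: "(SOME T. T \<in> coarse_mesh P \<and> x \<in> T) \<in> coarse_mesh P \<and> x \<in> (SOME T. T \<in> coarse_mesh P \<and> x \<in> T)"
    if "x \<in> closure (Om P)" for x
    by (rule someI_ex) (use that coarse.cover in auto)
  have "wavenum P * (\<Sum>T\<in>coarse_mesh P. diameter T) \<in> ?S"
  proof (intro CollectI conjI AE_I2)
    show "0 \<le> wavenum P * (\<Sum>T\<in>coarse_mesh P. diameter T)"
      using wavenum_pos dp by (intro mult_nonneg_nonneg sum_nonneg) (auto intro: less_imp_le)
    fix x assume "x \<in> space (lebesgue_on (Om P))"
    then have x: "x \<in> closure (Om P)" using closure_subset by auto
    let ?T = "SOME T. T \<in> coarse_mesh P \<and> x \<in> T"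
    have "diameter ?T \<le> (\<Sum>T\<in>coarse_mesh P. diameter T)"
      using some[OF x] dp by (intro member_le_sum coarse.finite_mesh) (auto intro: less_imp_le)
    moreover have "0 < diameter ?T" using some[OF x] dp by blast
    ultimately show "\<bar>?f x\<bar> \<le> wavenum P * (\<Sum>T\<in>coarse_mesh P. diameter T)"
      using wavenum_pos by (simp add: mesh_size_def abs_mult)
  qed
  then have ne: "?S \<noteq> {}" by blast
  show "0 \<le> kH_norm" unfolding Linf_norm_def by (rule cInf_greatest[OF ne]) auto
  assume T: "T \<in> coarse_mesh P"
  show "wavenum P * diameter T \<le> kH_norm" unfolding Linf_norm_def
  proof (rule cInf_greatest[OF ne])
    fix c assume "c \<in> ?S"
    then have "AE x in lebesgue. x \<in> Om P \<longrightarrow> \<bar>?f x\<bar> \<le> c"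
      using domain_lmeasurable by (simp add: AE_restrict_space_iff)
    moreover have "AE x in lebesgue. x \<notin> closure (Om P) - Om P"
      using coarse.closure_diff_negligible by (intro AE_not_in) (simp add: negligible_iff_null_sets)
    ultimately have "AE x in lebesgue. x \<in> T \<longrightarrow> wavenum P * diameter T \<le> c"
      using coarse.AE_unique_triangle
    proof eventually_elim
      case (elim x)
      show ?case
      proof
        assume "x \<in> T"
        then have x: "x \<in> closure (Om P)" using coarse.subset_closure[OF T] by blast
        then have "(SOME T. T \<in> coarse_mesh P \<and> x \<in> T) = T"
          using elim(3) some[OF x] T \<open>x \<in> T\<close> by blast
        then have "mesh_size (coarse_mesh P) x = diameter T" by (simp add: mesh_size_def)
        moreover have "\<bar>?f x\<bar> \<le> c" using elim(1,2) x by blast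
        ultimately show "wavenum P * diameter T \<le> c" by (simp add: abs_le_iff)
      qed
    qed
    then obtain N where N: "N \<in> null_sets lebesgue" "{x. \<not> (x \<in> T \<longrightarrow> wavenum P * diameter T \<le> c)} \<subseteq> N"
      unfolding eventually_ae_filter by auto
    show "wavenum P * diameter T \<le> c"
    proof (rule ccontr)
      assume "\<not> wavenum P * diameter T \<le> c"
      then have "interior T \<subseteq> N" using N(2) interior_subset by blast
      then have "negligible (interior T)" using N(1) negligible_subset negligible_iff_null_sets by blast
      then show False
        using open_not_negligible[OF open_interior] triangle.interior_nonempty[OF coarse.triangle[OF T]] by blast
    qed
  qed
qed

lemma chi_res_nonneg: "0 \<le> C \<Longrightarrow> 0 \<le> chi_res P C"
  using kH_norm_bounds(1) by (simp add: chi_res_def)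

text \<open>Since \<open>I_H w = 0\<close>, the approximation property bounds \<open>w\<close> itself on each triangle by its gradient on the
  neighbourhood.  Summation costs the overlap of the neighbourhoods, which is the patch factor in \<open>chi_res\<close>.\<close>

lemma resolution_estimate:
  assumes C: "0 < C" "approximation_const P C" and w: "w \<in> W_h P"
  shows "(wavenum P)\<^sup>2 * Re (ip (Om P) w w) \<le> (chi_res P C)\<^sup>2 * Re (grad_ip P (Om P) w w)"
proof -
  let ?N = "nbhd (coarse_mesh P)" and ?k = "wavenum P"
  have wV: "w \<in> V_h P" and I0: "I_H P w = (\<lambda>x. 0)" using w by (auto simp: W_h_def)
  have wH: "w \<in> H1 (Om P)" by (rule fe_space_H1[OF wV])
  let ?m = "\<lambda>S. LINT x|lebesgue_on S. (cmod (w x))\<^sup>2"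
  let ?g = "\<lambda>S i. LINT x|lebesgue_on S. (cmod (wgrad (Om P) w x $ i))\<^sup>2"
  have gi: "integrable (lebesgue_on (Om P)) (\<lambda>x. (cmod (wgrad (Om P) w x $ i))\<^sup>2)" for i
    using wgrad_L2[OF wH] by (simp add: L2_def)
  have mi: "integrable (lebesgue_on (Om P)) (\<lambda>x. (cmod (w x))\<^sup>2)"
    using H1_L2[OF wH] by (simp add: L2_def)
  have loc: "?k\<^sup>2 * ?m T \<le> C\<^sup>2 * kH_norm\<^sup>2 * (\<Sum>i\<in>UNIV. ?g (?N T) i)" if T: "T \<in> coarse_mesh P" for T
  proof -
    let ?G = "\<Sum>i\<in>UNIV. ?g (?N T) i"
    have d: "0 < diameter T" by (rule triangle.diameter_pos[OF coarse.triangle[OF T]])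
    have G: "0 \<le> ?G" by (intro sum_nonneg) simp
    have "L2norm T (\<lambda>x. w x - I_H P w x) / diameter T \<le> C * grad_norm P (?N T) w"
      using C(2) fe_space_Vspace[OF wV] T unfolding approximation_const_def by blast
    then have "sqrt (?m T) / diameter T \<le> C * sqrt ?G"
      unfolding L2norm_def grad_norm_def I0
      by (simp add: ip_self grad_ip_self[OF domain_lmeasurable(2) essential_nbhd[OF T] wH] del: of_real_power of_real_sum)
    then have "?k * sqrt (?m T) \<le> ?k * diameter T * (C * sqrt ?G)"
      using d wavenum_pos by (simp add: field_simps)
    also have "\<dots> \<le> kH_norm * (C * sqrt ?G)"
      using kH_norm_bounds(2)[OF T] C(1) G by (intro mult_right_mono) auto
    finally have "(?k * sqrt (?m T))\<^sup>2 \<le> (kH_norm * (C * sqrt ?G))\<^sup>2"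
      using wavenum_pos by (intro power_mono) auto
    then show ?thesis using G by (simp add: power_mult_distrib mult_ac)
  qed
  have "Re (ip (Om P) w w) = ?m (Om P)" by (simp add: ip_self del: of_real_power)
  also have "\<dots> \<le> (\<Sum>T\<in>coarse_mesh P. ?m T)"
  proof (rule integral_le_sum_of_cover[OF coarse.finite_mesh _ _ domain_lmeasurable(2) _ mi])
    show "Om P \<subseteq> \<Union> (coarse_mesh P)" using coarse.cover closure_subset by auto
    fix T assume T: "T \<in> coarse_mesh P"
    have e: "essential_part (Om P) T" by (rule coarse.essential_triangle[OF T])
    then show "T \<in> sets lebesgue" by (simp add: essential_part_def)
    show "integrable (lebesgue_on T) (\<lambda>x. (cmod (w x))\<^sup>2)"
      by (rule integrable_null_extension[OF mi domain_lmeasurable(2)]) (use e in \<open>auto simp: essential_part_def\<close>)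
  qed simp
  finally have "?k\<^sup>2 * Re (ip (Om P) w w) \<le> ?k\<^sup>2 * (\<Sum>T\<in>coarse_mesh P. ?m T)"
    by (rule mult_left_mono) simp
  also have "\<dots> = (\<Sum>T\<in>coarse_mesh P. ?k\<^sup>2 * ?m T)" by (rule sum_distrib_left)
  also have "\<dots> \<le> (\<Sum>T\<in>coarse_mesh P. C\<^sup>2 * kH_norm\<^sup>2 * (\<Sum>i\<in>UNIV. ?g (?N T) i))"
    by (intro sum_mono loc)
  also have "\<dots> = C\<^sup>2 * kH_norm\<^sup>2 * (\<Sum>i\<in>UNIV. \<Sum>T\<in>coarse_mesh P. ?g (?N T) i)"
    unfolding sum_distrib_left[symmetric] by (subst sum.swap) (rule refl)
  also have "\<dots> \<le> C\<^sup>2 * kH_norm\<^sup>2 * (\<Sum>i\<in>UNIV. real (C_patch P 1) * ?g (Om P) i)"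
    by (intro mult_left_mono sum_mono sum_nbhd_integral_le gi) auto
  also have "\<dots> = (chi_res P C)\<^sup>2 * (\<Sum>i\<in>UNIV. ?g (Om P) i)"
    by (simp add: chi_res_def power_mult_distrib sum_distrib_left mult_ac)
  also have "\<dots> = (chi_res P C)\<^sup>2 * Re (grad_ip P (Om P) w w)"
    by (simp add: grad_ip_self[OF domain_lmeasurable(2) essential_domain wH] del: of_real_power of_real_sum)
  finally show ?thesis .
qed

text \<open>The boundary integral of a squared modulus is real, so the Robin term is purely imaginary.\<close>

lemma Re_aform_self:
  "Re (aform P w w) = Re (grad_ip P (Om P) w w) - (wavenum P)\<^sup>2 * Re (ip (Om P) w w)"
proof -
  let ?r = "arc_integral (bedges P) (GamR P) (\<lambda>x. bdtrace (Om P) w x * cnj (bdtrace (Om P) w x))"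
  have "cnj ?r = ?r" by (subst arc_integral_cnj[symmetric]) (simp add: mult.commute)
  then have "Im ?r = 0" by (metis Reals_cnj_iff complex_is_Real_iff)
  then show ?thesis by (simp add: aform_def aform_on_def flip: of_real_power)
qed

text \<open>Writing \<open>g\<close> and \<open>m\<close> for the gradient and the mass term, \<open>m \<le> x g\<close> is equivalent to
  \<open>(1 - x) (g + m) \<le> (1 + x) (g - m)\<close>; here \<open>x\<close> is the square of \<open>chi_res\<close>.\<close>

lemma aform_coercive:
  assumes "0 < C" "approximation_const P C" "w \<in> W_h P"
  shows "c_W P C * (knorm P w)\<^sup>2 \<le> Re (aform P w w)"
proof -
  define g m x where "g = Re (grad_ip P (Om P) w w)" and "m = (wavenum P)\<^sup>2 * Re (ip (Om P) w w)"
    and "x = (chi_res P C)\<^sup>2"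
  have x: "0 \<le> x" by (simp add: x_def)
  have mg: "m \<le> x * g" using resolution_estimate[OF assms] by (simp add: m_def g_def x_def)
  have "(knorm P w)\<^sup>2 = g + m"
    using knorm_sq[of w] assms(3) W_h_sub by (auto simp: bform_def g_def m_def simp flip: of_real_power)
  moreover have "(1 - x) / (1 + x) * (g + m) \<le> g - m"
  proof -
    have "(1 - x) * (g + m) \<le> (g - m) * (1 + x)" using mg by (simp add: algebra_simps)
    then show ?thesis using x by (simp add: divide_le_eq)
  qed
  ultimately show ?thesis unfolding Re_aform_self c_W_def by (simp add: g_def m_def x_def)
qed

end

section \<open>Correctors\<close>

text \<open>Under the resolution condition \<open>a\<close> is coercive on the kernel of the quasi-interpolation, so all corrector
  problems are uniquely solvable and the definite descriptions denote their solutions.\<close>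

locale lod_stable = lod +
  fixes C_app :: real
  assumes C_app_pos: "0 < C_app" and C_app: "approximation_const P C_app"
    and resolved: "chi_res P C_app < 1"
begin

lemma c_W_pos: "0 < c_W P C_app"
proof -
  have "(chi_res P C_app)\<^sup>2 < 1"
    using chi_res_nonneg[of C_app] C_app_pos resolved by (simp add: power2_less_1_iff)
  then show ?thesis by (simp add: c_W_def add_pos_nonneg)
qed

lemma coercive: "w \<in> W_h P \<Longrightarrow> c_W P C_app * (knorm P w)\<^sup>2 \<le> Re (aform P w w)"
  by (rule aform_coercive[OF C_app_pos C_app])

lemma aform_definite:
  assumes "w \<in> W_h P" "w \<noteq> (\<lambda>x. 0)"
  shows "aform P w w \<noteq> 0"
proof -
  have "0 < c_W P C_app * (knorm P w)\<^sup>2"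
    using c_W_pos knorm_pos[of w] assms W_h_sub by auto
  then show ?thesis using coercive[OF assms(1)] by auto
qed

lemma corrector_ex1:
  assumes "csubspace W" "W \<subseteq> W_h P" "antilinear_on (V_h P) F"
  shows "\<exists>!q. q \<in> W \<and> (\<forall>w\<in>W. aform P q w = F w)"
proof (rule riesz_ex1[OF fine.finite_vertices assms(1)])
  have sub: "W \<subseteq> V_h P" using assms(2) W_h_sub by blast
  show "determined_on (vertices (fine_mesh P)) W" by (rule determined_on_subset[OF V_h_determined sub])
  show "sesquilinear_on W (aform P)" by (rule sesquilinear_on_subset[OF aform_sesquilinear sub])
  show "antilinear_on W F" by (rule antilinear_on_subset[OF assms(3) sub])
  show "aform P w w \<noteq> 0" if "w \<in> W" "w \<noteq> (\<lambda>x. 0)" for w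
    using aform_definite that assms(2) by blast
qed

lemma corrector_eqI:
  assumes "csubspace W" "W \<subseteq> W_h P" "antilinear_on (V_h P) F"
    and "q \<in> W" "\<And>w. w \<in> W \<Longrightarrow> aform P q w = F w"
  shows "(THE q. q \<in> W \<and> (\<forall>w\<in>W. aform P q w = F w)) = q"
  by (rule the1_equality[OF corrector_ex1[OF assms(1-3)]]) (use assms(4,5) in auto)

lemma antilinear_aform: "v \<in> V_h P \<Longrightarrow> antilinear_on (V_h P) (aform P v)"
  by (rule sesquilinear_on_antilinear[OF aform_sesquilinear])

lemma antilinear_aform_loc: "T \<in> coarse_mesh P \<Longrightarrow> v \<in> V_h P \<Longrightarrow> antilinear_on (V_h P) (aform_loc P T v)"
  by (rule sesquilinear_on_antilinear[OF aform_loc_sesquilinear])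

lemma Q_ideal:
  assumes "v \<in> V_h P"
  shows "Q_ideal P v \<in> W_h P" "w \<in> W_h P \<Longrightarrow> aform P (Q_ideal P v) w = aform P v w"
  using theI'[OF corrector_ex1[OF csubspace_W_h order_refl antilinear_aform[OF assms]]]
  unfolding Q_ideal_def by blast+

lemma q_loc:
  assumes "T \<in> coarse_mesh P" "v \<in> V_h P"
  shows "q_loc P l T v \<in> W_loc P l T"
    "w \<in> W_loc P l T \<Longrightarrow> aform P (q_loc P l T v) w = aform_loc P T v w"
  using theI'[OF corrector_ex1[OF csubspace_W_loc W_loc_sub antilinear_aform_loc[OF assms]], of l T]
  unfolding q_loc_def by blast+

lemma Q_ideal_axpy:
  assumes "u \<in> V_h P" "v \<in> V_h P"
  shows "Q_ideal P (\<lambda>x. u x + c * v x) = (\<lambda>x. Q_ideal P u x + c * Q_ideal P v x)"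
  unfolding Q_ideal_def[of P "\<lambda>x. u x + c * v x"]
proof (rule corrector_eqI[OF csubspace_W_h order_refl antilinear_aform])
  show "(\<lambda>x. u x + c * v x) \<in> V_h P" by (rule csubspace_axpy[OF csubspace_fe_space assms])
  show "(\<lambda>x. Q_ideal P u x + c * Q_ideal P v x) \<in> W_h P"
    by (rule csubspace_axpy[OF csubspace_W_h Q_ideal(1)[OF assms(1)] Q_ideal(1)[OF assms(2)]])
  fix w assume w: "w \<in> W_h P"
  then have wV: "w \<in> V_h P" using W_h_sub by blast
  have Q: "Q_ideal P u \<in> V_h P" "Q_ideal P v \<in> V_h P" using Q_ideal(1) assms W_h_sub by blast+
  show "aform P (\<lambda>x. Q_ideal P u x + c * Q_ideal P v x) w = aform P (\<lambda>x. u x + c * v x) w"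
    by (simp only: sesquilinear_on_left[OF aform_sesquilinear wV Q]
        sesquilinear_on_left[OF aform_sesquilinear wV assms] Q_ideal(2)[OF assms(1) w] Q_ideal(2)[OF assms(2) w])
qed

lemma q_loc_axpy:
  assumes T: "T \<in> coarse_mesh P" and uv: "u \<in> V_h P" "v \<in> V_h P"
  shows "q_loc P l T (\<lambda>x. u x + c * v x) = (\<lambda>x. q_loc P l T u x + c * q_loc P l T v x)"
  unfolding q_loc_def[of P l T "\<lambda>x. u x + c * v x"]
proof (rule corrector_eqI[OF csubspace_W_loc W_loc_sub antilinear_aform_loc[OF T]])
  show "(\<lambda>x. u x + c * v x) \<in> V_h P" by (rule csubspace_axpy[OF csubspace_fe_space uv])
  show "(\<lambda>x. q_loc P l T u x + c * q_loc P l T v x) \<in> W_loc P l T"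
    by (rule csubspace_axpy[OF csubspace_W_loc q_loc(1)[OF T uv(1)] q_loc(1)[OF T uv(2)]])
  fix w assume w: "w \<in> W_loc P l T"
  have sub: "W_loc P l T \<subseteq> V_h P" using W_loc_sub W_h_sub by blast
  then have wV: "w \<in> V_h P" using w by blast
  have q: "q_loc P l T u \<in> V_h P" "q_loc P l T v \<in> V_h P" using q_loc(1)[OF T] uv sub by blast+
  show "aform P (\<lambda>x. q_loc P l T u x + c * q_loc P l T v x) w = aform_loc P T (\<lambda>x. u x + c * v x) w"
    by (simp only: sesquilinear_on_left[OF aform_sesquilinear wV q]
        sesquilinear_on_left[OF aform_loc_sesquilinear[OF T] wV uv] q_loc(2)[OF T uv(1) w] q_loc(2)[OF T uv(2) w])
qed

lemma Q_loc_W_h: "v \<in> V_h P \<Longrightarrow> Q_loc P l v \<in> W_h P"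
  unfolding Q_loc_def using q_loc(1) W_loc_sub by (intro csubspace_sum[OF csubspace_W_h]) blast

lemma defect_W_h: "v \<in> V_h P \<Longrightarrow> defect P l v \<in> W_h P"
  unfolding defect_def by (intro csubspace_diff[OF csubspace_W_h] Q_ideal(1) Q_loc_W_h)

lemma defect_axpy:
  assumes "u \<in> V_h P" "v \<in> V_h P"
  shows "defect P l (\<lambda>x. u x + c * v x) = (\<lambda>x. defect P l u x + c * defect P l v x)"
  by (simp add: defect_def Q_loc_def Q_ideal_axpy assms q_loc_axpy sum.distrib sum_distrib_left algebra_simps)

lemma aform_cnj_cnj: "v \<in> V_h P \<Longrightarrow> w \<in> V_h P \<Longrightarrow> aform P (\<lambda>x. cnj (w x)) (\<lambda>x. cnj (v x)) = aform P v w"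
  unfolding aform_def by (rule aform_on_cnj_cnj[OF essential_domain])

lemma aform_loc_cnj_cnj:
  "T \<in> coarse_mesh P \<Longrightarrow> v \<in> V_h P \<Longrightarrow> w \<in> V_h P \<Longrightarrow>
     aform_loc P T (\<lambda>x. cnj (w x)) (\<lambda>x. cnj (v x)) = aform_loc P T v w"
  unfolding aform_loc_def by (rule aform_on_cnj_cnj[OF coarse.essential_triangle])

text \<open>The local spaces are closed under conjugation, and \<open>q\<close> solves the adjoint problem for \<open>v\<close> if and only if its
  conjugate solves the primal problem for the conjugate of \<open>v\<close>.\<close>

lemma q_loc_adj_eq:
  assumes T: "T \<in> coarse_mesh P" and v: "v \<in> V_h P"
  shows "q_loc_adj P l T v = (\<lambda>x. cnj (q_loc P l T (\<lambda>x. cnj (v x)) x))"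
proof -
  let ?W = "W_loc P l T" and ?v = "\<lambda>x. cnj (v x)"
  have sub: "?W \<subseteq> V_h P" using W_loc_sub W_h_sub by blast
  have cv: "?v \<in> V_h P" by (rule cnj_fe_space[OF v])
  have adj_iff: "(\<forall>w\<in>?W. aform P w q = aform_loc P T w v)
      \<longleftrightarrow> (\<forall>w\<in>?W. aform P (\<lambda>x. cnj (q x)) w = aform_loc P T ?v w)" if q: "q \<in> ?W" for q
  proof -
    have *: "aform P w q = aform_loc P T w v
      \<longleftrightarrow> aform P (\<lambda>x. cnj (q x)) (\<lambda>x. cnj (w x)) = aform_loc P T ?v (\<lambda>x. cnj (w x))" if "w \<in> ?W" for w
    proof -
      have "w \<in> V_h P" "q \<in> V_h P" using that q sub by auto
      then show ?thesis by (simp add: aform_cnj_cnj aform_loc_cnj_cnj[OF T] v)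
    qed
    show ?thesis
    proof (intro iffI ballI)
      fix w assume w: "w \<in> ?W" and "\<forall>w\<in>?W. aform P w q = aform_loc P T w v"
      then show "aform P (\<lambda>x. cnj (q x)) w = aform_loc P T ?v w"
        using *[OF cnj_W_loc[OF w]] cnj_W_loc[OF w] by simp
    next
      fix w assume w: "w \<in> ?W" and "\<forall>w\<in>?W. aform P (\<lambda>x. cnj (q x)) w = aform_loc P T ?v w"
      then show "aform P w q = aform_loc P T w v"
        using *[OF w] cnj_W_loc[OF w] by simp
    qed
  qed
  show ?thesis
    unfolding q_loc_adj_def
  proof (rule the_equality)
    have q: "q_loc P l T ?v \<in> ?W" by (rule q_loc(1)[OF T cv])
    show "(\<lambda>x. cnj (q_loc P l T ?v x)) \<in> ?W \<and> (\<forall>w\<in>?W. aform P w (\<lambda>x. cnj (q_loc P l T ?v x)) = aform_loc P T w v)"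
      using adj_iff[OF cnj_W_loc[OF q]] cnj_W_loc[OF q] q_loc(2)[OF T cv] by simp
    fix q assume "q \<in> ?W \<and> (\<forall>w\<in>?W. aform P w q = aform_loc P T w v)"
    then have "q_loc P l T ?v = (\<lambda>x. cnj (q x))"
      unfolding q_loc_def using adj_iff[of q] cnj_W_loc[of q]
      by (intro corrector_eqI[OF csubspace_W_loc W_loc_sub antilinear_aform_loc[OF T cv]]) auto
    then show "q = (\<lambda>x. cnj (q_loc P l T ?v x))" by simp
  qed
qed

lemma Q_loc_adj_eq: "v \<in> V_h P \<Longrightarrow> Q_loc_adj P l v = (\<lambda>x. cnj (Q_loc P l (\<lambda>x. cnj (v x)) x))"
  by (simp add: Q_loc_adj_def Q_loc_def q_loc_adj_eq)

section \<open>The residual represents the adjoint defect\<close>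

text \<open>The difference of the ideal and the localized adjoint corrector, written through the primal
  correctors by conjugation.\<close>

definition defect_adj :: "enat \<Rightarrow> cfun \<Rightarrow> cfun" where
  "defect_adj l v = (\<lambda>x. cnj (defect P l (\<lambda>x. cnj (v x)) x))"

lemma defect_adj_W_h: "v \<in> V_h P \<Longrightarrow> defect_adj l v \<in> W_h P"
  unfolding defect_adj_def by (intro cnj_W_h defect_W_h cnj_fe_space)

lemma knorm_defect_adj: "v \<in> V_h P \<Longrightarrow> knorm P (defect_adj l v) = knorm P (defect P l (\<lambda>x. cnj (v x)))"
  unfolding defect_adj_def using defect_W_h[OF cnj_fe_space] W_h_sub by (intro knorm_cnj) blast

lemma T_adj_V_h: "v \<in> V_h P \<Longrightarrow> T_adj P l v \<in> V_h P"
  unfolding T_adj_def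
  using cnj_W_h[OF Q_loc_W_h[OF cnj_fe_space], of v] W_h_sub
  by (intro csubspace_diff[OF csubspace_fe_space]) (auto simp: Q_loc_adj_eq)

text \<open>The key identity.  On \<open>W_h\<close> the ideal adjoint corrector \<open>Q\<close> satisfies \<open>a(w, Q) = a(w, v)\<close>, so in \<open>a(w, T_adj v)\<close>
  the function \<open>v\<close> may be replaced by \<open>Q\<close>, and what is left is the adjoint defect.\<close>

lemma residual_eq:
  assumes v: "v \<in> V_h P" and w: "w \<in> W_h P"
  shows "G_res P l v w = cnj (aform P w (defect_adj l v))"
proof -
  let ?v = "\<lambda>x. cnj (v x)"
  have cv: "?v \<in> V_h P" by (rule cnj_fe_space[OF v])
  have wV: "w \<in> V_h P" using w W_h_sub by blast
  have QV: "Q_ideal P ?v \<in> V_h P" "Q_loc P l ?v \<in> V_h P"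
    using Q_ideal(1)[OF cv] Q_loc_W_h[OF cv] W_h_sub by blast+
  let ?Q = "\<lambda>x. cnj (Q_ideal P ?v x)" and ?L = "\<lambda>x. cnj (Q_loc P l ?v x)"
  have "aform P w ?Q = aform P (Q_ideal P ?v) (\<lambda>x. cnj (w x))"
    using aform_cnj_cnj[OF QV(1) cnj_fe_space[OF wV]] by simp
  also have "\<dots> = aform P ?v (\<lambda>x. cnj (w x))" by (rule Q_ideal(2)[OF cv cnj_W_h[OF w]])
  also have "\<dots> = aform P w v" by (rule aform_cnj_cnj[OF wV v])
  finally have Q: "aform P w ?Q = aform P w v" .
  note diff = antilinear_on_diff[OF antilinear_aform[OF wV]]
  have "aform P w (T_adj P l v) = aform P w v - aform P w ?L"
    unfolding T_adj_def Q_loc_adj_eq[OF v] by (rule diff[OF v cnj_fe_space[OF QV(2)]])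
  also have "\<dots> = aform P w (\<lambda>x. ?Q x - ?L x)"
    using diff[OF cnj_fe_space[OF QV(1)] cnj_fe_space[OF QV(2)]] Q by simp
  also have "(\<lambda>x. ?Q x - ?L x) = defect_adj l v" by (simp add: defect_adj_def defect_def)
  finally show ?thesis by (simp add: G_res_def)
qed

lemma W_vertex_sub: "W_vertex P z \<subseteq> W_h P"
  unfolding W_vertex_def by (rule W_loc_sub)

lemma xi_residual:
  assumes v: "v \<in> V_h P"
  shows "xi P (G_res P l v) z \<in> W_vertex P z"
    and "w \<in> W_vertex P z \<Longrightarrow> bform P (xi P (G_res P l v) z) w = G_res P l v w"
proof -
  have sub: "W_vertex P z \<subseteq> V_h P" using W_vertex_sub W_h_sub by blast
  have "\<exists>!q. q \<in> W_vertex P z \<and> (\<forall>w\<in>W_vertex P z. bform P q w = G_res P l v w)"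
  proof (rule riesz_ex1[OF fine.finite_vertices])
    show "csubspace (W_vertex P z)" unfolding W_vertex_def by (rule csubspace_W_loc)
    show "determined_on (vertices (fine_mesh P)) (W_vertex P z)" by (rule determined_on_subset[OF V_h_determined sub])
    show "sesquilinear_on (W_vertex P z) (bform P)"
      by (rule sesquilinear_on_subset[OF semi_inner_on_sesquilinear[OF bform_semi_inner] sub])
    show "bform P w w \<noteq> 0" if "w \<in> W_vertex P z" "w \<noteq> (\<lambda>x. 0)" for w
      using bform_definite that sub by blast
    have "antilinear_on (V_h P) (\<lambda>w. cnj (aform P w (T_adj P l v)))"
      by (rule sesquilinear_on_antilinear_cnj[OF aform_sesquilinear T_adj_V_h[OF v]])
    then show "antilinear_on (W_vertex P z) (G_res P l v)"
      unfolding G_res_def[abs_def] by (rule antilinear_on_subset[OF _ sub])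
  qed
  from theI'[OF this] show "xi P (G_res P l v) z \<in> W_vertex P z"
    and "w \<in> W_vertex P z \<Longrightarrow> bform P (xi P (G_res P l v) z) w = G_res P l v w"
    unfolding xi_def by blast+
qed

lemma eta_sq: "(eta P G)\<^sup>2 = (\<Sum>z\<in>vertices (coarse_mesh P). (knorm P (xi P G z))\<^sup>2)"
  unfolding eta_def by (simp add: sum_nonneg)

lemma eta_nonneg: "0 \<le> eta P G"
  unfolding eta_def by (simp add: sum_nonneg)

lemma antilinear_residual_defect: "v \<in> V_h P \<Longrightarrow> antilinear_on (W_h P) (\<lambda>w. cnj (aform P w (defect_adj l v)))"
  using sesquilinear_on_antilinear_cnj[OF aform_sesquilinear] defect_adj_W_h W_h_sub
  by (intro antilinear_on_subset[OF _ W_h_sub]) blast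

lemma residual_sum:
  assumes v: "v \<in> V_h P" and w: "\<And>z. z \<in> I \<Longrightarrow> wz z \<in> W_h P"
  shows "G_res P l v (\<lambda>x. \<Sum>z\<in>I. wz z x) = (\<Sum>z\<in>I. G_res P l v (wz z))"
proof -
  have "G_res P l v (\<lambda>x. \<Sum>z\<in>I. wz z x) = cnj (aform P (\<lambda>x. \<Sum>z\<in>I. wz z x) (defect_adj l v))"
    by (rule residual_eq[OF v csubspace_sum[OF csubspace_W_h w]])
  also have "\<dots> = (\<Sum>z\<in>I. cnj (aform P (wz z) (defect_adj l v)))"
    by (rule antilinear_on_sum[OF csubspace_W_h antilinear_residual_defect[OF v] w])
  also have "\<dots> = (\<Sum>z\<in>I. G_res P l v (wz z))"
    by (intro sum.cong refl residual_eq[OF v w, symmetric])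
  finally show ?thesis .
qed

text \<open>Testing the residual with the sum of its local representatives reproduces the square of \<open>\<eta>\<close>; continuity of
  \<open>a\<close> and the synthesis bound control that test function by \<open>C_syn \<eta>\<close>.\<close>

lemma efficiency:
  assumes v: "v \<in> V_h P" and Ca: "0 < C_a" "continuity_const P C_a"
    and Csyn: "0 < C_syn" "synthesis_const P C_syn"
  shows "eta P (G_res P l v) \<le> C_a * C_syn * knorm P (defect_adj l v)"
proof -
  let ?Z = "vertices (coarse_mesh P)" and ?\<xi> = "xi P (G_res P l v)" and ?\<eta> = "eta P (G_res P l v)"
  let ?u = "defect_adj l v" and ?s = "\<lambda>x. \<Sum>z\<in>vertices (coarse_mesh P). xi P (G_res P l v) z x"
  have \<xi>: "?\<xi> z \<in> W_vertex P z" "?\<xi> z \<in> W_h P" "?\<xi> z \<in> V_h P" for z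
    using xi_residual(1)[OF v] W_vertex_sub W_h_sub by blast+
  have s: "?s \<in> W_h P" by (rule csubspace_sum[OF csubspace_W_h \<xi>(2)])
  have sV: "?s \<in> V_h P" "?u \<in> V_h P" using s defect_adj_W_h[OF v] W_h_sub by blast+
  have syn: "(knorm P ?s)\<^sup>2 \<le> C_syn\<^sup>2 * ?\<eta>\<^sup>2"
    unfolding eta_sq
    by (rule mp[OF spec[OF Csyn(2)[unfolded synthesis_const_def]]]) (use \<xi>(1) in blast)
  then have "(knorm P ?s)\<^sup>2 \<le> (C_syn * ?\<eta>)\<^sup>2" by (simp add: power_mult_distrib)
  then have ns: "knorm P ?s \<le> C_syn * ?\<eta>"
    by (rule power2_le_imp_le) (simp add: Csyn(1) eta_nonneg less_imp_le)
  have "?\<eta>\<^sup>2 = Re (\<Sum>z\<in>?Z. bform P (?\<xi> z) (?\<xi> z))"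
    unfolding eta_sq Re_sum by (intro sum.cong refl knorm_sq \<xi>(3))
  also have "(\<Sum>z\<in>?Z. bform P (?\<xi> z) (?\<xi> z)) = (\<Sum>z\<in>?Z. G_res P l v (?\<xi> z))"
    by (intro sum.cong refl xi_residual(2)[OF v \<xi>(1)])
  also have "\<dots> = G_res P l v ?s" by (rule residual_sum[OF v \<xi>(2), symmetric])
  also have "Re (G_res P l v ?s) \<le> cmod (aform P ?s ?u)"
    unfolding residual_eq[OF v s] using complex_Re_le_cmod[of "cnj (aform P ?s ?u)"] by simp
  also have "\<dots> \<le> C_a * knorm P ?s * knorm P ?u"
    by (rule bspec[OF bspec[OF Ca(2)[unfolded continuity_const_def] fe_space_Vspace[OF sV(1)]]
          fe_space_Vspace[OF sV(2)]])
  also have "\<dots> \<le> C_a * (C_syn * ?\<eta>) * knorm P ?u"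
    using Ca(1) knorm_nonneg[OF sV(2)] by (intro mult_right_mono mult_left_mono ns) auto
  finally have *: "?\<eta> * ?\<eta> \<le> (C_a * C_syn * knorm P ?u) * ?\<eta>" by (simp add: power2_eq_square mult_ac)
  show ?thesis
  proof (cases "?\<eta> = 0")
    case True
    then show ?thesis using Ca(1) Csyn(1) knorm_nonneg[OF sV(2)] by simp
  next
    case False
    then have "0 < ?\<eta>" using eta_nonneg[of "G_res P l v"] by simp
    then show ?thesis using * by (simp only: mult_le_cancel_right_pos)
  qed
qed

text \<open>Coercivity bounds the defect by the residual tested with the defect itself.  A stable decomposition
  of the defect localizes this value, and there the representatives of the residual take over.\<close>

lemma reliability:
  assumes v: "v \<in> V_h P" and Csd: "0 < C_sd" "stable_decomposition_const P C_sd"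
  shows "knorm P (defect_adj l v) \<le> C_sd / c_W P C_app * eta P (G_res P l v)"
proof -
  let ?Z = "vertices (coarse_mesh P)" and ?\<xi> = "xi P (G_res P l v)" and ?\<eta> = "eta P (G_res P l v)"
  let ?u = "defect_adj l v"
  have u: "?u \<in> W_h P" by (rule defect_adj_W_h[OF v])
  then have uV: "?u \<in> V_h P" using W_h_sub by blast
  obtain wz where wz: "\<forall>z\<in>?Z. wz z \<in> W_vertex P z" "?u = (\<lambda>x. \<Sum>z\<in>?Z. wz z x)"
    "(\<Sum>z\<in>?Z. (knorm P (wz z))\<^sup>2) \<le> C_sd\<^sup>2 * (knorm P ?u)\<^sup>2"
    using bspec[OF Csd(2)[unfolded stable_decomposition_const_def] u] by blast
  have wV: "wz z \<in> W_h P" "wz z \<in> V_h P" if "z \<in> ?Z" for z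
    using wz(1) that W_vertex_sub W_h_sub by blast+
  have \<xi>V: "?\<xi> z \<in> V_h P" for z using xi_residual(1)[OF v] W_vertex_sub W_h_sub by blast
  have "c_W P C_app * (knorm P ?u)\<^sup>2 \<le> Re (aform P ?u ?u)" by (rule coercive[OF u])
  also have "\<dots> = Re (G_res P l v ?u)" by (simp add: residual_eq[OF v u])
  also have "G_res P l v ?u = G_res P l v (\<lambda>x. \<Sum>z\<in>?Z. wz z x)"
    by (rule arg_cong[OF wz(2)])
  also have "\<dots> = (\<Sum>z\<in>?Z. G_res P l v (wz z))" by (rule residual_sum[OF v wV(1)])
  also have "\<dots> = (\<Sum>z\<in>?Z. bform P (?\<xi> z) (wz z))"
    using wz(1) by (intro sum.cong refl xi_residual(2)[OF v, symmetric]) auto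
  also have "Re \<dots> \<le> (\<Sum>z\<in>?Z. knorm P (?\<xi> z) * knorm P (wz z))"
    unfolding Re_sum
  proof (rule sum_mono)
    fix z assume "z \<in> ?Z"
    then show "Re (bform P (?\<xi> z) (wz z)) \<le> knorm P (?\<xi> z) * knorm P (wz z)"
      using semi_inner_on_cauchy_schwarz[OF bform_semi_inner csubspace_fe_space \<xi>V wV(2), of z z]
        complex_Re_le_cmod[of "bform P (?\<xi> z) (wz z)"]
      unfolding knorm_def by linarith
  qed
  also have "\<dots> \<le> L2_set (\<lambda>z. knorm P (?\<xi> z)) ?Z * L2_set (\<lambda>z. knorm P (wz z)) ?Z"
    using L2_set_mult_ineq[of "\<lambda>z. knorm P (?\<xi> z)" "\<lambda>z. knorm P (wz z)" ?Z] knorm_nonneg \<xi>V wV(2)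
    by simp
  also have "\<dots> \<le> ?\<eta> * (C_sd * knorm P ?u)"
  proof (rule mult_mono)
    show "L2_set (\<lambda>z. knorm P (?\<xi> z)) ?Z \<le> ?\<eta>" by (simp add: L2_set_def eta_def)
    show "L2_set (\<lambda>z. knorm P (wz z)) ?Z \<le> C_sd * knorm P ?u"
      unfolding L2_set_def
      by (rule real_le_lsqrt) (use wz(3) Csd(1) knorm_nonneg[OF uV] in \<open>auto simp: power_mult_distrib sum_nonneg\<close>)
  qed (use eta_nonneg in \<open>auto simp: L2_set_nonneg\<close>)
  finally have *: "(c_W P C_app * knorm P ?u) * knorm P ?u \<le> (C_sd * ?\<eta>) * knorm P ?u"
    by (simp add: power2_eq_square mult_ac)
  show ?thesis
  proof (cases "knorm P ?u = 0")
    case True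
    then show ?thesis using Csd(1) c_W_pos eta_nonneg by simp
  next
    case False
    then have "0 < knorm P ?u" using knorm_nonneg[OF uV] by simp
    then have "c_W P C_app * knorm P ?u \<le> C_sd * ?\<eta>" using * by (simp only: mult_le_cancel_right_pos)
    then show ?thesis using c_W_pos by (simp add: field_simps)
  qed
qed

section \<open>Comparison of the suprema\<close>

text \<open>The defect is linear on a finite-dimensional space.\<close>

lemma defect_bounded: "\<exists>C. \<forall>v\<in>V_H P. knorm P (defect P l v) \<le> C * knorm P v"
proof -
  have dV: "defect P l v \<in> V_h P" if "v \<in> V_H P" for v
    using defect_W_h that V_H_subset_V_h W_h_sub by blast
  have "\<exists>C. \<forall>w\<in>V_H P. knorm P (defect P l w) \<le> C * sqrt (Re (bform P w w))"
  proof (rule seminorm_bounded[where B = "bform P" and p = "\<lambda>w. knorm P (defect P l w)", OF fine.finite_vertices csubspace_fe_space])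
    show "determined_on (vertices (fine_mesh P)) (V_H P)"
      by (rule determined_on_subset[OF V_h_determined V_H_subset_V_h])
    show "semi_inner_on (V_H P) (bform P)"
      using sesquilinear_on_subset[OF semi_inner_on_sesquilinear[OF bform_semi_inner] V_H_subset_V_h]
        bform_semi_inner V_H_subset_V_h unfolding semi_inner_on_def by blast
    show "bform P w w \<noteq> 0" if "w \<in> V_H P" "w \<noteq> (\<lambda>x. 0)" for w
      using bform_definite that V_H_subset_V_h by blast
    show "knorm P (defect P l (\<lambda>x. u x + c * v x)) \<le> knorm P (defect P l u) + cmod c * knorm P (defect P l v)"
      if "u \<in> V_H P" "v \<in> V_H P" for c u v
    proof -
      have uv: "u \<in> V_h P" "v \<in> V_h P" using that V_H_subset_V_h by blast+
      show ?thesis unfolding defect_axpy[OF uv] knorm_def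
        by (rule semi_inner_on_triangle[OF bform_semi_inner csubspace_fe_space dV[OF that(1)] dV[OF that(2)]])
    qed
    have z: "(\<lambda>x. 0) \<in> V_h P" by (rule csubspace_zero[OF csubspace_fe_space])
    have "defect P l (\<lambda>x. 0) = (\<lambda>x. 0)" using defect_axpy[OF z z, of l "-1"] by simp
    moreover have "bform P (\<lambda>x. 0) (\<lambda>x. 0) = 0"
      by (rule antilinear_on_zero[OF csubspace_fe_space
            sesquilinear_on_antilinear[OF semi_inner_on_sesquilinear[OF bform_semi_inner] z]])
    ultimately show "knorm P (defect P l (\<lambda>x. 0)) = 0" by (simp add: knorm_def)
  qed
  then show ?thesis by (simp add: knorm_def)
qed

text \<open>Conjugation permutes the nonzero coarse functions and preserves their norm, so a pointwise comparison of the
  indicator of \<open>v\<close> with the adjoint defect of \<open>v\<close>, which is the conjugate of the primal defect of the conjugate of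
  \<open>v\<close>, bounds each supremum by the other.  The boundedness of the sets passes from the defect to the indicator.\<close>

lemma two_sided_bound:
  assumes Ca: "0 < C_a" "continuity_const P C_a" and Csd: "0 < C_sd" "stable_decomposition_const P C_sd"
    and Csyn: "0 < C_syn" "synthesis_const P C_syn"
  shows "Theta P l / (C_a * C_syn) \<le> delta P l" "delta P l \<le> C_sd / c_W P C_app * Theta P l"
proof -
  let ?S = "{v \<in> V_H P. v \<noteq> (\<lambda>x. 0)}"
  let ?d = "\<lambda>v. knorm P (defect P l v) / knorm P v"
  let ?t = "\<lambda>v. eta P (G_res P l v) / knorm P v"
  have delta: "delta P l = Sup (insert 0 (?d ` ?S))"
    unfolding delta_def by (rule arg_cong[of _ _ Sup]) auto
  have Theta: "Theta P l = Sup (insert 0 (?t ` ?S))"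
    unfolding Theta_def by (rule arg_cong[of _ _ Sup]) auto
  have cnjS: "(\<lambda>x. cnj (v x)) \<in> ?S" if v: "v \<in> ?S" for v
  proof -
    have "v = (\<lambda>x. 0)" if "(\<lambda>x. cnj (v x)) = (\<lambda>x. 0)" using that by (simp add: fun_eq_iff)
    then show ?thesis using v cnj_fe_space by blast
  qed
  have SV: "v \<in> V_h P" "0 < knorm P v" if "v \<in> ?S" for v
    using that V_H_subset_V_h knorm_pos by blast+
  obtain C where C: "\<forall>v\<in>V_H P. knorm P (defect P l v) \<le> C * knorm P v" using defect_bounded by blast
  have "?d v \<le> C" if "v \<in> ?S" for v using C that SV(2)[OF that] by (simp add: field_simps)
  then have "bdd_above (?d ` ?S)" by (rule bdd_aboveI2)
  then have bd: "bdd_above (insert 0 (?d ` ?S))" by simp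
  have d0: "0 \<le> delta P l" unfolding delta by (rule cSup_upper[OF _ bd]) simp
  have t_le: "?t v \<le> C_a * C_syn * delta P l" if v: "v \<in> ?S" for v
  proof -
    have "?d (\<lambda>x. cnj (v x)) \<le> delta P l" unfolding delta
      by (rule cSup_upper[OF _ bd]) (use cnjS[OF v] in blast)
    then have "C_a * C_syn * (knorm P (defect_adj l v) / knorm P v) \<le> C_a * C_syn * delta P l"
      using SV[OF v] Ca(1) Csyn(1) by (intro mult_left_mono) (simp_all add: knorm_defect_adj knorm_cnj)
    moreover have "?t v \<le> C_a * C_syn * knorm P (defect_adj l v) / knorm P v"
      using efficiency[OF SV(1)[OF v] Ca Csyn] SV(2)[OF v] by (intro divide_right_mono) auto
    ultimately show ?thesis by simp
  qed
  have "Theta P l \<le> C_a * C_syn * delta P l"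
    unfolding Theta by (rule cSup_least) (use t_le d0 Ca(1) Csyn(1) in auto)
  then show "Theta P l / (C_a * C_syn) \<le> delta P l"
    using Ca(1) Csyn(1) by (simp add: field_simps)
  have bt: "bdd_above (insert 0 (?t ` ?S))" using bdd_aboveI2[of ?S ?t, OF t_le] by simp
  have t0: "0 \<le> Theta P l" unfolding Theta by (rule cSup_upper[OF _ bt]) simp
  have K: "0 \<le> C_sd / c_W P C_app" using Csd(1) c_W_pos by simp
  have d_le: "?d v \<le> C_sd / c_W P C_app * Theta P l" if v: "v \<in> ?S" for v
  proof -
    let ?v = "\<lambda>x. cnj (v x)"
    have cv: "?v \<in> ?S" by (rule cnjS[OF v])
    have "?t ?v \<le> Theta P l" unfolding Theta by (rule cSup_upper[OF _ bt]) (use cv in blast)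
    then have "C_sd / c_W P C_app * ?t ?v \<le> C_sd / c_W P C_app * Theta P l"
      using K by (rule mult_left_mono)
    moreover have "knorm P (defect P l v) \<le> C_sd / c_W P C_app * eta P (G_res P l ?v)"
      using reliability[OF SV(1)[OF cv] Csd, of l] knorm_defect_adj[OF SV(1)[OF cv], of l] by simp
    then have "?d v \<le> C_sd / c_W P C_app * eta P (G_res P l ?v) / knorm P v"
      using SV(2)[OF v] by (intro divide_right_mono) auto
    ultimately show ?thesis using knorm_cnj[OF SV(1)[OF v]] by simp
  qed
  show "delta P l \<le> C_sd / c_W P C_app * Theta P l"
    unfolding delta by (rule cSup_least) (use d_le mult_nonneg_nonneg[OF K t0] in auto)
qed

end

theorem theorem3p4:
  fixes P :: lod_problem and k_min \<kappa>_H \<kappa>_h \<chi>\<^sub>0 C_a C_app C_sd C_syn :: real and l :: enat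
  assumes "lod_setting P"
    and "shape_regular \<kappa>_H (coarse_mesh P)" and "shape_regular \<kappa>_h (fine_mesh P)"
    and "0 < k_min" and "k_min \<le> wavenum P"
    and "0 < C_a" and "continuity_const P C_a"
    and "0 < C_app" and "approximation_const P C_app"
    and "0 < C_sd" and "stable_decomposition_const P C_sd"
    and "0 < C_syn" and "synthesis_const P C_syn"
    and "chi_res P C_app \<le> \<chi>\<^sub>0" and "\<chi>\<^sub>0 < 1"
  shows "Theta P l / (C_a * C_syn) \<le> delta P l \<and>
         delta P l \<le> C_sd / c_W P C_app * Theta P l"
proof -
  interpret lod_stable P C_app
    by unfold_locales (use assms in auto)
  show ?thesis using two_sided_bound[of C_a C_sd C_syn l] assms by blast
qed

end
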